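(* Let $m\in\mathbb{N}$, $0<R\le\infty$, $F\in\mathcal{H}^m_R$, and let $f_i:\Omega\to(-R,R)$ satisfy $H_{\boldsymbol\lambda}(\boldsymbol b,\boldsymbol a)\int_{\Omega}\left|\frac{\partial^{\boldsymbol\lambda}f_i(\boldsymbol x)}{\Delta\boldsymbol x^{\boldsymbol\lambda}}\right|\Delta\boldsymbol x<R$ for $i=1,\dots,m$. If $f_i\in\mathcal{L}^1_{\boldsymbol a}(\Omega,1,\boldsymbol\lambda)$ for all $i=1,\dots,m$, then $$\int_{\Omega}\left(\sum_{i=1}^m D_iF(|f_1(\boldsymbol x)|,\dots,|f_m(\boldsymbol x)|)\left|\frac{\partial^{\boldsymbol\lambda}f_i(\boldsymbol x)}{\Delta\boldsymbol x^{\boldsymbol\lambda}}\right|\right)\Delta\boldsymbol x$$ $$\le\ \frac{1}{H_{\boldsymbol\lambda}(\boldsymbol b,\boldsymbol a)}F\left(H_{\boldsymbol\lambda}(\boldsymbol b,\boldsymbol a)\int_{\Omega}\left|\frac{\partial^{\boldsymbol\lambda}f_1(\boldsymbol x)}{\Delta\boldsymbol x^{\boldsymbol\lambda}}\right|\Delta\boldsymbol x,\dots,H_{\boldsymbol\lambda}(\boldsymbol b,\boldsymbol a)\int_{\Omega}\left|\frac{\partial^{\boldsymbol\lambda}f_m(\boldsymbol x)}{\Delta\boldsymbol x^{\boldsymbol\lambda}}\right|\Delta\boldsymbol x\right).$$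
   Context: Let $n\in\mathbb{N}$, let $\mathbb{T}_1,\dots,\mathbb{T}_n$ be time scales (nonempty closed subsets of $\mathbb{R}$) with forward and backward jump operators $\sigma_j,\rho_j$, and $\Lambda^n=\mathbb{T}_1\times\cdots\times\mathbb{T}_n$. Put $\rho_j^0(x_j)=x_j$ and $\rho_j^k=\rho_j\circ\rho_j^{k-1}$. Inequalities between vectors are componentwise ($\boldsymbol x<\boldsymbol y$ means $x_j<y_j$ for all $j$). $\boldsymbol\lambda=(\lambda_1,\dots,\lambda_n)$ is a multi-index with $\boldsymbol\lambda\ge\boldsymbol 1=(1,\dots,1)$; $\boldsymbol a,\boldsymbol b\in\Lambda^n$ satisfy $\boldsymbol a<\boldsymbol\rho^{\boldsymbol\lambda-\boldsymbol 1}(\boldsymbol b)=(\rho_1^{\lambda_1-1}(b_1),\dots,\rho_n^{\lambda_n-1}(b_n))$, and $\Omega=\{\boldsymbol x\in\Lambda^n:\boldsymbol a\le\boldsymbol x\le\boldsymbol b\}$. $\int_\Omega f\,\Delta\boldsymbol x$ is the $n$-fold iterated delta integral $\int_{a_1}^{b_1}\cdots\int_{a_n}^{b_n}f\,\Delta x_1\cdots\Delta x_n$. The partial delta derivative $\frac{\partial f(\boldsymbol x)}{\Delta_jx_j}$ is $\lim_{t_j\to x_j,\ t_j\ne\sigma_j(x_j)}\frac{f(x_1,\dots,\sigma_j(x_j),\dots,x_n)-f(x_1,\dots,t_j,\dots,x_n)}{\sigma_j(x_j)-t_j}$; higher-order ones are defined by iteration; $\frac{\partial^{\boldsymbol\lambda}f}{\Delta\boldsymbol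 x^{\boldsymbol\lambda}}=\frac{\partial^{\lambda_1+\cdots+\lambda_n}f}{\Delta_1x_1^{\lambda_1}\cdots\Delta_nx_n^{\lambda_n}}$. $C^{n\boldsymbol\lambda}_{\rm rd}(\Omega)$ is the set of $f:\Omega\to\mathbb{R}$ having rd-continuous derivatives $\frac{\partial^{k_1+\cdots+k_j}f}{\Delta_1x_1^{k_1}\cdots\Delta_jx_j^{k_j}}$ for $1\le k_j\le\lambda_j$, $j=1,\dots,n$. $\mathcal{L}^1_{\boldsymbol a}(\Omega,1,\boldsymbol\lambda)$ is the set of $f\in C^{n\boldsymbol\lambda}_{\rm rd}(\Omega)$ with $\frac{\partial^{k_j}f(\boldsymbol x)}{\Delta_jx_j^{k_j}}\big|_{x_j=a_j}=0$ for $0\le k_j\le\lambda_j-1$, $j=1,\dots,n$, and $\int_\Omega\left|\frac{\partial^{\boldsymbol\lambda}f(\boldsymbol x)}{\Delta\boldsymbol x^{\boldsymbol\lambda}}\right|\Delta\boldsymbol x<\infty$. $H_{\boldsymbol\lambda}(\boldsymbol x,\boldsymbol t)=\prod_{j=1}^n h^{(j)}_{\lambda_j-1}(x_j,\sigma_j(t_j))$, where $h^{(j)}_0\equiv1$ and $h^{(j)}_{k+1}(t,s)=\int_s^th^{(j)}_k(u,s)\Delta u$ for $t,s\in\mathbb{T}_j$. $\mathcal{H}^m_R$ is the set of all functions $F:(-R,R)^m\to\mathbb{R}$ such that (1) $F\in C^1((-R,R)^m)$; (2) $F(0,\dots,0)=0$; (3) for each $i=1,\dots,m$ the partial derivative $D_iF=\partial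 F/\partial t_i$ is non-negative and increasing in each variable on $(0,R)$ (arguments in $(0,R)^m$). "Increasing" means non-decreasing. *)

theory Defs
  imports "HOL-Analysis.Analysis"
begin

section \<open>One time scale\<close>

definition time_scale :: "real set \<Rightarrow> bool" where
  "time_scale T \<longleftrightarrow> closed T \<and> T \<noteq> {}"

text \<open>The jump operators, with the conventions inf {} = sup T and sup {} = inf T. They are
  defined at every real number; the values off \<open>T\<close> matter only for \<open>delta_measure\<close>.\<close>

definition fwd_jump :: "real set \<Rightarrow> real \<Rightarrow> real" where
  "fwd_jump T t = (if \<exists>s\<in>T. t < s then Inf {s\<in>T. t < s} else Sup T)"

definition bwd_jump :: "real set \<Rightarrow> real \<Rightarrow> real" where
  "bwd_jump T t = (if \<exists>s\<in>T. s < t then Sup {s\<in>T. s < t} else Inf T)"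

definition right_dense :: "real set \<Rightarrow> real \<Rightarrow> bool" where
  "right_dense T t \<longleftrightarrow> (\<exists>s\<in>T. t < s) \<and> fwd_jump T t = t"

definition left_dense :: "real set \<Rightarrow> real \<Rightarrow> bool" where
  "left_dense T t \<longleftrightarrow> (\<exists>s\<in>T. s < t) \<and> bwd_jump T t = t"

text \<open>The truncation usually written with a superscript kappa: a left-scattered maximum is removed,
  because no delta derivative is defined there. Derivatives of order \<open>k\<close> live on
  \<open>(ts_kappa ^^ k) T\<close>.\<close>

definition ts_kappa :: "real set \<Rightarrow> real set" where
  "ts_kappa T = {t\<in>T. \<not> ((\<forall>s\<in>T. s \<le> t) \<and> bwd_jump T t < t)}"

text \<open>Lebesgue delta measure: the Lebesgue-Stieltjes measure generated by the forward jump. It is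
  concentrated on \<open>T\<close> and gives \<open>{c..<d}\<close>, for \<open>c \<le> d\<close> in \<open>T\<close>, the measure \<open>d - c\<close>; see
  \<open>emeasure_delta_measure\<close> below.\<close>

definition delta_measure :: "real set \<Rightarrow> real measure" where
  "delta_measure T = interval_measure (fwd_jump T)"

definition delta_integral :: "real set \<Rightarrow> real \<Rightarrow> real \<Rightarrow> (real \<Rightarrow> real) \<Rightarrow> real" where
  "delta_integral T c d f =
     (if c \<le> d then LINT t:{c..<d} \<inter> T|delta_measure T. f t
      else - (LINT t:{d..<c} \<inter> T|delta_measure T. f t))"

definition delta_nn_integral :: "real set \<Rightarrow> real \<Rightarrow> real \<Rightarrow> (real \<Rightarrow> ennreal) \<Rightarrow> ennreal" where
  "delta_nn_integral T c d f = (\<integral>\<^sup>+t\<in>{c..<d} \<inter> T. f t \<partial>delta_measure T)"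

primrec ts_monomial :: "real set \<Rightarrow> nat \<Rightarrow> real \<Rightarrow> real \<Rightarrow> real" where
  "ts_monomial T 0 t s = 1"
| "ts_monomial T (Suc k) t s = delta_integral T s t (\<lambda>u. ts_monomial T k u s)"

lemma fwd_jump_ge_le:
  assumes "t \<in> T" "s < t"
  shows "s \<le> fwd_jump T s" "fwd_jump T s \<le> t"
proof -
  have bdd: "bdd_below {r\<in>T. s < r}" by (rule bdd_belowI[of _ s]) auto
  show "fwd_jump T s \<le> t"
    using assms cInf_lower[OF _ bdd, of t] by (auto simp: fwd_jump_def)
  show "s \<le> fwd_jump T s"
    using assms by (auto simp: fwd_jump_def intro!: cInf_greatest)
qed

lemma fwd_jump_ge:
  assumes "t \<in> T"
  shows "t \<le> fwd_jump T t"
proof (cases "\<exists>s\<in>T. t < s")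
  case True
  then show ?thesis using fwd_jump_ge_le(1) by blast
next
  case False
  then have "bdd_above T" by (meson bdd_aboveI not_le)
  then show ?thesis using assms False by (auto simp: fwd_jump_def intro: cSup_upper)
qed

lemma fwd_jump_mono:
  assumes "time_scale T" "x \<le> y"
  shows "fwd_jump T x \<le> fwd_jump T y"
proof -
  have bdd: "bdd_below {r\<in>T. z < r}" for z by (rule bdd_belowI[of _ z]) auto
  show ?thesis
  proof (cases "\<exists>s\<in>T. y < s")
    case True
    then have "Inf {s\<in>T. x < s} \<le> Inf {s\<in>T. y < s}"
      using assms(2) by (intro cInf_superset_mono bdd) auto
    then show ?thesis using True assms(2) by (force simp: fwd_jump_def)
  next
    case False
    then have above: "bdd_above T" by (meson bdd_aboveI not_le)
    show ?thesis
    proof (cases "\<exists>s\<in>T. x < s")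
      case True
      then obtain s where s: "s \<in> T" "x < s" by blast
      have "Inf {s\<in>T. x < s} \<le> s" using s by (intro cInf_lower bdd) auto
      also have "s \<le> Sup T" using s above by (intro cSup_upper)
      finally show ?thesis using True False by (simp add: fwd_jump_def)
    qed (use False in \<open>auto simp: fwd_jump_def\<close>)
  qed
qed

lemma continuous_fwd_jump:
  assumes "time_scale T"
  shows "continuous (at_right x) (fwd_jump T)"
proof (cases "\<exists>s\<in>T. x < s")
  case True
  have bdd: "bdd_below {r\<in>T. x < r}" by (rule bdd_belowI[of _ x]) auto
  have eq: "fwd_jump T x = Inf {s\<in>T. x < s}" using True by (simp add: fwd_jump_def)
  have "(fwd_jump T \<longlongrightarrow> fwd_jump T x) (at_right x)"
  proof (rule tendstoI)
    fix e :: real assume "e > 0"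
    then obtain s where s: "s \<in> T" "x < s" "s < fwd_jump T x + e"
      using cInf_lessD[of "{s\<in>T. x < s}" "fwd_jump T x + e"] True eq by auto
    have "dist (fwd_jump T y) (fwd_jump T x) < e" if "x < y" "y < s" for y
      using fwd_jump_ge_le(2)[OF s(1) that(2)] fwd_jump_mono[OF assms, of x y] that s(3)
      by (auto simp: dist_real_def)
    then show "\<forall>\<^sub>F y in at_right x. dist (fwd_jump T y) (fwd_jump T x) < e"
      using s(2) by (auto simp: eventually_at_right)
  qed
  then show ?thesis by (simp add: continuous_within)
next
  case False
  have "fwd_jump T y = fwd_jump T x" if "x < y" for y
    using False that by (auto simp: fwd_jump_def)
  then have "\<forall>\<^sub>F y in at_right x. fwd_jump T y = fwd_jump T x"
    by (auto simp: eventually_at_filter)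
  then have "(fwd_jump T \<longlongrightarrow> fwd_jump T x) (at_right x)"
    by (rule tendsto_eventually)
  then show ?thesis by (simp add: continuous_within)
qed

lemma emeasure_delta_measure:
  assumes T: "time_scale T" and cd: "c \<in> T" "d \<in> T" "c \<le> d"
  shows "emeasure (delta_measure T) {c..<d} = ennreal (d - c)"
proof -
  let ?M = "delta_measure T"
  have sets: "sets ?M = sets borel" by (simp add: delta_measure_def)
  have Ioc: "emeasure ?M {x<..y} = ennreal (fwd_jump T y - fwd_jump T x)" if "x \<le> y" for x y
    unfolding delta_measure_def
    using that fwd_jump_mono[OF T] continuous_fwd_jump[OF T]
    by (intro emeasure_interval_measure_Ioc) auto
  have sing: "emeasure ?M {t} = ennreal (fwd_jump T t - t)" if t: "t \<in> T" for t
  proof -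
    let ?s = "\<lambda>n. t - inverse (real (Suc n))"
    have s_lt: "?s n < t" for n by simp
    have "(\<lambda>n. emeasure ?M {?s n<..t}) \<longlonglongrightarrow> emeasure ?M (\<Inter>n. {?s n<..t})"
    proof (rule Lim_emeasure_decseq)
      show "decseq (\<lambda>n. {?s n<..t})"
        by (rule decseq_SucI) (auto simp: field_simps intro: order_le_less_trans)
      show "emeasure ?M {?s n<..t} \<noteq> \<infinity>" for n
        using s_lt[of n] by (subst Ioc) auto
    qed (auto simp: sets)
    moreover have "(\<Inter>n. {?s n<..t}) = {t}"
    proof -
      have "x = t" if "\<forall>n. ?s n < x \<and> x \<le> t" for x
      proof (rule ccontr)
        assume "x \<noteq> t"
        then have "0 < t - x" using that by force
        then obtain n where "inverse (real (Suc n)) < t - x" using reals_Archimedean by blast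
        then show False using that[rule_format, of n] by simp
      qed
      then show ?thesis by auto
    qed
    moreover have "(\<lambda>n. emeasure ?M {?s n<..t}) \<longlonglongrightarrow> ennreal (fwd_jump T t - t)"
    proof -
      have "(\<lambda>n. fwd_jump T (?s n)) \<longlonglongrightarrow> t"
      proof (rule tendsto_sandwich[of ?s _ _ "\<lambda>_. t"])
        show "?s \<longlonglongrightarrow> t"
          using tendsto_diff[OF tendsto_const LIMSEQ_inverse_real_of_nat, of t] by simp
      qed (use fwd_jump_ge_le[OF t s_lt] in auto)
      then have "(\<lambda>n. ennreal (fwd_jump T t - fwd_jump T (?s n)))
          \<longlonglongrightarrow> ennreal (fwd_jump T t - t)"
        by (intro tendsto_ennrealI tendsto_diff tendsto_const)
      then show ?thesis using Ioc[OF less_imp_le[OF s_lt]] by simp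
    qed
    ultimately show ?thesis by (metis LIMSEQ_unique)
  qed
  have le: "0 \<le> fwd_jump T c - c" "0 \<le> fwd_jump T d - d" "0 \<le> fwd_jump T d - fwd_jump T c"
    using fwd_jump_ge cd fwd_jump_mono[OF T cd(3)] by auto
  have "emeasure ?M {c..<d} + emeasure ?M {d} = emeasure ?M ({c..<d} \<union> {d})"
    by (rule plus_emeasure) (auto simp: sets)
  also have "{c..<d} \<union> {d} = {c} \<union> {c<..d}" using cd(3) by auto
  also have "emeasure ?M \<dots> = emeasure ?M {c} + emeasure ?M {c<..d}"
    by (rule plus_emeasure[symmetric]) (auto simp: sets)
  also have "\<dots> = ennreal ((fwd_jump T c - c) + (fwd_jump T d - fwd_jump T c))"
    using sing[OF cd(1)] Ioc[OF cd(3)] le by (simp only: ennreal_plus)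
  also have "(fwd_jump T c - c) + (fwd_jump T d - fwd_jump T c) = (d - c) + (fwd_jump T d - d)"
    by simp
  also have "ennreal \<dots> = ennreal (d - c) + emeasure ?M {d}"
    using sing[OF cd(2)] le cd(3) by (simp only: ennreal_plus diff_ge_0_iff_ge)
  finally show ?thesis
    using sing[OF cd(2)] by (simp add: add.commute[of _ "ennreal (fwd_jump T d - d)"])
qed


section \<open>Products of time scales\<close>

text \<open>The coordinates 1, ..., n are the elements of a finite linearly ordered index type. A function
  on the product of the time scales is a total function on \<open>real ^ 'n\<close> whose values elsewhere are
  irrelevant. A function given on a box only is covered by taking each \<open>T j\<close> to be contained in
  \<open>{a $ j..b $ j}\<close>.\<close>

definition vec_upd :: "real ^ 'k \<Rightarrow> 'k \<Rightarrow> real \<Rightarrow> real ^ 'k" where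
  "vec_upd x j t = (\<chi> i. if i = j then t else x $ i)"

definition ts_prod :: "('n \<Rightarrow> real set) \<Rightarrow> (real ^ 'n) set" where
  "ts_prod T = {x. \<forall>j. x $ j \<in> T j}"

definition ts_box :: "('n \<Rightarrow> real set) \<Rightarrow> real ^ 'n \<Rightarrow> real ^ 'n \<Rightarrow> (real ^ 'n) set" where
  "ts_box T a b = {x \<in> ts_prod T. \<forall>j. a $ j \<le> x $ j \<and> x $ j \<le> b $ j}"

primrec iter_delta_integral ::
  "('n \<Rightarrow> real set) \<Rightarrow> real ^ 'n \<Rightarrow> real ^ 'n \<Rightarrow> 'n list \<Rightarrow> (real ^ 'n \<Rightarrow> real) \<Rightarrow> real ^ 'n \<Rightarrow> real"
where
  "iter_delta_integral T a b [] f x = f x"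
| "iter_delta_integral T a b (j # js) f x =
     delta_integral (T j) (a $ j) (b $ j) (\<lambda>t. iter_delta_integral T a b js f (vec_upd x j t))"

text \<open>The base point \<open>0\<close> is immaterial, as every coordinate is overwritten.\<close>

definition box_delta_integral ::
  "('n::{finite,linorder} \<Rightarrow> real set) \<Rightarrow> (real, 'n) vec \<Rightarrow> (real, 'n) vec \<Rightarrow> ((real, 'n) vec \<Rightarrow> real) \<Rightarrow> real" where
  "box_delta_integral T a b f = iter_delta_integral T a b (sorted_list_of_set UNIV) f 0"

primrec iter_delta_nn_integral ::
  "('n \<Rightarrow> real set) \<Rightarrow> real ^ 'n \<Rightarrow> real ^ 'n \<Rightarrow> 'n list \<Rightarrow> (real ^ 'n \<Rightarrow> ennreal) \<Rightarrow> real ^ 'n \<Rightarrow> ennreal"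
where
  "iter_delta_nn_integral T a b [] f x = f x"
| "iter_delta_nn_integral T a b (j # js) f x =
     delta_nn_integral (T j) (a $ j) (b $ j) (\<lambda>t. iter_delta_nn_integral T a b js f (vec_upd x j t))"

definition box_delta_nn_integral ::
  "('n::{finite,linorder} \<Rightarrow> real set) \<Rightarrow> (real, 'n) vec \<Rightarrow> (real, 'n) vec \<Rightarrow> ((real, 'n) vec \<Rightarrow> ennreal) \<Rightarrow> ennreal" where
  "box_delta_nn_integral T a b f = iter_delta_nn_integral T a b (sorted_list_of_set UNIV) f 0"


section \<open>Partial delta derivatives\<close>

text \<open>The filter for \<open>t \<rightarrow> s\<close> in \<open>T\<close> with \<open>t \<noteq> \<sigma>(s)\<close>. At a right-scattered \<open>s\<close> the value
  \<open>t = s\<close> is admitted, so \<open>at _ within _\<close> would be wrong. For \<open>s\<close> in \<open>T\<close> the filter is trivial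
  precisely if \<open>s\<close> is a left-scattered maximum (or the only point).\<close>

definition delta_filter :: "real set \<Rightarrow> real \<Rightarrow> real filter" where
  "delta_filter T s = inf (nhds s) (principal (T - {fwd_jump T s}))"

definition delta_quotient ::
  "real set \<Rightarrow> 'n \<Rightarrow> (real ^ 'n \<Rightarrow> real) \<Rightarrow> real ^ 'n \<Rightarrow> real \<Rightarrow> real" where
  "delta_quotient S j f x t =
     (f (vec_upd x j (fwd_jump S (x $ j))) - f (vec_upd x j t)) / (fwd_jump S (x $ j) - t)"

text \<open>Here \<open>S\<close> is the time scale of the \<open>j\<close>-th variable.\<close>

definition pdelta_differentiable ::
  "real set \<Rightarrow> 'n \<Rightarrow> (real ^ 'n \<Rightarrow> real) \<Rightarrow> real ^ 'n \<Rightarrow> bool" where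
  "pdelta_differentiable S j f x \<longleftrightarrow> delta_filter S (x $ j) \<noteq> bot \<and>
     (\<exists>D. (delta_quotient S j f x \<longlongrightarrow> D) (delta_filter S (x $ j)))"

definition pdelta ::
  "real set \<Rightarrow> 'n \<Rightarrow> (real ^ 'n \<Rightarrow> real) \<Rightarrow> real ^ 'n \<Rightarrow> real" where
  "pdelta S j f x =
     (if pdelta_differentiable S j f x
      then Lim (delta_filter S (x $ j)) (delta_quotient S j f x) else 0)"

text \<open>As usual, the derivative of order \<open>k + 1\<close> is the delta derivative, with respect to the time
  scale \<open>(ts_kappa ^^ k) (T j)\<close>, of the derivative of order \<open>k\<close>. Its value is \<open>0\<close> at the points outside
  \<open>(ts_kappa ^^ Suc k) (T j)\<close>, where it is not defined (the filter is trivial there).\<close>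

primrec pdelta_iter ::
  "('n \<Rightarrow> real set) \<Rightarrow> 'n \<Rightarrow> nat \<Rightarrow> (real ^ 'n \<Rightarrow> real) \<Rightarrow> real ^ 'n \<Rightarrow> real" where
  "pdelta_iter T j 0 f = f"
| "pdelta_iter T j (Suc k) f = pdelta ((ts_kappa ^^ k) (T j)) j (pdelta_iter T j k f)"

text \<open>\<open>mixed_delta T k f\<close> applies \<open>k j\<close> derivatives in each variable \<open>j\<close>, in increasing order of the
  variables (the first variable first). This order makes the derivatives that occur in \<open>C_rd\<close> below
  exactly the successive stages of the construction of the full mixed derivative.\<close>

definition mixed_delta ::
  "('n::{finite,linorder} \<Rightarrow> real set) \<Rightarrow> ('n \<Rightarrow> nat) \<Rightarrow> ((real, 'n) vec \<Rightarrow> real) \<Rightarrow> (real, 'n) vec \<Rightarrow> real" where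
  "mixed_delta T k f = fold (\<lambda>j. pdelta_iter T j (k j)) (sorted_list_of_set UNIV) f"

definition kappa_box ::
  "('n \<Rightarrow> real set) \<Rightarrow> real ^ 'n \<Rightarrow> real ^ 'n \<Rightarrow> ('n \<Rightarrow> nat) \<Rightarrow> (real ^ 'n) set" where
  "kappa_box T a b k = {x \<in> ts_box T a b. \<forall>j. x $ j \<in> (ts_kappa ^^ k j) (T j)}"

text \<open>Joint rd-continuity. For \<open>L = {}\<close>: \<open>f\<close> is continuous at \<open>x\<close> in the variables in which \<open>x\<close> is
  right-dense, the other variables being kept fixed. For \<open>L \<noteq> {}\<close>: if moreover the variables in
  \<open>L\<close>, in which \<open>x\<close> is left-dense but not right-dense, tend to \<open>x\<close> strictly from the left, then a
  finite limit exists. For one variable this is the usual definition: continuity at right-dense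
  points and finite left-hand limits at left-dense points.\<close>

definition rd_continuous_on ::
  "('n::finite \<Rightarrow> real set) \<Rightarrow> (real ^ 'n) set \<Rightarrow> (real ^ 'n \<Rightarrow> real) \<Rightarrow> bool" where
  "rd_continuous_on T S f \<longleftrightarrow>
     (\<forall>x\<in>S. \<forall>L \<subseteq> {j. left_dense (T j) (x $ j) \<and> \<not> right_dense (T j) (x $ j)}.
        \<exists>l. (f \<longlongrightarrow> l) (at x within
               {y\<in>S. \<forall>j. if j \<in> L then y $ j < x $ j
                          else right_dense (T j) (x $ j) \<or> y $ j = x $ j})
          \<and> (L = {} \<longrightarrow> l = f x))"

text \<open>The derivative of order \<open>k 1 + ... + k j\<close> in the variables \<open>1, ..., j\<close> is encoded by putting
  \<open>k i = 0\<close> for \<open>i > j\<close>.\<close>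

definition C_rd ::
  "('n::{finite,linorder} \<Rightarrow> real set) \<Rightarrow> (real, 'n) vec \<Rightarrow> (real, 'n) vec \<Rightarrow> ('n \<Rightarrow> nat) \<Rightarrow> ((real, 'n) vec \<Rightarrow> real) set"
where
  "C_rd T a b lam = {f. \<forall>j k. (\<forall>i\<le>j. 1 \<le> k i \<and> k i \<le> lam i) \<and> (\<forall>i>j. k i = 0) \<longrightarrow>
      (\<forall>x\<in>kappa_box T a b k.
         pdelta_differentiable ((ts_kappa ^^ (k j - 1)) (T j)) j (mixed_delta T (k(j := k j - 1)) f) x) \<and>
      rd_continuous_on T (kappa_box T a b k) (mixed_delta T k f)}"

definition L1_class ::
  "('n::{finite,linorder} \<Rightarrow> real set) \<Rightarrow> (real, 'n) vec \<Rightarrow> (real, 'n) vec \<Rightarrow> ('n \<Rightarrow> nat) \<Rightarrow> ((real, 'n) vec \<Rightarrow> real) set"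
where
  "L1_class T a b lam = {f \<in> C_rd T a b lam.
      (\<forall>j. \<forall>k<lam j. \<forall>x\<in>ts_box T a b. x $ j = a $ j \<longrightarrow>
         (k > 0 \<longrightarrow>
            pdelta_differentiable ((ts_kappa ^^ (k - 1)) (T j)) j (pdelta_iter T j (k - 1) f) x) \<and>
         pdelta_iter T j k f x = 0) \<and>
      box_delta_nn_integral T a b (\<lambda>x. ennreal \<bar>mixed_delta T lam f x\<bar>) < \<infinity>}"

definition H_kernel ::
  "('n::finite \<Rightarrow> real set) \<Rightarrow> ('n \<Rightarrow> nat) \<Rightarrow> real ^ 'n \<Rightarrow> real ^ 'n \<Rightarrow> real" where
  "H_kernel T lam x t = (\<Prod>j\<in>UNIV. ts_monomial (T j) (lam j - 1) (x $ j) (fwd_jump (T j) (t $ j)))"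


section \<open>The class of functions F\<close>

definition partial_deriv :: "'m \<Rightarrow> (real ^ 'm \<Rightarrow> real) \<Rightarrow> real ^ 'm \<Rightarrow> real" where
  "partial_deriv i F x = deriv (\<lambda>t. F (vec_upd x i t)) (x $ i)"

definition C1_on :: "(real ^ 'm::finite) set \<Rightarrow> (real ^ 'm \<Rightarrow> real) \<Rightarrow> bool" where
  "C1_on S F \<longleftrightarrow> (\<forall>i. (\<forall>x\<in>S. (\<lambda>t. F (vec_upd x i t)) field_differentiable at (x $ i))
                    \<and> continuous_on S (partial_deriv i F))"

definition sym_cube :: "ereal \<Rightarrow> (real ^ 'm) set" where
  "sym_cube R = {x. \<forall>i. ereal \<bar>x $ i\<bar> < R}"

definition pos_cube :: "ereal \<Rightarrow> (real ^ 'm) set" where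
  "pos_cube R = {x. \<forall>i. 0 < x $ i \<and> ereal (x $ i) < R}"

definition H_class :: "ereal \<Rightarrow> (real ^ 'm::finite \<Rightarrow> real) set" where
  "H_class R = {F. C1_on (sym_cube R) F \<and> F 0 = 0 \<and>
     (\<forall>i. (\<forall>x\<in>pos_cube R. 0 \<le> partial_deriv i F x) \<and>
          (\<forall>x\<in>pos_cube R. \<forall>k t. x $ k \<le> t \<and> ereal t < R \<longrightarrow>
              partial_deriv i F x \<le> partial_deriv i F (vec_upd x k t)))}"

end

theory Submission
  imports Defs
begin

text \<open>
  The variables are integrated one at a time. For a fixed order, let \<open>J\<close> denote integration over
  \<open>[a\<^sub>j, x\<^sub>j)\<close> and let \<open>g\<close> be the derivative of \<open>f\<close> of full order in the variables before \<open>j\<close>. By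
  induction \<open>f = P g\<close>, where \<open>P\<close> is an iterated integral in those variables. The fundamental theorem in
  the variable \<open>j\<close> expresses each \<open>P (\<partial>\<^sub>j\<^sup>r g)\<close> as its value at \<open>x\<^sub>j = a\<^sub>j\<close> plus
  \<open>J (P (\<partial>\<^sub>j\<^sup>r\<^sup>+\<^sup>1 g))\<close>, since \<open>J\<close> commutes with \<open>P\<close> by Fubini. Hence these functions are the successive
  derivatives of \<open>f\<close> in the variable \<open>j\<close>, and the boundary conditions on \<open>f\<close> remove all boundary terms.
  No commutation of mixed derivatives is needed.

  An iterated primitive of a nonnegative \<open>w\<close> of order \<open>k + 1\<close> is at most \<open>h\<^sub>k(b, \<sigma>(a))\<close> times the
  primitive of \<open>w\<close>. So \<open>|f|\<close> is bounded by \<open>H\<close> times the integral of the absolute value of the full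
  derivative over \<open>{t\<^sub>1 < x\<^sub>1}\<close>, a function \<open>V\<close> of the first variable only. Monotonicity of the partial
  derivatives of \<open>F\<close> then gives the one-dimensional inequality \<open>\<integral> \<Sum>\<^sub>i D\<^sub>iF(V) dV\<^sub>i \<le> F(V(b))\<close>.
\<close>

section \<open>Calculus on one time scale\<close>

text \<open>Two obstacles shape the proof. First, there is no chain rule: the measure dV can have
  atoms at right-scattered points, where F(V) jumps. The integrand takes D_iF at the value of V
  before the jump, so monotonicity of D_iF still bounds the contribution of the atom by the
  increment of F. This is why primitives run over half-open intervals and are left-continuous.
  Second, functions are total, and derivatives near b may depend on values beyond the box, where the
  boundary conditions say nothing. But an integral over t < x stays strictly below x, so an r-fold
  primitive never reads a derivative of order r at those top points. Every derivative is therefore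
  multiplied by the indicator of a set on which the box determines it. This makes it a bounded Borel
  function on the whole space, and since all cell measures are finite, linearity and Fubini apply.
  The hypothesis a < rho^(lambda-1)(b) keeps a in these sets and makes H positive, as the division
  by H requires.\<close>

definition bounded_borel :: "('a::topological_space \<Rightarrow> real) \<Rightarrow> bool" where
  "bounded_borel f \<longleftrightarrow> f \<in> borel_measurable borel \<and> (\<exists>C. \<forall>x. \<bar>f x\<bar> \<le> C)"

lemma bounded_borelE:
  assumes "bounded_borel f"
  obtains C where "f \<in> borel_measurable borel" "C \<ge> 0" "\<And>x. \<bar>f x\<bar> \<le> C"
  using assms unfolding bounded_borel_def by (meson abs_ge_zero order_trans)

lemma bounded_borelI:
  "f \<in> borel_measurable borel \<Longrightarrow> (\<And>x. \<bar>f x\<bar> \<le> C) \<Longrightarrow> bounded_borel f"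
  unfolding bounded_borel_def by blast

lemma bounded_borel_measurable: "bounded_borel f \<Longrightarrow> f \<in> borel_measurable borel"
  by (simp add: bounded_borel_def)

lemma bounded_borel_add:
  assumes "bounded_borel f" "bounded_borel g"
  shows "bounded_borel (\<lambda>x. f x + g x)"
proof -
  obtain C D where "f \<in> borel_measurable borel" "\<And>x. \<bar>f x\<bar> \<le> C"
    "g \<in> borel_measurable borel" "\<And>x. \<bar>g x\<bar> \<le> D"
    using assms by (metis bounded_borelE)
  then show ?thesis
    by (intro bounded_borelI[where C="C + D"]) (auto intro: order_trans[OF abs_triangle_ineq] add_mono)
qed

lemma bounded_borel_mult:
  assumes "bounded_borel f" "bounded_borel g"
  shows "bounded_borel (\<lambda>x. f x * g x)"
proof -
  obtain C D where "f \<in> borel_measurable borel" "\<And>x. \<bar>f x\<bar> \<le> C" "C \<ge> 0"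
    "g \<in> borel_measurable borel" "\<And>x. \<bar>g x\<bar> \<le> D"
    using assms by (metis bounded_borelE)
  then show ?thesis
    by (intro bounded_borelI[where C="C * D"]) (auto simp: abs_mult intro: mult_mono)
qed

lemma bounded_borel_abs: "bounded_borel f \<Longrightarrow> bounded_borel (\<lambda>x. \<bar>f x\<bar>)"
  unfolding bounded_borel_def by auto

lemma bounded_borel_const: "bounded_borel (\<lambda>_. c)"
  by (rule bounded_borelI[where C="\<bar>c\<bar>"]) auto

lemma bounded_borel_indicator: "A \<in> sets borel \<Longrightarrow> bounded_borel (indicator A)"
  by (rule bounded_borelI[where C=1]) (auto simp: indicator_def)

lemma bounded_borel_sum:
  "(\<And>i. i \<in> I \<Longrightarrow> bounded_borel (f i)) \<Longrightarrow> bounded_borel (\<lambda>x. \<Sum>i\<in>I. f i x)"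
  by (induction I rule: infinite_finite_induct)
    (auto intro: bounded_borel_add bounded_borel_const)

lemma integrable_bounded_borel:
  fixes f :: "'a::topological_space \<Rightarrow> real"
  assumes "finite_measure M"  "sets M = sets borel" "bounded_borel f"
  shows "integrable M f"
proof -
  interpret finite_measure M by fact
  obtain C where "f \<in> borel_measurable borel" "\<And>x. \<bar>f x\<bar> \<le> C"
    using assms(3) by (metis bounded_borelE)
  then show ?thesis
    by (intro integrable_const_bound[where B=C]) (auto simp: measurable_cong_sets[OF assms(2) refl])
qed

section \<open>Truncations, jump operators and induction on a time scale\<close>

lemma ts_kappaI_less: "t \<in> S \<Longrightarrow> s \<in> S \<Longrightarrow> t < s \<Longrightarrow> t \<in> ts_kappa S"
  by (auto simp: ts_kappa_def not_le)

text \<open>Left-density is expressed by points of \<open>S\<close>, a form that passes to initial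
  segments without computing their backward jump.\<close>

lemma ts_kappaI_left:
  assumes "t \<in> S" "\<And>y. y < t \<Longrightarrow> \<exists>s\<in>S. y < s \<and> s < t"
  shows "t \<in> ts_kappa S"
proof -
  have "\<not> bwd_jump S t < t"
  proof
    assume l: "bwd_jump S t < t"
    then obtain s where s: "s \<in> S" "bwd_jump S t < s" "s < t" using assms(2) by blast
    have "bdd_above {s\<in>S. s < t}" by (rule bdd_aboveI[of _ t]) auto
    then have "s \<le> Sup {s\<in>S. s < t}" using s by (intro cSup_upper) auto
    then show False using s by (auto simp: bwd_jump_def split: if_splits)
  qed
  then show ?thesis using assms by (auto simp: ts_kappa_def)
qed

lemma ts_kappa_subset: "ts_kappa S \<subseteq> S"
  by (auto simp: ts_kappa_def)

lemma fwd_jump_in: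
  assumes "closed S" "t \<in> S"
  shows "fwd_jump S t \<in> S"
proof (cases "\<exists>s\<in>S. t < s")
  case True
  then have "Inf {s\<in>S. t < s} \<in> closure {s\<in>S. t < s}"
    by (intro closure_contains_Inf bdd_belowI[of _ t]) auto
  also have "\<dots> \<subseteq> S" using assms by (intro closure_minimal) auto
  finally show ?thesis using True by (simp add: fwd_jump_def)
next
  case False
  then have "Sup S = t" using assms by (intro cSup_eq_maximum) (auto simp: not_less)
  then show ?thesis using False assms by (simp add: fwd_jump_def)
qed

text \<open>An initial segment \<open>S\<close> of \<open>T\<close> that reaches a point
  \<open>u\<close> above \<open>t\<close> contains every point of \<open>T\<close> between
  \<open>t\<close> and \<open>u\<close>, and these determine the infimum. Truncated scales are such
  segments, so derivatives of higher order use the forward jump of \<open>T\<close> below the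
  top.\<close>

lemma fwd_jump_lower:
  assumes "S \<subseteq> T" "\<And>s t. t \<in> S \<Longrightarrow> s \<in> T \<Longrightarrow> s \<le> t \<Longrightarrow> s \<in> S" "u \<in> S" "t < u"
  shows "fwd_jump S t = fwd_jump T t"
proof -
  have bdd: "bdd_below {s\<in>A. t < s}" for A :: "real set" by (rule bdd_belowI[of _ t]) auto
  have "Inf {s\<in>T. t < s} \<le> Inf {s\<in>S. t < s}"
    using assms by (intro cInf_superset_mono bdd) auto
  moreover have "Inf {s\<in>S. t < s} \<le> Inf {s\<in>T. t < s}"
  proof (rule cInf_greatest)
    show "{s\<in>T. t < s} \<noteq> {}" using assms by auto
    fix x assume x: "x \<in> {s\<in>T. t < s}"
    show "Inf {s\<in>S. t < s} \<le> x"
    proof (cases "x \<le> u")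
      case True
      then have "x \<in> S" using assms x by auto
      then show ?thesis using x by (intro cInf_lower bdd) auto
    next
      case False
      have "Inf {s\<in>S. t < s} \<le> u" using assms by (intro cInf_lower bdd) auto
      then show ?thesis using False by simp
    qed
  qed
  ultimately show ?thesis using assms by (force simp: fwd_jump_def)
qed

lemma fwd_jump_dense:
  assumes "u \<in> T" "t < u" "fwd_jump T t = t" "t < y"
  shows "\<exists>s\<in>T. t < s \<and> s < y"
proof -
  have "{s\<in>T. t < s} \<noteq> {}" "Inf {s\<in>T. t < s} < y"
    using assms by (auto simp: fwd_jump_def split: if_splits)
  from cInf_lessD[OF this] show ?thesis by auto
qed

lemma right_dense_iff: "u \<in> T \<Longrightarrow> t < u \<Longrightarrow> right_dense T t \<longleftrightarrow> fwd_jump T t = t"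
  by (auto simp: right_dense_def)

text \<open>Real induction adapted to a closed set. The three closure conditions cover the step
  across a gap, a start to the right of a right-dense point and the passage to a left-dense point.
  The supremum of the points up to which \<open>P\<close> holds throughout then cannot lie below
  \<open>u\<close>.\<close>

lemma time_scale_induct:
  fixes P :: "real \<Rightarrow> bool"
  assumes T: "closed T" and aT: "a \<in> T" "u \<in> T" "a \<le> u"
    and base: "P a"
    and scattered: "\<And>t. t \<in> T \<Longrightarrow> a \<le> t \<Longrightarrow> t < u \<Longrightarrow> P t \<Longrightarrow> t < fwd_jump T t \<Longrightarrow> P (fwd_jump T t)"
    and dense: "\<And>t. t \<in> T \<Longrightarrow> a \<le> t \<Longrightarrow> t < u \<Longrightarrow> P t \<Longrightarrow> fwd_jump T t = t \<Longrightarrow>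
      \<exists>y>t. \<forall>s\<in>T. t < s \<and> s \<le> y \<and> s \<le> u \<longrightarrow> P s"
    and left: "\<And>t. t \<in> T \<Longrightarrow> a < t \<Longrightarrow> t \<le> u \<Longrightarrow> (\<And>y. y < t \<Longrightarrow> \<exists>s\<in>T. y < s \<and> s < t) \<Longrightarrow>
      (\<And>s. s \<in> T \<Longrightarrow> a \<le> s \<Longrightarrow> s < t \<Longrightarrow> P s) \<Longrightarrow> P t"
  shows "P u"
proof -
  define A where "A = {x\<in>T. a \<le> x \<and> x \<le> u \<and> (\<forall>s\<in>T. a \<le> s \<and> s \<le> x \<longrightarrow> P s)}"
  define c where "c = Sup A"
  have aA: "a \<in> A" using aT base by (auto simp: A_def)
  have bdd: "bdd_above A" by (rule bdd_aboveI[of _ u]) (auto simp: A_def)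
  have "c \<in> closure A" unfolding c_def using aA bdd by (intro closure_contains_Sup) auto
  also have "closure A \<subseteq> T" using T by (intro closure_minimal) (auto simp: A_def)
  finally have cT: "c \<in> T" .
  have ac: "a \<le> c" unfolding c_def using aA bdd by (rule cSup_upper)
  have cu: "c \<le> u" unfolding c_def using aA by (intro cSup_least) (auto simp: A_def)
  have below: "P s" if "s \<in> T" "a \<le> s" "s < c" for s
  proof -
    from \<open>s < c\<close> have "s < Sup A" by (simp add: c_def)
    then obtain x where "x \<in> A" "s < x" using less_cSupE[of s A] aA by auto
    then show ?thesis using that by (auto simp: A_def)
  qed
  \<comment> \<open>If the supremum is not in \<open>A\<close>, points of \<open>A\<close>
    accumulate at it from the left and the left-dense case applies.\<close>
  have Pc: "P c"
  proof (cases "c \<in> A")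
    case True then show ?thesis using ac cT by (auto simp: A_def)
  next
    case False
    then have "a < c" using aA ac by (cases "a = c") auto
    moreover have "\<exists>s\<in>T. y < s \<and> s < c" if "y < c" for y
    proof -
      from \<open>y < c\<close> have "y < Sup A" by (simp add: c_def)
    then obtain x where "x \<in> A" "y < x" using less_cSupE[of y A] aA by auto
      moreover have "x \<le> c" unfolding c_def using \<open>x \<in> A\<close> bdd by (rule cSup_upper)
      ultimately show ?thesis using False by (intro bexI[of _ x]) (auto simp: A_def less_le)
    qed
    ultimately show ?thesis using left[of c] cT cu below by blast
  qed
  then have cA: "c \<in> A" using cT ac cu below by (auto simp: A_def) (metis less_eq_real_def)
  have "c = u"
  proof (rule ccontr)
    assume "c \<noteq> u"
    then have cu: "c < u" using cu by simp
    have "\<exists>x\<in>A. c < x"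
    proof (cases "fwd_jump T c = c")
      case True
      obtain y where y: "y > c" "\<And>s. s \<in> T \<Longrightarrow> c < s \<Longrightarrow> s \<le> y \<Longrightarrow> s \<le> u \<Longrightarrow> P s"
        using dense[OF cT ac cu Pc True] by blast
      obtain s where s: "s \<in> T" "c < s" "s < min y u"
        using fwd_jump_dense[OF aT(2) cu True, of "min y u"] y cu by auto
      have "P r" if "r \<in> T" "a \<le> r" "r \<le> s" for r
        using y(2)[of r] that s below[of r] Pc by (cases "r < c"; cases "r = c") auto
      then show ?thesis using s ac by (intro bexI[of _ s]) (auto simp: A_def)
    next
      case False
      let ?s = "fwd_jump T c"
      have lt: "c < ?s" using fwd_jump_ge[OF cT] False by simp
      have "P r" if "r \<in> T" "a \<le> r" "r \<le> ?s" for r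
        using scattered[OF cT ac cu Pc lt] that below[of r] Pc fwd_jump_ge_le(2)[of r T c]
        by (cases "r < c"; cases "r = c") auto
      then show ?thesis using lt ac fwd_jump_in[OF T cT] fwd_jump_ge_le(2)[OF aT(2) cu]
        by (intro bexI[of _ ?s]) (auto simp: A_def)
    qed
    then show False using cSup_upper[OF _ bdd] unfolding c_def by force
  qed
  then show ?thesis using Pc by simp
qed

text \<open>A density rather than a restricted space keeps all reals in the space, so total
  functions can be integrated as they are. Excluding \<open>b\<close> drops the mass sigma(b) - b
  that \<open>delta_measure\<close> may put there.\<close>

definition cell_measure :: "real set \<Rightarrow> real \<Rightarrow> real \<Rightarrow> real measure" where
  "cell_measure T a b = density (delta_measure T) (indicator ({a..<b} \<inter> T))"

lemma sets_delta_measure [simp, measurable_cong]: "sets (delta_measure T) = sets borel"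
  by (simp add: delta_measure_def)

lemma space_delta_measure [simp]: "space (delta_measure T) = UNIV"
  by (simp add: delta_measure_def)

lemma sets_cell_measure [simp, measurable_cong]: "sets (cell_measure T a b) = sets borel"
  by (simp add: cell_measure_def)

lemma space_cell_measure [simp]: "space (cell_measure T a b) = UNIV"
  by (simp add: cell_measure_def)

text \<open>\<open>fwd_jump T\<close> takes the same value at both ends of an interval
  \<open>{p<..q}\<close> free of points of \<open>T\<close>, so such an interval has measure zero.
  Those with rational ends cover the open complement of \<open>T\<close>.\<close>

lemma null_gaps:
  assumes "time_scale T"
  shows "- T \<in> null_sets (delta_measure T)"
proof -
  define G where "G = {(p, q). p \<in> \<rat> \<and> q \<in> \<rat> \<and> p < q \<and> {p<..q} \<inter> T = {}}"
  have "countable (\<rat> \<times> \<rat> :: (real \<times> real) set)" using countable_rat by blast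
  then have "countable G" by (rule countable_subset[rotated]) (auto simp: G_def)
  moreover have "{p<..q} \<in> null_sets (delta_measure T)" if "(p, q) \<in> G" for p q
  proof -
    have "{s\<in>T. p < s} = {s\<in>T. q < s}" "p \<le> q" using that by (force simp: G_def not_le)+
    then have "fwd_jump T p = fwd_jump T q" by (auto simp: fwd_jump_def)
    then have "emeasure (delta_measure T) {p<..q} = 0"
      unfolding delta_measure_def using \<open>p \<le> q\<close>
      by (subst emeasure_interval_measure_Ioc)
        (auto intro: fwd_jump_mono assms continuous_fwd_jump)
    then show ?thesis by (auto simp: null_sets_def)
  qed
  ultimately have "(\<Union>(p,q)\<in>G. {p<..q}) \<in> null_sets (delta_measure T)"
    by (intro null_sets_UN') auto
  moreover have "- T \<subseteq> (\<Union>(p,q)\<in>G. {p<..q})"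
  proof
    fix x assume "x \<in> - T"
    moreover have "open (- T)" using assms by (simp add: time_scale_def open_Compl)
    ultimately obtain e where e: "e > 0" "ball x e \<subseteq> - T" by (meson openE)
    obtain p q where pq: "p \<in> \<rat>" "x - e < p" "p < x" "q \<in> \<rat>" "x < q" "q < x + e"
      using Rats_dense_in_real[of "x - e" x] Rats_dense_in_real[of x "x + e"] e(1) by auto
    then have "{p<..q} \<subseteq> ball x e" by (auto simp: dist_real_def)
    then have "(p, q) \<in> G" using e pq by (auto simp: G_def)
    then show "x \<in> (\<Union>(p,q)\<in>G. {p<..q})" using pq by (intro UN_I[of "(p, q)"]) auto
  qed
  ultimately show ?thesis
    using assms by (elim null_sets_subset) (auto simp: time_scale_def)
qed

section \<open>The delta measure of an interval and its primitives\<close>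

locale ts_interval =
  fixes T :: "real set" and a b :: real
  assumes ts: "time_scale T" and aT: "a \<in> T" and bT: "b \<in> T" and ab: "a < b"
begin

abbreviation "\<mu> \<equiv> cell_measure T a b"

lemma closed_T: "closed T" using ts by (simp add: time_scale_def)

lemma meas_T: "T \<in> sets borel" using closed_T by simp

lemma emeasure_Ico:
  assumes "s \<in> T" "t \<in> T" "a \<le> s" "s \<le> t" "t \<le> b"
  shows "emeasure \<mu> {s..<t} = ennreal (t - s)"
proof -
  have "emeasure \<mu> {s..<t} = (\<integral>\<^sup>+x. indicator ({a..<b} \<inter> T) x * indicator {s..<t} x \<partial>delta_measure T)"
    unfolding cell_measure_def using meas_T by (subst emeasure_density) auto
  also have "\<dots> = (\<integral>\<^sup>+x. indicator {s..<t} x \<partial>delta_measure T)"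
    using AE_not_in[OF null_gaps[OF ts]] assms
    by (intro nn_integral_cong_AE) (auto simp: indicator_def)
  also have "\<dots> = ennreal (t - s)"
    using emeasure_delta_measure[OF ts, of s t] assms by simp
  finally show ?thesis .
qed

lemma AE_cell: "AE x in \<mu>. x \<in> T \<and> a \<le> x \<and> x < b"
  unfolding cell_measure_def using meas_T by (subst AE_density) (auto simp: indicator_def)

lemma emeasure_cell_UNIV: "emeasure \<mu> UNIV = ennreal (b - a)"
proof -
  have "emeasure \<mu> UNIV = emeasure \<mu> {a..<b}"
    using AE_cell by (intro emeasure_eq_AE) auto
  then show ?thesis using emeasure_Ico[of a b] aT bT ab by simp
qed

lemma finite_measure_cell: "finite_measure \<mu>"
  by (rule finite_measureI) (simp add: emeasure_cell_UNIV)

sublocale finite_measure \<mu> by (rule finite_measure_cell)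

lemma measure_Ico:
  assumes "s \<in> T" "t \<in> T" "a \<le> s" "s \<le> t" "t \<le> b"
  shows "measure \<mu> {s..<t} = t - s"
  using emeasure_Ico[OF assms] assms by (simp add: measure_def)

lemma integrable_cell: "bounded_borel f \<Longrightarrow> integrable \<mu> f"
  by (rule integrable_bounded_borel[OF finite_measure_cell]) auto

text \<open>The delta integral from \<open>a\<close> to \<open>x\<close>, extended to all real
  \<open>x\<close>: it is 0 to the left of \<open>a\<close> and constant to the right of
  \<open>b\<close>. The strict inequality leaves out a possible atom at \<open>x\<close>.\<close>

definition prim :: "(real \<Rightarrow> real) \<Rightarrow> real \<Rightarrow> real" where
  "prim f x = (\<integral>t. (if t < x then 1 else 0) * f t \<partial>\<mu>)"

lemma bounded_borel_less:
  fixes f :: "real \<Rightarrow> real"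
  assumes "bounded_borel f"
  shows "bounded_borel (\<lambda>t. (if t < x then 1 else 0) * f t)"
proof -
  have eq: "(\<lambda>t. (if t < x then 1 else 0) * f t) = (\<lambda>t. indicator {..<x} t * f t)"
    by (auto simp: indicator_def fun_eq_iff)
  show ?thesis unfolding eq by (intro bounded_borel_mult bounded_borel_indicator assms) simp
qed

lemma prim_base:
  assumes "bounded_borel f"
  shows "prim f a = 0"
proof -
  have "prim f a = (\<integral>t. 0 \<partial>\<mu>)" unfolding prim_def
    using borel_measurable_integrable[OF integrable_cell[OF bounded_borel_less[OF assms]]]
    by (intro integral_cong_AE) (use AE_cell in auto)
  then show ?thesis by simp
qed

text \<open>The basic estimate for primitives: a deviation \<open>e\<close> obtained from continuity
  gives derivatives, \<open>c = 0\<close> gives the Lipschitz bound, and \<open>e = 0\<close> gives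
  the exact increment across a gap.\<close>

lemma prim_diff:
  assumes f: "bounded_borel f"
    and st: "s \<in> T" "t \<in> T" "a \<le> s" "s \<le> t" "t \<le> b"
    and le: "\<And>r. r \<in> T \<Longrightarrow> s \<le> r \<Longrightarrow> r < t \<Longrightarrow> \<bar>f r - c\<bar> \<le> e"
  shows "\<bar>prim f t - prim f s - c * (t - s)\<bar> \<le> e * (t - s)"
proof -
  let ?I = "\<lambda>r. indicator {s..<t} r :: real"
  have I: "bounded_borel ?I" by (rule bounded_borel_indicator) simp
  have int: "(\<integral>r. ?I r \<partial>\<mu>) = t - s" using measure_Ico[OF st] by simp
  have "prim f t - prim f s = (\<integral>r. (if r < t then 1 else 0) * f r - (if r < s then 1 else 0) * f r \<partial>\<mu>)"
    unfolding prim_def using f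
    by (intro Bochner_Integration.integral_diff[symmetric] integrable_cell bounded_borel_less)
  also have "\<dots> = (\<integral>r. ?I r * f r \<partial>\<mu>)"
    using st by (intro Bochner_Integration.integral_cong) (auto simp: indicator_def)
  finally have "prim f t - prim f s - c * (t - s) = (\<integral>r. ?I r * f r \<partial>\<mu>) - (\<integral>r. c * ?I r \<partial>\<mu>)"
    using int by simp
  also have "\<dots> = (\<integral>r. ?I r * f r - c * ?I r \<partial>\<mu>)"
    using f by (intro Bochner_Integration.integral_diff[symmetric] integrable_cell
        bounded_borel_mult I bounded_borel_const)
  also have "\<bar>\<dots>\<bar> \<le> (\<integral>r. \<bar>?I r * f r - c * ?I r\<bar> \<partial>\<mu>)"
    by (rule integral_abs_bound)
  also have "\<dots> \<le> (\<integral>r. e * ?I r \<partial>\<mu>)"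
  proof (rule integral_mono_AE)
    have "bounded_borel (\<lambda>r. \<bar>?I r * f r + (- c) * ?I r\<bar>)"
      by (intro bounded_borel_abs bounded_borel_add bounded_borel_mult I bounded_borel_const f)
    then show "integrable \<mu> (\<lambda>r. \<bar>?I r * f r - c * ?I r\<bar>)"
      using integrable_cell by force
    show "integrable \<mu> (\<lambda>r. e * ?I r)"
      by (intro integrable_cell bounded_borel_mult I bounded_borel_const)
    show "AE r in \<mu>. \<bar>?I r * f r - c * ?I r\<bar> \<le> e * ?I r"
      using AE_cell by eventually_elim (use le in \<open>auto simp: indicator_def\<close>)
  qed
  also have "\<dots> = e * (t - s)" using int by simp
  finally show ?thesis .
qed

text \<open>The quotient is a mean of \<open>f\<close> between \<open>s\<close> and sigma(t). The
  points of \<open>T\<close> over which the mean runs are no farther from \<open>t\<close> than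
  \<open>s\<close>, because none lies strictly between \<open>t\<close> and sigma(t).\<close>

lemma prim_quotient:
  assumes f: "bounded_borel f"
    and t: "t \<in> T" "a \<le> t" "t < b" and s: "s \<in> T" "a \<le> s" "s \<le> b" "s \<noteq> fwd_jump T t"
    and le: "\<And>r. r \<in> T \<Longrightarrow> a \<le> r \<Longrightarrow> r \<le> b \<Longrightarrow> \<bar>r - t\<bar> \<le> \<bar>s - t\<bar> \<Longrightarrow> \<bar>f r - f t\<bar> \<le> e"
  shows "\<bar>(prim f (fwd_jump T t) - prim f s) / (fwd_jump T t - s) - f t\<bar> \<le> e"
proof -
  let ?\<sigma> = "fwd_jump T t"
  have \<sigma>: "?\<sigma> \<in> T" "t \<le> ?\<sigma>" "?\<sigma> \<le> b"
    using fwd_jump_in[OF closed_T t(1)] fwd_jump_ge[OF t(1)] fwd_jump_ge_le(2)[OF bT t(3)] by auto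
  have "\<bar>prim f ?\<sigma> - prim f s - f t * (?\<sigma> - s)\<bar> \<le> e * \<bar>?\<sigma> - s\<bar>"
  proof (cases "s \<le> ?\<sigma>")
    case True
    have "\<bar>f r - f t\<bar> \<le> e" if r: "r \<in> T" "s \<le> r" "r < ?\<sigma>" for r
      using le[of r] fwd_jump_ge_le(2)[of r T t] r s \<sigma> by (cases "r \<le> t") auto
    from prim_diff[OF f s(1) \<sigma>(1) s(2) True \<sigma>(3) this] show ?thesis using True by simp
  next
    case False
    have "\<bar>f r - f t\<bar> \<le> e" if r: "r \<in> T" "?\<sigma> \<le> r" "r < s" for r
      using le[of r] r s \<sigma> t by auto
    from prim_diff[OF f \<sigma>(1) s(1) _ _ s(3) this]
    have "\<bar>prim f s - prim f ?\<sigma> - f t * (s - ?\<sigma>)\<bar> \<le> e * (s - ?\<sigma>)" using False \<sigma> t by simp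
    moreover have "prim f s - prim f ?\<sigma> - f t * (s - ?\<sigma>) = - (prim f ?\<sigma> - prim f s - f t * (?\<sigma> - s))"
      by (simp add: algebra_simps)
    ultimately show ?thesis using False by (simp add: abs_minus_commute)
  qed
  moreover have "(prim f ?\<sigma> - prim f s) / (?\<sigma> - s) - f t
      = (prim f ?\<sigma> - prim f s - f t * (?\<sigma> - s)) / (?\<sigma> - s)"
    using s(4) by (simp add: field_simps)
  ultimately show ?thesis using s(4) by (simp add: abs_divide divide_le_eq)
qed

text \<open>The differentiation half of the fundamental theorem. The filter is confined to
  \<open>{a..b}\<close>, outside of which \<open>prim f\<close> is constant.\<close>

lemma prim_quotient_tendsto:
  assumes f: "bounded_borel f" and t: "t \<in> T" "a \<le> t" "t < b"
    and cont: "(f \<longlongrightarrow> f t) (at t within T \<inter> {a..b})"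
  shows "((\<lambda>s. (prim f (fwd_jump T t) - prim f s) / (fwd_jump T t - s)) \<longlongrightarrow> f t)
    (inf (nhds t) (principal (T \<inter> {a..b} - {fwd_jump T t})))"
proof (rule tendstoI)
  fix e :: real assume "e > 0"
  then have "\<forall>\<^sub>F r in at t within T \<inter> {a..b}. dist (f r) (f t) < e / 2"
    using cont by (intro tendstoD) auto
  then obtain d where d: "d > 0"
    and fd: "\<And>r. r \<in> T \<Longrightarrow> a \<le> r \<Longrightarrow> r \<le> b \<Longrightarrow> r \<noteq> t \<Longrightarrow> dist r t < d \<Longrightarrow> dist (f r) (f t) < e / 2"
    unfolding eventually_at by auto
  have "dist ((prim f (fwd_jump T t) - prim f s) / (fwd_jump T t - s)) (f t) < e"
    if s: "s \<in> T" "a \<le> s" "s \<le> b" "s \<noteq> fwd_jump T t" "dist s t < d" for s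
  proof -
    have "\<bar>f r - f t\<bar> \<le> e / 2" if "r \<in> T" "a \<le> r" "r \<le> b" "\<bar>r - t\<bar> \<le> \<bar>s - t\<bar>" for r
      using fd[of r] that s \<open>e > 0\<close> by (cases "r = t") (auto simp: dist_real_def)
    from prim_quotient[OF f t s(1-4) this] show ?thesis
      using \<open>e > 0\<close> by (auto simp: dist_real_def)
  qed
  then show "\<forall>\<^sub>F s in inf (nhds t) (principal (T \<inter> {a..b} - {fwd_jump T t})).
      dist ((prim f (fwd_jump T t) - prim f s) / (fwd_jump T t - s)) (f t) < e"
    unfolding eventually_inf_principal eventually_nhds_metric using d by auto
qed

lemma prim_lipschitz:
  assumes f: "bounded_borel f"
  obtains C where "C \<ge> 0" "\<And>s t. s \<in> T \<Longrightarrow> t \<in> T \<Longrightarrow> a \<le> s \<Longrightarrow> s \<le> b \<Longrightarrow> a \<le> t \<Longrightarrow> t \<le> b \<Longrightarrow>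
    \<bar>prim f t - prim f s\<bar> \<le> C * \<bar>t - s\<bar>"
proof -
  obtain C where C: "C \<ge> 0" "\<And>x. \<bar>f x\<bar> \<le> C" using f by (metis bounded_borelE)
  have *: "\<bar>prim f t - prim f s\<bar> \<le> C * (t - s)"
    if "s \<in> T" "t \<in> T" "a \<le> s" "s \<le> t" "t \<le> b" for s t
    using prim_diff[OF f that, of 0 C] C by simp
  show thesis
  proof (rule that[of C])
    fix s t assume "s \<in> T" "t \<in> T" "a \<le> s" "s \<le> b" "a \<le> t" "t \<le> b"
    then show "\<bar>prim f t - prim f s\<bar> \<le> C * \<bar>t - s\<bar>"
      using *[of s t] *[of t s] by (cases "s \<le> t") (auto simp: abs_minus_commute)
  qed fact
qed

lemma prim_continuous:
  assumes f: "bounded_borel f" and t: "t \<in> T" "a \<le> t" "t \<le> b"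
  shows "(prim f \<longlongrightarrow> prim f t) (at t within T \<inter> {a..b})"
proof -
  obtain C where C: "C \<ge> 0" "\<And>s t. s \<in> T \<Longrightarrow> t \<in> T \<Longrightarrow> a \<le> s \<Longrightarrow> s \<le> b \<Longrightarrow> a \<le> t \<Longrightarrow> t \<le> b \<Longrightarrow>
    \<bar>prim f t - prim f s\<bar> \<le> C * \<bar>t - s\<bar>" using prim_lipschitz[OF f] by metis
  have "((\<lambda>s. C * \<bar>s - t\<bar>) \<longlongrightarrow> C * \<bar>t - t\<bar>) (at t within T \<inter> {a..b})"
    by (intro tendsto_intros)
  then have "((\<lambda>s. C * \<bar>s - t\<bar>) \<longlongrightarrow> 0) (at t within T \<inter> {a..b})" by simp
  then have "((\<lambda>s. prim f s - prim f t) \<longlongrightarrow> 0) (at t within T \<inter> {a..b})"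
    by (rule Lim_null_comparison[rotated])
      (use C t in \<open>auto simp: eventually_at_filter intro!: always_eventually\<close>)
  then show ?thesis using Lim_null by blast
qed

lemma delta_filter_value:
  assumes "(q \<longlongrightarrow> D) (delta_filter S t)" "t \<in> S" "fwd_jump S t \<noteq> t"
  shows "q t = (D::real)"
proof (rule ccontr)
  assume "q t \<noteq> D"
  then have "\<forall>\<^sub>F s in delta_filter S t. dist (q s) D < dist (q t) D"
    using assms(1) by (intro tendstoD) auto
  then have "\<forall>\<^sub>F s in nhds t. s \<in> S - {fwd_jump S t} \<longrightarrow> dist (q s) D < dist (q t) D"
    by (simp add: delta_filter_def eventually_inf_principal)
  from eventually_nhds_x_imp_x[OF this] show False using assms by auto
qed

text \<open>At a left-dense \<open>t\<close> the hypothesis on the quotients forces \<open>g\<close> to be left-continuous, also when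
  \<open>t\<close> is right-scattered, so the estimate up to \<open>e * (t - a)\<close> passes to \<open>t\<close>.\<close>

lemma increment_eq_prim:
  assumes f: "bounded_borel f"
    and S: "S \<subseteq> T" "\<And>s t. t \<in> S \<Longrightarrow> s \<in> T \<Longrightarrow> s \<le> t \<Longrightarrow> s \<in> S"
    and u: "u \<in> S" "a \<le> u" "u \<le> b"
    and lim: "\<And>t. t \<in> ts_kappa S \<Longrightarrow> a \<le> t \<Longrightarrow> t \<le> u \<Longrightarrow>
      ((\<lambda>s. (g (fwd_jump S t) - g s) / (fwd_jump S t - s)) \<longlongrightarrow> D t) (delta_filter S t)"
    and eq: "\<And>t. t \<in> S \<Longrightarrow> a \<le> t \<Longrightarrow> t < u \<Longrightarrow> D t = f t"
    and cont: "\<And>t. t \<in> T \<Longrightarrow> a \<le> t \<Longrightarrow> t < u \<Longrightarrow> right_dense T t \<Longrightarrow>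
      (f \<longlongrightarrow> f t) (at t within {s\<in>T. t < s \<and> s < u})"
  shows "g u - g a = prim f u"
proof -
  \<comment> \<open>The error may grow linearly in \<open>t - a\<close>: each step of the induction
    adds at most \<open>e\<close> times its length, and \<open>e\<close> is sent to 0 at the
    end.\<close>
  have P: "\<bar>g u - g a - prim f u\<bar> \<le> e * (u - a)" if e: "e > 0" for e
  proof (rule time_scale_induct[where P="\<lambda>t. \<bar>g t - g a - prim f t\<bar> \<le> e * (t - a)", OF closed_T aT])
    show "u \<in> T" "a \<le> u" using u S by auto
    show "\<bar>g a - g a - prim f a\<bar> \<le> e * (a - a)" using prim_base[OF f] by simp
  next
    fix t assume t: "t \<in> T" "a \<le> t" "t < u" "\<bar>g t - g a - prim f t\<bar> \<le> e * (t - a)"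
      and lt: "t < fwd_jump T t"
    let ?\<sigma> = "fwd_jump T t"
    have tS: "t \<in> S" using S(2)[OF u(1) t(1)] t by simp
    have k: "t \<in> ts_kappa S" using ts_kappaI_less[OF tS u(1) t(3)] .
    have \<sigma>: "fwd_jump S t = ?\<sigma>" by (rule fwd_jump_lower[OF S u(1) t(3)])
    have "(g ?\<sigma> - g t) / (?\<sigma> - t) = f t"
      using delta_filter_value[OF lim[OF k t(2)] tS] lt t(3) eq[OF tS t(2,3)] by (simp add: \<sigma>)
    then have "g ?\<sigma> - g t = f t * (?\<sigma> - t)" using lt by (simp add: field_simps)
    moreover have "\<bar>prim f ?\<sigma> - prim f t - f t * (?\<sigma> - t)\<bar> \<le> 0 * (?\<sigma> - t)"
    proof (rule prim_diff[OF f t(1) fwd_jump_in[OF closed_T t(1)] t(2)])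
      have "u \<in> T" using S u by auto
      then show "?\<sigma> \<le> b" using fwd_jump_ge_le(2)[of u T t] t u by simp
      fix r assume "r \<in> T" "t \<le> r" "r < ?\<sigma>"
      then have "r = t" using fwd_jump_ge_le(2)[of r T t] by force
      then show "\<bar>f r - f t\<bar> \<le> 0" by simp
    qed (use lt in auto)
    moreover have "e * (t - a) \<le> e * (?\<sigma> - a)" using e lt by simp
    ultimately show "\<bar>g ?\<sigma> - g a - prim f ?\<sigma>\<bar> \<le> e * (?\<sigma> - a)"
      using t(4) by linarith
  next
    fix t assume t: "t \<in> T" "a \<le> t" "t < u" "\<bar>g t - g a - prim f t\<bar> \<le> e * (t - a)"
      and d: "fwd_jump T t = t"
    have uT: "u \<in> T" using S u by auto
    have tS: "t \<in> S" using S(2)[OF u(1) t(1)] t by simp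
    have k: "t \<in> ts_kappa S" using ts_kappaI_less[OF tS u(1) t(3)] .
    have \<sigma>: "fwd_jump S t = t" using fwd_jump_lower[OF S u(1) t(3)] d by simp
    \<comment> \<open>Half of \<open>e\<close> is for the quotient of \<open>g\<close>, the other
      half for the oscillation of \<open>f\<close> to the right of \<open>t\<close>.\<close>
    have "\<forall>\<^sub>F s in delta_filter S t. dist ((g t - g s) / (t - s)) (f t) < e / 2"
      using tendstoD[OF lim[OF k t(2)], of "e/2"] t e eq[OF tS t(2,3)] by (simp add: \<sigma>)
    then obtain d1 where d1: "d1 > 0" "\<And>s. s \<in> S \<Longrightarrow> s \<noteq> t \<Longrightarrow> dist s t < d1 \<Longrightarrow>
        dist ((g t - g s) / (t - s)) (f t) < e / 2"
      unfolding delta_filter_def \<sigma> eventually_inf_principal eventually_nhds_metric by auto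
    have "right_dense T t" using right_dense_iff[OF uT t(3)] d by simp
    from tendstoD[OF cont[OF t(1-3) this], of "e/2"] e
    obtain d2 where d2: "d2 > 0" "\<And>s. s \<in> T \<Longrightarrow> t < s \<Longrightarrow> s < u \<Longrightarrow> dist s t < d2 \<Longrightarrow>
        dist (f s) (f t) < e / 2"
      unfolding eventually_at by auto
    show "\<exists>y>t. \<forall>s\<in>T. t < s \<and> s \<le> y \<and> s \<le> u \<longrightarrow> \<bar>g s - g a - prim f s\<bar> \<le> e * (s - a)"
    proof (intro exI[of _ "t + min d1 d2 / 2"] conjI ballI impI)
      show "t < t + min d1 d2 / 2" using d1 d2 by simp
      fix s assume s: "s \<in> T" "t < s \<and> s \<le> t + min d1 d2 / 2 \<and> s \<le> u"
      then have sS: "s \<in> S" using S(2)[OF u(1)] by blast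
      have "dist ((g t - g s) / (t - s)) (f t) < e / 2"
        using s d1 d2 by (intro d1(2) sS) (auto simp: dist_real_def)
      moreover have "(g t - g s) / (t - s) - f t = (g s - g t - f t * (s - t)) / (s - t)"
        using s by (simp add: field_simps)
      ultimately have "\<bar>g s - g t - f t * (s - t)\<bar> \<le> e / 2 * (s - t)"
        using s by (simp add: dist_real_def abs_divide divide_less_eq)
      moreover have "\<bar>prim f s - prim f t - f t * (s - t)\<bar> \<le> e / 2 * (s - t)"
      proof (rule prim_diff[OF f t(1) s(1) t(2)])
        fix r assume "r \<in> T" "t \<le> r" "r < s"
        moreover have "s < t + d2" using s d2(1) min.cobounded2[of d1 d2] by linarith
        ultimately show "\<bar>f r - f t\<bar> \<le> e / 2"
          using d2(2)[of r] s e by (cases "r = t") (auto simp: dist_real_def)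
      qed (use s u in auto)
      moreover have "e * (s - a) = e / 2 * (s - t) + e / 2 * (s - t) + e * (t - a)"
        by (simp add: field_simps)
      ultimately show "\<bar>g s - g a - prim f s\<bar> \<le> e * (s - a)" using t(4) by linarith
    qed
  next
    fix t assume t: "t \<in> T" "a < t" "t \<le> u" and ld: "\<And>y. y < t \<Longrightarrow> \<exists>s\<in>T. y < s \<and> s < t"
      and IH: "\<And>s. s \<in> T \<Longrightarrow> a \<le> s \<Longrightarrow> s < t \<Longrightarrow> \<bar>g s - g a - prim f s\<bar> \<le> e * (s - a)"
    have tS: "t \<in> S" using S(2)[OF u(1) t(1)] t by simp
    have k: "t \<in> ts_kappa S"
    proof (rule ts_kappaI_left[OF tS])
      fix y assume "y < t"
      then obtain s where "s \<in> T" "y < s" "s < t" using ld by blast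
      then show "\<exists>s\<in>S. y < s \<and> s < t" using S(2)[OF tS, of s] by auto
    qed
    let ?F = "at t within {s\<in>T. a \<le> s \<and> s < t}"
    let ?\<sigma> = "fwd_jump S t"
    have \<sigma>: "t \<le> ?\<sigma>" using fwd_jump_ge[OF tS] .
    have F: "?F \<noteq> bot"
      unfolding trivial_limit_within islimpt_approachable
    proof (intro notI, erule notE, intro allI impI)
      fix d :: real assume "d > 0"
      then obtain s where "s \<in> T" "max a (t - d) < s" "s < t" using ld[of "max a (t - d)"] t by auto
      then show "\<exists>x'\<in>{s \<in> T. a \<le> s \<and> s < t}. x' \<noteq> t \<and> dist x' t < d"
        by (intro bexI[of _ s]) (auto simp: dist_real_def)
    qed
    have "?F \<le> delta_filter S t"
      unfolding delta_filter_def at_within_def using \<sigma> S(2)[OF tS]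
      by (intro inf_mono order_refl) auto
    then have q: "((\<lambda>s. (g ?\<sigma> - g s) / (?\<sigma> - s)) \<longlongrightarrow> D t) ?F"
      using lim[OF k] t by (intro tendsto_mono[of ?F]) auto
    \<comment> \<open>Solving the quotient for \<open>g s\<close> turns its limit into a limit of
      \<open>g\<close> from the left.\<close>
    have "((\<lambda>s. g ?\<sigma> - (g ?\<sigma> - g s) / (?\<sigma> - s) * (?\<sigma> - s)) \<longlongrightarrow> g ?\<sigma> - D t * (?\<sigma> - t)) ?F"
      by (intro tendsto_intros q)
    moreover have "g ?\<sigma> - D t * (?\<sigma> - t) = g t"
    proof (cases "?\<sigma> = t")
      case False
      then have "(g ?\<sigma> - g t) / (?\<sigma> - t) = D t"
        using delta_filter_value[OF lim[OF k] tS] t by auto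
      then show ?thesis using False by (simp add: field_simps)
    qed simp
    moreover have "\<forall>\<^sub>F s in ?F. g ?\<sigma> - (g ?\<sigma> - g s) / (?\<sigma> - s) * (?\<sigma> - s) = g s"
      using \<sigma> by (auto simp: eventually_at_filter intro!: always_eventually)
    ultimately have g: "(g \<longlongrightarrow> g t) ?F" using Lim_transform_eventually by fastforce
    have "(prim f \<longlongrightarrow> prim f t) (at t within T \<inter> {a..b})"
      using t u by (intro prim_continuous f) auto
    then have p: "(prim f \<longlongrightarrow> prim f t) ?F"
      by (rule tendsto_within_subset) (use t u in auto)
    show "\<bar>g t - g a - prim f t\<bar> \<le> e * (t - a)"
    proof (rule tendsto_le[OF F])
      show "((\<lambda>s. e * (s - a)) \<longlongrightarrow> e * (t - a)) ?F" by (intro tendsto_intros)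
      show "((\<lambda>s. \<bar>g s - g a - prim f s\<bar>) \<longlongrightarrow> \<bar>g t - g a - prim f t\<bar>) ?F"
        by (intro tendsto_intros g p)
      show "\<forall>\<^sub>F s in ?F. \<bar>g s - g a - prim f s\<bar> \<le> e * (s - a)"
        using IH by (auto simp: eventually_at_filter intro!: always_eventually)
    qed
  qed
  have "\<bar>g u - g a - prim f u\<bar> \<le> 0"
  proof (rule field_le_epsilon)
    fix e :: real assume "e > 0"
    \<comment> \<open>The added 1 keeps the denominator positive when \<open>u = a\<close>.\<close>
    then have "0 < e / (u - a + 1)" "e / (u - a + 1) * (u - a) \<le> e"
      using u(2) by (auto simp: field_simps)
    then show "\<bar>g u - g a - prim f u\<bar> \<le> 0 + e"
      using P[of "e / (u - a + 1)"] by linarith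
  qed
  then show ?thesis by simp
qed

end

section \<open>Iterated backward jumps\<close>

lemma bwd_jump_le:
  assumes "t \<in> T"
  shows "bwd_jump T t \<le> t"
proof (cases "\<exists>s\<in>T. s < t")
  case True
  then show ?thesis by (auto simp: bwd_jump_def intro!: cSup_least)
next
  case False
  then have "Inf T = t" using assms by (intro cInf_eq_minimum) (auto simp: not_less)
  then show ?thesis using False by (simp add: bwd_jump_def)
qed

lemma bwd_jump_in:
  assumes "closed T" "t \<in> T"
  shows "bwd_jump T t \<in> T"
proof (cases "\<exists>s\<in>T. s < t")
  case True
  then have "Sup {s\<in>T. s < t} \<in> closure {s\<in>T. s < t}"
    by (intro closure_contains_Sup bdd_aboveI[of _ t]) auto
  also have "\<dots> \<subseteq> T" using assms by (intro closure_minimal) auto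
  finally show ?thesis using True by (simp add: bwd_jump_def)
next
  case False
  then have "Inf T = t" using assms by (intro cInf_eq_minimum) (auto simp: not_less)
  then show ?thesis using False assms by (simp add: bwd_jump_def)
qed

lemma le_bwd_jump:
  assumes "s \<in> T" "s < t"
  shows "s \<le> bwd_jump T t"
proof -
  have "s \<le> Sup {s\<in>T. s < t}" using assms by (intro cSup_upper bdd_aboveI[of _ t]) auto
  then show ?thesis using assms by (auto simp: bwd_jump_def)
qed

lemma bwd_jump_mono:
  assumes "closed T" "s \<in> T" "t \<in> T" "s \<le> t"
  shows "bwd_jump T s \<le> bwd_jump T t"
proof (cases "s = t")
  case False
  then have "s \<le> bwd_jump T t" using assms by (intro le_bwd_jump) auto
  then show ?thesis using bwd_jump_le[OF assms(2)] by simp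
qed simp

lemma bwd_iter_in: "closed T \<Longrightarrow> t \<in> T \<Longrightarrow> (bwd_jump T ^^ k) t \<in> T"
  by (induction k) (auto intro: bwd_jump_in)

lemma bwd_iter_mono:
  assumes "closed T" "s \<in> T" "t \<in> T" "s \<le> t"
  shows "(bwd_jump T ^^ k) s \<le> (bwd_jump T ^^ k) t"
  by (induction k) (auto intro: bwd_jump_mono bwd_iter_in assms)

lemma bwd_iter_Suc_le: "closed T \<Longrightarrow> t \<in> T \<Longrightarrow> (bwd_jump T ^^ Suc k) t \<le> (bwd_jump T ^^ k) t"
  by (auto intro: bwd_jump_le bwd_iter_in)

lemma bwd_iter_antimono:
  assumes "closed T" "t \<in> T" "k \<le> l"
  shows "(bwd_jump T ^^ l) t \<le> (bwd_jump T ^^ k) t"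
  using assms(3)
proof (induction l rule: dec_induct)
  case (step l)
  then show ?case using bwd_iter_Suc_le[OF assms(1,2), of l] by simp
qed simp

lemma left_dense_points:
  assumes "t \<in> T" "c \<in> T" "c < t" "bwd_jump T t = t" "y < t"
  shows "\<exists>s\<in>T. y < s \<and> s < t"
proof -
  have "y < Sup {s\<in>T. s < t}" using assms by (auto simp: bwd_jump_def split: if_splits)
  moreover have "{s\<in>T. s < t} \<noteq> {}" using assms by auto
  ultimately obtain s where "s \<in> {s\<in>T. s < t}" "y < s" using less_cSupE by blast
  then show ?thesis by auto
qed

text \<open>One more jump is afforded by starting between the old starting point \<open>y\<close>
  and \<open>t\<close>: the first jump from there lands at or above \<open>y\<close>.\<close>

lemma bwd_iter_left_dense:
  assumes "closed T" "t \<in> T" "c \<in> T" "c < t" "bwd_jump T t = t"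
  shows "\<exists>y\<in>T. y < t \<and> c < (bwd_jump T ^^ k) y"
proof (induction k)
  case 0
  then show ?case using left_dense_points[OF assms(2-5), of c] assms by auto
next
  case (Suc k)
  then obtain y where y: "y \<in> T" "y < t" "c < (bwd_jump T ^^ k) y" by blast
  obtain z where z: "z \<in> T" "y < z" "z < t"
    using left_dense_points[OF assms(2-5) y(2)] by blast
  have "(bwd_jump T ^^ k) y \<le> (bwd_jump T ^^ k) (bwd_jump T z)"
    using y z assms by (intro bwd_iter_mono le_bwd_jump bwd_jump_in) auto
  then show ?case using y z by (intro bexI[of _ z]) (auto simp: funpow_Suc_right simp del: funpow.simps)
qed

text \<open>Trades one backward jump for a strictly smaller starting point: the predecessor of a
  left-scattered \<open>t\<close>, or a point close enough to a left-dense one. The induction for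
  positivity of the monomials needs this exchange.\<close>

lemma bwd_iter_predecessor:
  assumes "closed T" "t \<in> T" "c \<in> T" "c < (bwd_jump T ^^ Suc k) t"
  shows "\<exists>y\<in>T. y < t \<and> c < (bwd_jump T ^^ k) y"
proof (cases "bwd_jump T t = t")
  case True
  have "c < t" using bwd_iter_antimono[OF assms(1,2), of 0 "Suc k"] assms(4) by simp
  then show ?thesis using bwd_iter_left_dense[OF assms(1-3) _ True] by blast
next
  case False
  then show ?thesis using assms bwd_jump_le[OF assms(2)]
    by (intro bexI[of _ "bwd_jump T t"])
      (auto simp: funpow_Suc_right simp del: funpow.simps intro: bwd_jump_in)
qed

section \<open>Iterated primitives and time scale monomials\<close>

context ts_interval
begin

lemma prim_mono:
  assumes "bounded_borel f" "bounded_borel g"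
    and "\<And>t. t \<in> T \<Longrightarrow> a \<le> t \<Longrightarrow> t < b \<Longrightarrow> t < x \<Longrightarrow> f t \<le> g t"
  shows "prim f x \<le> prim g x"
  unfolding prim_def
proof (intro integral_mono_AE integrable_cell bounded_borel_less assms(1,2))
  show "AE t in \<mu>. (if t < x then 1 else 0) * f t \<le> (if t < x then 1 else 0) * g t"
    using AE_cell by eventually_elim (use assms(3) in auto)
qed

lemma prim_nonneg:
  assumes "bounded_borel f" "\<And>t. 0 \<le> f t"
  shows "0 \<le> prim f x"
  unfolding prim_def using assms by (intro integral_nonneg_AE) auto

lemma prim_incr:
  assumes "bounded_borel f" "\<And>t. 0 \<le> f t" "x \<le> y"
  shows "prim f x \<le> prim f y"
  unfolding prim_def using assms
  by (intro integral_mono_AE integrable_cell bounded_borel_less) auto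

text \<open>Measurability comes from monotonicity, which is why \<open>f\<close> is taken
  nonnegative.\<close>

lemma bounded_borel_prim:
  assumes "bounded_borel f" "\<And>t. 0 \<le> f t"
  shows "bounded_borel (prim f)"
proof (rule bounded_borelI)
  show "prim f \<in> borel_measurable borel"
    by (intro borel_measurable_mono monoI prim_incr assms)
  show "\<bar>prim f x\<bar> \<le> (\<integral>t. f t \<partial>\<mu>)" for x
  proof -
    have "prim f x \<le> (\<integral>t. f t \<partial>\<mu>)" unfolding prim_def using assms
      by (intro integral_mono_AE integrable_cell bounded_borel_less) auto
    then show ?thesis using prim_nonneg[OF assms] by simp
  qed
qed

lemma delta_integral_cell:
  assumes f: "bounded_borel f" and "a \<le> s" "s \<le> t" "t \<le> b"
    and eq: "\<And>u. u \<in> T \<Longrightarrow> s \<le> u \<Longrightarrow> u < t \<Longrightarrow> g u = f u"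
  shows "delta_integral T s t g = (\<integral>u. indicator {s..<t} u * f u \<partial>\<mu>)"
proof -
  have "delta_integral T s t g = (\<integral>u. indicator ({s..<t} \<inter> T) u *\<^sub>R f u \<partial>delta_measure T)"
    unfolding delta_integral_def set_lebesgue_integral_def using assms
    by (simp) (intro Bochner_Integration.integral_cong, auto simp: indicator_def)
  also have "\<dots> = (\<integral>u. indicator ({a..<b} \<inter> T) u *\<^sub>R (indicator {s..<t} u * f u) \<partial>delta_measure T)"
    using assms by (intro Bochner_Integration.integral_cong) (auto simp: indicator_def)
  also have "\<dots> = (\<integral>u. indicator {s..<t} u * f u \<partial>density (delta_measure T) (\<lambda>x. ennreal (indicator ({a..<b} \<inter> T) x)))"
    using meas_T bounded_borel_measurable[OF f] by (intro integral_density[symmetric]) auto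
  also have "\<dots> = (\<integral>u. indicator {s..<t} u * f u \<partial>\<mu>)"
    by (simp add: cell_measure_def ennreal_indicator)
  finally show ?thesis .
qed

text \<open>An extension of \<open>ts_monomial T k\<close> with base point \<open>s\<close> that is nonnegative and monotone on the whole
  real line.\<close>

primrec mono_ext :: "real \<Rightarrow> nat \<Rightarrow> real \<Rightarrow> real" where
  "mono_ext s 0 = (\<lambda>_. 1)"
| "mono_ext s (Suc k) = prim (\<lambda>u. indicator {s..} u * mono_ext s k u)"

lemma mono_ext: "bounded_borel (mono_ext s k)" "0 \<le> mono_ext s k x"
proof -
  have "bounded_borel (mono_ext s k) \<and> (\<forall>x. 0 \<le> mono_ext s k x)"
  proof (induction k)
    case (Suc k)
    then have "bounded_borel (\<lambda>u. indicator {s..} u * mono_ext s k u)"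
      by (intro bounded_borel_mult bounded_borel_indicator) auto
    with Suc show ?case by (auto intro!: bounded_borel_prim prim_nonneg)
  qed (simp add: bounded_borel_const)
  then show "bounded_borel (mono_ext s k)" "0 \<le> mono_ext s k x" by auto
qed

lemma bounded_borel_mono_ext: "bounded_borel (\<lambda>u. indicator {s..} u * mono_ext s k u)"
  by (intro bounded_borel_mult bounded_borel_indicator mono_ext) auto

lemma ts_monomial_eq:
  assumes "a \<le> s" "s \<le> t" "t \<le> b"
  shows "ts_monomial T k t s = mono_ext s k t"
  using assms(2,3)
proof (induction k arbitrary: t)
  case (Suc k)
  have "delta_integral T s t (\<lambda>u. ts_monomial T k u s)
      = (\<integral>u. indicator {s..<t} u * mono_ext s k u \<partial>\<mu>)"
    by (intro delta_integral_cell mono_ext assms(1) Suc) (use Suc in auto)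
  also have "\<dots> = prim (\<lambda>u. indicator {s..} u * mono_ext s k u) t"
    unfolding prim_def by (intro Bochner_Integration.integral_cong) (auto simp: indicator_def)
  finally show ?case by simp
qed simp

lemma mono_ext_incr: "x \<le> y \<Longrightarrow> mono_ext s k x \<le> mono_ext s k y"
  by (cases k) (auto intro!: prim_incr bounded_borel_mono_ext simp: mono_ext)

lemma prim_iter_bounded_borel:
  assumes "bounded_borel f" "\<And>t. 0 \<le> f t"
  shows "bounded_borel ((prim ^^ k) f)" "0 \<le> (prim ^^ k) f t"
proof -
  have "bounded_borel ((prim ^^ k) f) \<and> (\<forall>t. 0 \<le> (prim ^^ k) f t)"
    using assms by (induction k) (auto intro: bounded_borel_prim prim_nonneg)
  then show "bounded_borel ((prim ^^ k) f)" "0 \<le> (prim ^^ k) f t" by auto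
qed

text \<open>Iterated primitives vanish at \<open>a\<close>, and the next point of \<open>T\<close> is \<open>\<sigma>(a)\<close>: this is why the monomial may
  be based at \<open>\<sigma>(a)\<close>.\<close>

lemma prim_iter_le:
  assumes f: "bounded_borel f" "\<And>t. 0 \<le> f t"
  shows "(prim ^^ Suc k) f x \<le> mono_ext (fwd_jump T a) k x * prim f x"
proof (induction k arbitrary: x)
  case (Suc k)
  let ?s = "fwd_jump T a" and ?g = "(prim ^^ Suc k) f"
  have g: "bounded_borel ?g" "\<And>t. 0 \<le> ?g t" by (rule prim_iter_bounded_borel[OF f])+
  have "prim ?g x \<le> prim (\<lambda>u. prim f x * (indicator {?s..} u * mono_ext ?s k u)) x"
  proof (rule prim_mono[OF g(1)])
    show "bounded_borel (\<lambda>u. prim f x * (indicator {?s..} u * mono_ext ?s k u))"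
      by (intro bounded_borel_mult[OF bounded_borel_const] bounded_borel_mono_ext)
    fix t assume t: "t \<in> T" "a \<le> t" "t < b" "t < x"
    show "?g t \<le> prim f x * (indicator {?s..} t * mono_ext ?s k t)"
    proof (cases "t = a")
      case True
      then have "?g t = 0" using prim_base prim_iter_bounded_borel[OF f] by simp
      then show ?thesis using prim_nonneg[OF f] mono_ext(2) by (simp add: indicator_def)
    next
      case False
      then have "?s \<le> t" using fwd_jump_ge_le(2)[of t T a] t by simp
      moreover have "?g t \<le> mono_ext ?s k t * prim f t" by (rule Suc)
      moreover have "\<dots> \<le> mono_ext ?s k t * prim f x"
        using prim_incr[OF f, of t x] t mono_ext(2) by (intro mult_left_mono) auto
      ultimately show ?thesis by (simp add: mult.commute)
    qed
  qed
  also have "\<dots> = prim f x * prim (\<lambda>u. indicator {?s..} u * mono_ext ?s k u) x"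
    unfolding prim_def by (subst integral_mult_right_zero[symmetric]) (simp only: mult.left_commute)
  finally show ?case by (simp add: mult.commute)
qed simp

text \<open>Choose \<open>y < x\<close> from which one jump fewer still ends above \<open>a\<close>.
  On \<open>{y..<x}\<close> the integrand of the next primitive is at least its positive value at
  \<open>y\<close>, because \<open>y\<close> is not below sigma(a) and the extension is monotone. At
  \<open>x = b\<close> this turns a < rho^(lambda-1)(b) into positivity of the factors of H.\<close>

lemma mono_ext_pos:
  assumes "x \<in> T" "x \<le> b" "a < (bwd_jump T ^^ k) x"
  shows "0 < mono_ext (fwd_jump T a) k x"
  using assms
proof (induction k arbitrary: x)
  case (Suc k)
  let ?s = "fwd_jump T a" and ?g = "\<lambda>u. indicator {fwd_jump T a..} u * mono_ext (fwd_jump T a) k u"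
  obtain y where y: "y \<in> T" "y < x" "a < (bwd_jump T ^^ k) y"
    using bwd_iter_predecessor[OF closed_T Suc.prems(1) aT Suc.prems(3)] by blast
  have ay: "a < y" using bwd_iter_antimono[OF closed_T y(1), of 0 k] y by simp
  have sy: "?s \<le> y" using fwd_jump_ge_le(2)[of y T a] y ay by simp
  have pos: "0 < mono_ext ?s k y" using Suc y by auto
  let ?c = "mono_ext ?s k y"
  have "?c * (x - y) = (\<integral>u. ?c * indicator {y..<x} u \<partial>\<mu>)"
    using measure_Ico[of y x] y ay Suc.prems by simp
  also have "\<dots> \<le> prim ?g x" unfolding prim_def
  proof (rule integral_mono_AE)
    show "integrable \<mu> (\<lambda>u. ?c * indicator {y..<x} u)"
      by (intro integrable_cell bounded_borel_mult bounded_borel_const bounded_borel_indicator) auto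
    show "integrable \<mu> (\<lambda>t. (if t < x then 1 else 0) * ?g t)"
      by (intro integrable_cell bounded_borel_less bounded_borel_mono_ext)
    show "AE u in \<mu>. ?c * indicator {y..<x} u \<le> (if u < x then 1 else 0) * ?g u"
      using sy mono_ext mono_ext_incr by (auto simp: indicator_def)
  qed
  finally have "?c * (x - y) \<le> mono_ext ?s (Suc k) x" by simp
  moreover have "0 < ?c * (x - y)" using pos y by simp
  ultimately show ?case by linarith
qed simp

end

section \<open>Integration in one of several variables\<close>

lemma vec_upd_nth [simp]: "vec_upd x j t $ i = (if i = j then t else x $ i)"
  by (simp add: vec_upd_def)

lemma vec_upd_upd [simp]: "vec_upd (vec_upd x j s) j t = vec_upd x j t"
  by (simp add: vec_eq_iff)

lemma vec_upd_id [simp]: "vec_upd x j (x $ j) = x"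
  by (simp add: vec_eq_iff)

lemma vec_upd_commute: "i \<noteq> j \<Longrightarrow> vec_upd (vec_upd x i s) j t = vec_upd (vec_upd x j t) i s"
  by (simp add: vec_eq_iff)

lemma continuous_vec_upd:
  "continuous_on UNIV (\<lambda>p. vec_upd (fst p) j (snd p) :: real ^ 'n::finite)"
  unfolding vec_upd_def
proof (rule continuous_on_vec_lambda)
  fix i
  show "continuous_on UNIV (\<lambda>p. if i = j then snd p else (fst p :: real ^ 'n) $ i)"
    by (cases "i = j") (auto intro!: continuous_intros)
qed

lemma measurable_vec_upd [measurable]:
  "(\<lambda>p. vec_upd (fst p) j (snd p) :: real ^ 'n::finite) \<in> borel \<Otimes>\<^sub>M borel \<rightarrow>\<^sub>M borel"
  unfolding borel_prod by (rule borel_measurable_continuous_onI[OF continuous_vec_upd])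

lemma measurable_vec_nth [measurable]: "(\<lambda>x :: real ^ 'n::finite. x $ j) \<in> borel_measurable borel"
  by (intro borel_measurable_continuous_onI continuous_intros)

lemma measurable_vec_upd2 [measurable (raw)]:
  assumes "f \<in> M \<rightarrow>\<^sub>M borel" "g \<in> M \<rightarrow>\<^sub>M borel"
  shows "(\<lambda>p. vec_upd (f p) j (g p) :: real ^ 'n::finite) \<in> M \<rightarrow>\<^sub>M borel"
  using measurable_compose[OF measurable_Pair[OF assms] measurable_vec_upd] by simp

lemma bounded_borel_slice:
  fixes \<phi> :: "real ^ 'n::finite \<Rightarrow> real"
  assumes "bounded_borel \<phi>"
  shows "bounded_borel (\<lambda>t. \<phi> (vec_upd x j t))"
proof -
  obtain C where [measurable]: "\<phi> \<in> borel_measurable borel" and "\<And>x. \<bar>\<phi> x\<bar> \<le> C"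
    using assms by (metis bounded_borelE)
  then show ?thesis by (intro bounded_borelI[where C=C]) auto
qed

text \<open>The kernel is 1 for integration over the whole cell and the indicator of
  \<open>t < x $ j\<close> for a primitive, so boundedness and Fubini are proved once for
  both.\<close>

definition kernel_op ::
  "real measure \<Rightarrow> 'n \<Rightarrow> (real \<Rightarrow> real \<Rightarrow> real) \<Rightarrow> (real ^ 'n \<Rightarrow> real) \<Rightarrow> real ^ 'n \<Rightarrow> real" where
  "kernel_op M j \<theta> \<phi> x = (\<integral>t. \<theta> (x $ j) t * \<phi> (vec_upd x j t) \<partial>M)"

definition unit_kernel :: "(real \<Rightarrow> real \<Rightarrow> real) \<Rightarrow> bool" where
  "unit_kernel \<theta> \<longleftrightarrow> case_prod \<theta> \<in> borel_measurable (borel \<Otimes>\<^sub>M borel) \<and> (\<forall>s t. 0 \<le> \<theta> s t \<and> \<theta> s t \<le> 1)"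

lemma unit_kernel_one: "unit_kernel (\<lambda>_ _. 1)"
  by (simp add: unit_kernel_def)

lemma unit_kernel_less: "unit_kernel (\<lambda>s t. if t < s then 1 else 0)"
  by (auto simp: unit_kernel_def)

lemma unit_kernelD:
  assumes "unit_kernel \<theta>"
  shows "f \<in> borel_measurable M \<Longrightarrow> g \<in> borel_measurable M \<Longrightarrow> (\<lambda>p. \<theta> (f p) (g p)) \<in> borel_measurable M"
    and "0 \<le> \<theta> s t" "\<theta> s t \<le> 1"
  using assms measurable_compose[OF measurable_Pair, of f M borel g borel "case_prod \<theta>" borel]
  by (auto simp: unit_kernel_def)

lemma unit_kernel_le:
  assumes "unit_kernel \<theta>" "\<bar>y\<bar> \<le> C"
  shows "\<bar>\<theta> s t * y\<bar> \<le> C"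
proof -
  have "\<theta> s t * \<bar>y\<bar> \<le> 1 * C" using assms unit_kernelD(2,3)[OF assms(1)] by (intro mult_mono) auto
  then show ?thesis using unit_kernelD(2)[OF assms(1)] by (simp add: abs_mult)
qed

locale borel_finite = finite_measure M for M :: "real measure" +
  assumes sets_borel [simp, measurable_cong]: "sets M = sets borel"
begin

lemma kernel_integrable:
  assumes "unit_kernel \<theta>" "bounded_borel (\<phi> :: real ^ 'n::finite \<Rightarrow> real)"
  shows "integrable M (\<lambda>t. \<theta> s t * \<phi> (vec_upd x j t))"
proof -
  obtain C where C: "\<phi> \<in> borel_measurable borel" "\<And>x. \<bar>\<phi> x\<bar> \<le> C"
    using assms by (metis bounded_borelE)
  note [measurable] = C(1) unit_kernelD(1)[OF assms(1)]
  show ?thesis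
    by (intro integrable_const_bound[where B=C])
      (auto intro!: always_eventually unit_kernel_le[OF assms(1)] C(2))
qed

lemma kernel_op_bounded_borel:
  assumes "unit_kernel \<theta>" "bounded_borel (\<phi> :: real ^ 'n::finite \<Rightarrow> real)"
  shows "bounded_borel (kernel_op M j \<theta> \<phi>)"
proof -
  obtain C where C: "\<phi> \<in> borel_measurable borel" "\<And>x. \<bar>\<phi> x\<bar> \<le> C"
    using assms by (metis bounded_borelE)
  note [measurable] = C(1) unit_kernelD(1)[OF assms(1)]
  show ?thesis
  proof (rule bounded_borelI)
    show "kernel_op M j \<theta> \<phi> \<in> borel_measurable borel"
      unfolding kernel_op_def
    proof (rule borel_measurable_lebesgue_integral)
      have "(\<lambda>(x, t). \<theta> (x $ j) t * \<phi> (vec_upd x j t)) \<in> borel_measurable (borel \<Otimes>\<^sub>M borel)"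
        by measurable
      then show "(\<lambda>(x, t). \<theta> (x $ j) t * \<phi> (vec_upd x j t)) \<in> borel_measurable (borel \<Otimes>\<^sub>M M)"
        by (simp cong: measurable_cong_sets sets_pair_measure_cong)
    qed
    fix x
    have "\<bar>kernel_op M j \<theta> \<phi> x\<bar> \<le> (\<integral>t. \<bar>\<theta> (x $ j) t * \<phi> (vec_upd x j t)\<bar> \<partial>M)"
      unfolding kernel_op_def by (rule integral_abs_bound)
    also have "\<dots> \<le> (\<integral>t. C \<partial>M)"
      using kernel_integrable[OF assms]
      by (intro integral_mono integrable_abs) (auto intro!: unit_kernel_le[OF assms(1)] C(2))
    finally show "\<bar>kernel_op M j \<theta> \<phi> x\<bar> \<le> (\<integral>t. C \<partial>M)" .
  qed
qed

lemma kernel_op_add: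
  assumes "unit_kernel \<theta>" "bounded_borel (\<phi> :: real ^ 'n::finite \<Rightarrow> real)" "bounded_borel \<psi>"
  shows "kernel_op M j \<theta> (\<lambda>x. \<phi> x + \<psi> x) = (\<lambda>x. kernel_op M j \<theta> \<phi> x + kernel_op M j \<theta> \<psi> x)"
  unfolding kernel_op_def distrib_left
  using kernel_integrable[OF assms(1,2)] kernel_integrable[OF assms(1,3)] by simp

end

text \<open>Updating coordinate \<open>j\<close> leaves \<open>x $ i\<close> alone, so each kernel
  is a constant factor for the other integration. What remains is Fubini for a bounded function on a
  product of finite measures.\<close>

lemma kernel_op_commute:
  assumes "borel_finite M" "borel_finite N" "unit_kernel \<theta>" "unit_kernel \<eta>"
    and \<phi>: "bounded_borel (\<phi> :: real ^ 'n::finite \<Rightarrow> real)" and ij: "i \<noteq> j"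
  shows "kernel_op M i \<theta> (kernel_op N j \<eta> \<phi>) = kernel_op N j \<eta> (kernel_op M i \<theta> \<phi>)"
proof
  fix x :: "real ^ 'n"
  interpret M: borel_finite M by fact
  interpret N: borel_finite N by fact
  interpret P: pair_sigma_finite M N ..
  interpret MN: finite_measure "M \<Otimes>\<^sub>M N"
    by (rule finite_measure_pair_measure) (rule M.finite_measure_axioms N.finite_measure_axioms)+
  obtain C where C: "\<phi> \<in> borel_measurable borel" "\<And>x. \<bar>\<phi> x\<bar> \<le> C"
    using \<phi> by (metis bounded_borelE)
  note [measurable] = C(1) unit_kernelD(1)[OF assms(3)] unit_kernelD(1)[OF assms(4)]
  let ?f = "\<lambda>s t. \<theta> (x $ i) s * (\<eta> (x $ j) t * \<phi> (vec_upd (vec_upd x i s) j t))"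
  have "integrable (M \<Otimes>\<^sub>M N) (case_prod ?f)"
    by (intro MN.integrable_const_bound[where B=C])
      (auto intro!: always_eventually unit_kernel_le[OF assms(3)] unit_kernel_le[OF assms(4)] C(2))
  from P.Fubini_integral[OF this]
  have "(\<integral>t. (\<integral>s. ?f s t \<partial>M) \<partial>N) = (\<integral>s. (\<integral>t. ?f s t \<partial>N) \<partial>M)" by simp
  moreover have "kernel_op M i \<theta> (kernel_op N j \<eta> \<phi>) x = (\<integral>s. (\<integral>t. ?f s t \<partial>N) \<partial>M)"
    using ij by (simp add: kernel_op_def)
  moreover have "kernel_op N j \<eta> (kernel_op M i \<theta> \<phi>) x = (\<integral>t. (\<integral>s. ?f s t \<partial>M) \<partial>N)"
    using ij by (simp add: kernel_op_def vec_upd_commute[of j i] mult.left_commute flip: integral_mult_right_zero)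
  ultimately show "kernel_op M i \<theta> (kernel_op N j \<eta> \<phi>) x = kernel_op N j \<eta> (kernel_op M i \<theta> \<phi>) x"
    by simp
qed

section \<open>Iterated primitives on a box\<close>

locale ts_cuboid =
  fixes T :: "'n::{finite,linorder} \<Rightarrow> real set" and a b :: "(real, 'n) vec" and lam :: "'n \<Rightarrow> nat"
  assumes ts: "\<And>j. time_scale (T j)" and lam: "\<And>j. 1 \<le> lam j"
    and aT: "a \<in> ts_prod T" and bT: "b \<in> ts_prod T"
    and ab_rho: "\<And>j. a $ j < (bwd_jump (T j) ^^ (lam j - 1)) (b $ j)"
begin

lemma closed_scale: "closed (T j)" using ts by (simp add: time_scale_def)

lemma ab: "a $ j < b $ j"
  using bwd_iter_antimono[OF closed_scale, of "b $ j" j 0 "lam j - 1"] ab_rho[of j] bT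
  by (simp add: ts_prod_def)

sublocale I: ts_interval "T j" "a $ j" "b $ j" for j
  using ts aT bT ab by unfold_locales (auto simp: ts_prod_def)

abbreviation "cell j \<equiv> cell_measure (T j) (a $ j) (b $ j)"

lemma borel_finite_cell: "borel_finite (cell j)"
  by (intro borel_finite.intro I.finite_measure_cell borel_finite_axioms.intro) simp

definition J :: "'n \<Rightarrow> ((real, 'n) vec \<Rightarrow> real) \<Rightarrow> (real, 'n) vec \<Rightarrow> real" where
  "J j = kernel_op (cell j) j (\<lambda>s t. if t < s then 1 else 0)"

definition E :: "'n \<Rightarrow> ((real, 'n) vec \<Rightarrow> real) \<Rightarrow> (real, 'n) vec \<Rightarrow> real" where
  "E j = kernel_op (cell j) j (\<lambda>_ _. 1)"

lemma J_prim: "J j \<phi> x = I.prim j (\<lambda>t. \<phi> (vec_upd x j t)) (x $ j)"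
  by (simp add: J_def kernel_op_def I.prim_def)

lemma J_bounded_borel: "bounded_borel \<phi> \<Longrightarrow> bounded_borel (J j \<phi>)"
  unfolding J_def by (intro borel_finite.kernel_op_bounded_borel borel_finite_cell unit_kernel_less)

lemma E_bounded_borel: "bounded_borel \<phi> \<Longrightarrow> bounded_borel (E j \<phi>)"
  unfolding E_def by (intro borel_finite.kernel_op_bounded_borel borel_finite_cell unit_kernel_one)

lemma J_add: "bounded_borel \<phi> \<Longrightarrow> bounded_borel \<psi> \<Longrightarrow> J j (\<lambda>x. \<phi> x + \<psi> x) = (\<lambda>x. J j \<phi> x + J j \<psi> x)"
  unfolding J_def by (intro borel_finite.kernel_op_add borel_finite_cell unit_kernel_less)

lemma J_commute: "bounded_borel \<phi> \<Longrightarrow> i \<noteq> j \<Longrightarrow> J i (J j \<phi>) = J j (J i \<phi>)"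
  unfolding J_def by (intro kernel_op_commute borel_finite_cell unit_kernel_less)

lemma J_cong:
  assumes "\<And>t. t \<in> T j \<Longrightarrow> a $ j \<le> t \<Longrightarrow> t < b $ j \<Longrightarrow> t < x $ j \<Longrightarrow> \<phi> (vec_upd x j t) = \<psi> (vec_upd x j t)"
    and "bounded_borel \<phi>" "bounded_borel \<psi>"
  shows "J j \<phi> x = J j \<psi> x"
  unfolding J_prim using assms by (intro antisym I.prim_mono bounded_borel_slice) auto

lemma J_mono:
  assumes "\<And>t. t \<in> T j \<Longrightarrow> a $ j \<le> t \<Longrightarrow> t < b $ j \<Longrightarrow> t < x $ j \<Longrightarrow> \<phi> (vec_upd x j t) \<le> \<psi> (vec_upd x j t)"
    and "bounded_borel \<phi>" "bounded_borel \<psi>"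
  shows "J j \<phi> x \<le> J j \<psi> x"
  unfolding J_prim using assms by (intro I.prim_mono bounded_borel_slice) auto

definition JL :: "'n list \<Rightarrow> ((real, 'n) vec \<Rightarrow> real) \<Rightarrow> (real, 'n) vec \<Rightarrow> real" where
  "JL js \<phi> = foldr J js \<phi>"

lemma JL_simps [simp]: "JL [] \<phi> = \<phi>" "JL (j # js) \<phi> = J j (JL js \<phi>)" "JL (is @ js) \<phi> = JL is (JL js \<phi>)"
  by (simp_all add: JL_def)

lemma JL_bounded_borel: "bounded_borel \<phi> \<Longrightarrow> bounded_borel (JL js \<phi>)"
  by (induction js) (auto intro: J_bounded_borel)

lemma JL_add:
  assumes "bounded_borel \<phi>" "bounded_borel \<psi>"
  shows "JL js (\<lambda>x. \<phi> x + \<psi> x) = (\<lambda>x. JL js \<phi> x + JL js \<psi> x)"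
  by (induction js) (auto intro: JL_bounded_borel J_add assms)

lemma JL_J_commute:
  assumes "bounded_borel \<phi>" "j \<notin> set js"
  shows "JL js (J j \<phi>) = J j (JL js \<phi>)"
  using assms(2) by (induction js) (auto intro: JL_bounded_borel J_commute assms)

text \<open>Integrations in other variables never leave the slice through \<open>x $ j\<close>, so
  an identity valid on that slice alone may be used under the integrals.\<close>

lemma JL_slice:
  assumes "j \<notin> set js" "\<And>y. y $ j = x $ j \<Longrightarrow> \<phi> y = \<psi> y"
  shows "JL js \<phi> x = JL js \<psi> x"
  using assms
proof (induction js arbitrary: x)
  case (Cons i js)
  have "JL js \<phi> (vec_upd x i t) = JL js \<psi> (vec_upd x i t)" for t
    using Cons.prems by (intro Cons.IH) auto
  then show ?case by (simp add: J_prim)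
qed simp

lemma JL_subst:
  assumes "j \<notin> set js"
  shows "JL js (\<lambda>y. \<phi> (vec_upd y j c)) x = JL js \<phi> (vec_upd x j c)"
  using assms
proof (induction js arbitrary: x)
  case (Cons i js)
  then have "JL js (\<lambda>y. \<phi> (vec_upd y j c)) (vec_upd x i t) = JL js \<phi> (vec_upd (vec_upd x j c) i t)" for t
    by (simp add: vec_upd_commute[of j i])
  then show ?case using Cons.prems by (auto simp: J_prim)
qed simp

lemma JL_replicate: "JL (replicate k j) \<phi> x = (I.prim j ^^ k) (\<lambda>t. \<phi> (vec_upd x j t)) (x $ j)"
  by (induction k arbitrary: x) (simp_all add: J_prim)

end

section \<open>Joint rd-continuity\<close>

lemma ts_kappa_lower:
  assumes "t \<in> ts_kappa S" "s \<in> S" "s \<le> t"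
  shows "s \<in> ts_kappa S"
proof (cases "s = t")
  case False
  then show ?thesis using assms ts_kappa_subset by (intro ts_kappaI_less[of s S t]) auto
qed (use assms in simp)

lemma ts_kappa_iter_subset: "(ts_kappa ^^ k) S \<subseteq> S"
  by (induction k) (use ts_kappa_subset in auto)

lemma ts_kappa_iter_lower:
  "t \<in> (ts_kappa ^^ k) S \<Longrightarrow> s \<in> S \<Longrightarrow> s \<le> t \<Longrightarrow> s \<in> (ts_kappa ^^ k) S"
proof (induction k)
  case (Suc k)
  then show ?case using ts_kappa_subset by (auto intro: ts_kappa_lower)
qed simp

lemma closed_ts_kappa:
  assumes "closed S"
  shows "closed (ts_kappa S)"
proof (cases "ts_kappa S = S")
  case False
  then obtain t where t: "t \<in> S" "\<And>s. s \<in> S \<Longrightarrow> s \<le> t" "bwd_jump S t < t"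
    by (auto simp: ts_kappa_def)
  \<comment> \<open>Removing a left-scattered maximum amounts to intersecting with the closed
    half-line up to its predecessor.\<close>
  have "ts_kappa S = S \<inter> {..bwd_jump S t}"
  proof (intro equalityI subsetI)
    fix s assume s: "s \<in> ts_kappa S"
    then have "s \<in> S" "s \<noteq> t" using t by (auto simp: ts_kappa_def)
    then show "s \<in> S \<inter> {..bwd_jump S t}" using t(2)[of s] le_bwd_jump[of s S t] by auto
  next
    fix s assume "s \<in> S \<inter> {..bwd_jump S t}"
    then show "s \<in> ts_kappa S" using t by (intro ts_kappaI_less[of s S t]) auto
  qed
  then show ?thesis using assms by auto
qed (use assms in simp)

lemma closed_ts_kappa_iter: "closed S \<Longrightarrow> closed ((ts_kappa ^^ k) S)"
  by (induction k) (auto intro: closed_ts_kappa)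

text \<open>Supplies a point above \<open>t\<close> that is admissible for one order less: if the
  last jump starts at a left-dense point, a point close to it, and otherwise the end of that
  jump.\<close>

lemma bwd_iter_above:
  assumes "closed T" "c \<in> T" "t \<in> T" "t < (bwd_jump T ^^ k) c"
  shows "\<exists>s\<in>T. t < s \<and> s \<le> c \<and> (k \<ge> 1 \<longrightarrow> s < (bwd_jump T ^^ (k - 1)) c)"
proof (cases k)
  case (Suc l)
  let ?d = "(bwd_jump T ^^ l) c"
  have d: "?d \<in> T" "?d \<le> c" "t < bwd_jump T ?d"
    using bwd_iter_in[OF assms(1,2)] bwd_iter_antimono[OF assms(1,2), of 0 l] assms(4) Suc by auto
  show ?thesis
  proof (cases "bwd_jump T ?d = ?d")
    case True
    then obtain s where "s \<in> T" "t < s" "s < ?d"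
      using left_dense_points[OF d(1) assms(3), of t] d by auto
    then show ?thesis using d Suc by auto
  next
    case False
    then show ?thesis using d Suc bwd_jump_le[OF d(1)] bwd_jump_in[OF assms(1) d(1)]
      by (intro bexI[of _ "bwd_jump T ?d"]) auto
  qed
qed (use assms in auto)

text \<open>A truncation removes at most the top point, so each order costs one backward jump. The
  strict inequality pays for one of them, hence \<open>k - 1\<close>.\<close>

lemma in_ts_kappa_iter:
  assumes "closed T" "c \<in> T" "t \<in> T" "k \<ge> 1 \<Longrightarrow> t < (bwd_jump T ^^ (k - 1)) c"
  shows "t \<in> (ts_kappa ^^ k) T"
  using assms(3,4)
proof (induction k arbitrary: t)
  case (Suc k)
  have lt: "t < (bwd_jump T ^^ k) c" using Suc.prems by simp
  obtain s where s: "s \<in> T" "t < s" "k \<ge> 1 \<longrightarrow> s < (bwd_jump T ^^ (k - 1)) c"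
    using bwd_iter_above[OF assms(1,2) Suc.prems(1) lt] by blast
  have "s \<in> (ts_kappa ^^ k) T" using s by (intro Suc.IH) auto
  moreover from this have "t \<in> (ts_kappa ^^ k) T"
    using ts_kappa_iter_lower Suc.prems(1) s(2) by (metis less_imp_le)
  ultimately show ?case using ts_kappaI_less s(2) by simp
qed simp

lemma fwd_jump_kappa_iter:
  assumes "s \<in> (ts_kappa ^^ k) T" "t < s"
  shows "fwd_jump ((ts_kappa ^^ k) T) t = fwd_jump T t"
  by (rule fwd_jump_lower[OF ts_kappa_iter_subset _ assms]) (rule ts_kappa_iter_lower)

text \<open>At a right-scattered \<open>t\<close> the monotone function \<open>fwd_jump T\<close>
  has left limit at most \<open>t\<close> but a value above it, and a monotone function has only
  countably many discontinuities. The one other candidate is the maximum of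
  \<open>T\<close>.\<close>

lemma countable_not_right_dense:
  assumes "time_scale T"
  shows "countable {t\<in>T. \<not> right_dense T t}"
proof -
  have "{t\<in>T. \<not> right_dense T t} \<subseteq> {t. \<not> isCont (fwd_jump T) t} \<union> {Sup T}"
  proof
    fix t assume t: "t \<in> {t\<in>T. \<not> right_dense T t}"
    show "t \<in> {t. \<not> isCont (fwd_jump T) t} \<union> {Sup T}"
    proof (cases "\<exists>s\<in>T. t < s")
      case True
      then have lt: "t < fwd_jump T t"
        using t fwd_jump_ge[of t T] by (auto simp: right_dense_def less_le)
      have "\<not> isCont (fwd_jump T) t"
      proof
        assume "isCont (fwd_jump T) t"
        then have "(fwd_jump T \<longlongrightarrow> fwd_jump T t) (at_left t)"
          unfolding isCont_def by (rule tendsto_within_subset) auto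
        moreover have "\<forall>\<^sub>F s in at_left t. fwd_jump T s \<le> t"
          using t fwd_jump_ge_le(2) by (auto simp: eventually_at_filter intro!: always_eventually)
        ultimately have "fwd_jump T t \<le> t" by (rule tendsto_upperbound) simp
        then show False using lt by simp
      qed
      then show ?thesis by simp
    next
      case False
      then have "Sup T = t" using t by (intro cSup_eq_maximum) (auto simp: not_less)
      then show ?thesis by simp
    qed
  qed
  moreover
  have "countable {t. \<not> isCont (fwd_jump T) t}"
    by (rule mono_ctble_discont) (auto intro: monoI fwd_jump_mono assms)
  then have "countable ({t. \<not> isCont (fwd_jump T) t} \<union> {Sup T})" by simp
  ultimately show ?thesis by (rule countable_subset)
qed

lemma rd_continuous_onD:
  assumes "rd_continuous_on T S f" "x \<in> S"
  shows "(f \<longlongrightarrow> f x) (at x within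
    {y\<in>S. \<forall>j. if j \<in> {} then y $ j < x $ j else right_dense (T j) (x $ j) \<or> y $ j = x $ j})"
proof -
  from assms(1)[unfolded rd_continuous_on_def, rule_format, OF assms(2) empty_subsetI]
  show ?thesis by auto
qed

text \<open>Only countably many points of each time scale are not right-dense. Fixing in some coordinates such a
  point and letting the others be right-dense splits \<open>S\<close> into countably many pieces on which \<open>f\<close> is
  continuous.\<close>

lemma rd_continuous_on_measurable:
  fixes S :: "(real ^ 'n::finite) set"
  assumes T: "\<And>j. time_scale (T j)" and S: "S \<in> sets borel" "S \<subseteq> ts_prod T"
    and rd: "rd_continuous_on T S f"
  shows "(\<lambda>x. indicator S x * f x) \<in> borel_measurable borel"
proof -
  define N where "N j = {t\<in>T j. \<not> right_dense (T j) t}" for j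
  \<comment> \<open>An index \<open>v\<close> freezes a coordinate at a point that is not
    right-dense (\<open>Some t\<close>) or leaves it among the right-dense ones
    (\<open>None\<close>).\<close>
  define W where "W = (\<Pi>\<^sub>E j\<in>UNIV. insert None (Some ` N j))"
  define piece where "piece v = {y\<in>S. \<forall>j. y $ j \<in> (case v j of None \<Rightarrow> T j - N j | Some t \<Rightarrow> {t})}" for v
  have cN: "countable (N j)" for j unfolding N_def by (rule countable_not_right_dense[OF T])
  have mT: "T j \<in> sets borel" for j using T[of j] by (simp add: time_scale_def)
  have mN: "N j \<in> sets borel" for j
    using cN[of j] sets.countable[of "N j" borel] by simp
  have "countable W" unfolding W_def using cN by (intro countable_PiE) auto
  have mp: "piece v \<in> sets borel" for v
  proof -
    have "(case v j of None \<Rightarrow> T j - N j | Some t \<Rightarrow> {t}) \<in> sets borel" for j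
      using mN mT by (auto split: option.split)
    then have "{y :: real ^ 'n. \<forall>j. y $ j \<in> (case v j of None \<Rightarrow> T j - N j | Some t \<Rightarrow> {t})} \<in> sets borel"
      by measurable
    then show ?thesis using S(1) unfolding piece_def by (simp add: Collect_conj_eq)
  qed
  let ?f = "\<lambda>x. indicator S x * f x"
  let ?\<C> = "insert (- S) (piece ` W)"
  show ?thesis
  proof (rule measurable_piecewise_restrict)
    show "countable ?\<C>" using \<open>countable W\<close> by simp
    show "\<Omega> \<inter> space borel \<in> sets borel" if "\<Omega> \<in> ?\<C>" for \<Omega>
      using that mp S(1) by auto
    show "space borel \<subseteq> \<Union> ?\<C>"
    proof
      fix y :: "real ^ 'n"
      show "y \<in> \<Union> ?\<C>"
      proof (cases "y \<in> S")
        case True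
        define v where "v j = (if y $ j \<in> N j then Some (y $ j) else None)" for j
        have "v \<in> W" by (auto simp: W_def v_def)
        moreover have "y \<in> piece v" using True S(2) by (auto simp: piece_def v_def ts_prod_def)
        ultimately show ?thesis by blast
      qed simp
    qed
    show "?f \<in> borel_measurable (restrict_space borel \<Omega>)" if "\<Omega> \<in> ?\<C>" for \<Omega>
    proof (cases "\<Omega> = - S")
      case True
      then have "?f \<in> borel_measurable (restrict_space borel \<Omega>) \<longleftrightarrow>
          (\<lambda>_. 0::real) \<in> borel_measurable (restrict_space borel \<Omega>)"
        by (intro measurable_cong) (auto simp: space_restrict_space)
      then show ?thesis by simp
    next
      case False
      with \<open>\<Omega> \<in> ?\<C>\<close> obtain v where v: "\<Omega> = piece v" by auto
      have "continuous_on \<Omega> f"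
        unfolding continuous_on_def
      proof
        fix x assume x: "x \<in> \<Omega>"
        then have "x \<in> S" by (simp add: v piece_def)
        have "(f \<longlongrightarrow> f x) (at x within
            {y\<in>S. \<forall>j. if j \<in> {} then y $ j < x $ j else right_dense (T j) (x $ j) \<or> y $ j = x $ j})"
          by (rule rd_continuous_onD[OF rd \<open>x \<in> S\<close>])
        then show "(f \<longlongrightarrow> f x) (at x within \<Omega>)"
        proof (rule tendsto_within_subset, intro subsetI CollectI conjI allI)
          fix y j assume y: "y \<in> \<Omega>"
          then show "y \<in> S" by (simp add: v piece_def)
          have "x $ j \<in> (case v j of None \<Rightarrow> T j - N j | Some t \<Rightarrow> {t})"
            "y $ j \<in> (case v j of None \<Rightarrow> T j - N j | Some t \<Rightarrow> {t})"
            using x y by (auto simp: v piece_def)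
          then show "if j \<in> {} then y $ j < x $ j else right_dense (T j) (x $ j) \<or> y $ j = x $ j"
            by (auto simp: N_def split: option.splits)
        qed
      qed
      then have "continuous_on \<Omega> ?f"
        by (rule continuous_on_eq) (auto simp: v piece_def)
      then show ?thesis by (rule borel_measurable_continuous_on_restrict)
    qed
  qed
qed

lemma eventually_right_scattered:
  assumes "\<not> right_dense T t" "t \<in> T"
  shows "\<exists>d>0. \<forall>s\<in>T. \<bar>s - t\<bar> < d \<longrightarrow> s \<le> t"
proof (cases "\<exists>s\<in>T. t < s")
  case True
  then have "t < fwd_jump T t"
    using assms fwd_jump_ge[of t T] by (auto simp: right_dense_def less_le)
  then show ?thesis using fwd_jump_ge_le(2)[of _ T t]
    by (intro exI[of _ "fwd_jump T t - t"]) (force simp: abs_less_iff)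
next
  case False
  then show ?thesis by (intro exI[of _ 1]) (auto simp: not_less)
qed

lemma eventually_left_scattered:
  assumes "\<not> left_dense T t" "t \<in> T"
  shows "\<exists>d>0. \<forall>s\<in>T. \<bar>s - t\<bar> < d \<longrightarrow> t \<le> s"
proof (cases "\<exists>s\<in>T. s < t")
  case True
  then have "bwd_jump T t < t"
    using assms bwd_jump_le[of t T] by (auto simp: left_dense_def less_le)
  then show ?thesis using le_bwd_jump[of _ T t]
    by (intro exI[of _ "t - bwd_jump T t"]) (force simp: abs_less_iff)
next
  case False
  then show ?thesis by (intro exI[of _ 1]) (auto simp: not_less)
qed

text \<open>Near \<open>x\<close>, a point of \<open>S\<close> can differ from \<open>x\<close> to
  the right only in right-dense coordinates and to the left only in left-dense ones. So it falls
  under one of the finitely many sets \<open>L\<close> of the definition, each with a finite limit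
  and hence a local bound; compactness makes the bound global.\<close>

lemma rd_continuous_on_bounded:
  fixes S :: "(real ^ 'n::finite) set"
  assumes S: "compact S" "S \<subseteq> ts_prod T" and rd: "rd_continuous_on T S f"
  shows "\<exists>C. \<forall>x\<in>S. \<bar>f x\<bar> \<le> C"
proof -
  have loc: "\<exists>d>0. \<exists>C. \<forall>y\<in>S. dist y x < d \<longrightarrow> \<bar>f y\<bar> \<le> C" if x: "x \<in> S" for x
  proof -
    let ?D = "{j. left_dense (T j) (x $ j) \<and> \<not> right_dense (T j) (x $ j)}"
    let ?A = "\<lambda>L. {y\<in>S. \<forall>j. if j \<in> L then y $ j < x $ j else right_dense (T j) (x $ j) \<or> y $ j = x $ j}"
    have xT: "x $ j \<in> T j" for j using x S(2) by (auto simp: ts_prod_def)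
    have "\<exists>C. \<forall>\<^sub>F y in nhds x. y \<in> ?A L \<longrightarrow> \<bar>f y\<bar> \<le> C" if L: "L \<in> Pow ?D" for L
    proof -
      obtain l where l: "(f \<longlongrightarrow> l) (at x within ?A L)"
        using rd x L unfolding rd_continuous_on_def by blast
      \<comment> \<open>The limit ignores the point \<open>x\<close> itself, so its value enters the
        bound separately.\<close>
      have "\<bar>f y\<bar> \<le> max \<bar>f x\<bar> (\<bar>l\<bar> + 1)" if "y \<noteq> x \<longrightarrow> dist (f y) l < 1" for y
        using that by (cases "y = x") (auto simp: dist_real_def)
      note le = this
      have "\<forall>\<^sub>F y in nhds x. y \<noteq> x \<longrightarrow> y \<in> ?A L \<longrightarrow> dist (f y) l < 1"
        using tendstoD[OF l, of 1] unfolding eventually_at_filter by simp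
      then have "\<forall>\<^sub>F y in nhds x. y \<in> ?A L \<longrightarrow> \<bar>f y\<bar> \<le> max \<bar>f x\<bar> (\<bar>l\<bar> + 1)"
        by eventually_elim (use le in blast)
      then show ?thesis by blast
    qed
    then have "\<forall>L\<in>Pow ?D. \<exists>C. \<forall>\<^sub>F y in nhds x. y \<in> ?A L \<longrightarrow> \<bar>f y\<bar> \<le> C" by blast
    from bchoice[OF this] obtain CL where
      CL: "\<forall>L\<in>Pow ?D. \<forall>\<^sub>F y in nhds x. y \<in> ?A L \<longrightarrow> \<bar>f y\<bar> \<le> CL L" by blast
    define C where "C = Max (CL ` Pow ?D)"
    have ev1: "\<forall>\<^sub>F y in nhds x. \<forall>L\<in>Pow ?D. y \<in> ?A L \<longrightarrow> \<bar>f y\<bar> \<le> CL L"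
      using CL by (intro eventually_ball_finite) auto
    have coord: "\<forall>\<^sub>F y in nhds x. \<bar>y $ j - x $ j\<bar> < d" if "d > 0" for j d
    proof -
      have "((\<lambda>y. y $ j) \<longlongrightarrow> x $ j) (nhds x)" by (intro tendsto_vec_nth filterlim_ident)
      from tendstoD[OF this that] show ?thesis by (simp add: dist_real_def)
    qed
    have "\<forall>\<^sub>F y in nhds x. y \<in> S \<longrightarrow> \<not> right_dense (T j) (x $ j) \<longrightarrow> y $ j \<le> x $ j" for j
    proof (cases "right_dense (T j) (x $ j)")
      case False
      from eventually_right_scattered[OF this xT] obtain d where
        d: "d > 0" "\<forall>s\<in>T j. \<bar>s - x $ j\<bar> < d \<longrightarrow> s \<le> x $ j" by blast
      show ?thesis
        using coord[OF d(1), of j] by eventually_elim (use d S(2) in \<open>auto simp: ts_prod_def\<close>)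
    qed simp
    then have ev2: "\<forall>\<^sub>F y in nhds x. \<forall>j. y \<in> S \<longrightarrow> \<not> right_dense (T j) (x $ j) \<longrightarrow> y $ j \<le> x $ j"
      by (rule eventually_all_finite)
    have "\<forall>\<^sub>F y in nhds x. y \<in> S \<longrightarrow> \<not> left_dense (T j) (x $ j) \<longrightarrow> x $ j \<le> y $ j" for j
    proof (cases "left_dense (T j) (x $ j)")
      case False
      from eventually_left_scattered[OF this xT] obtain d where
        d: "d > 0" "\<forall>s\<in>T j. \<bar>s - x $ j\<bar> < d \<longrightarrow> x $ j \<le> s" by blast
      show ?thesis
        using coord[OF d(1), of j] by eventually_elim (use d S(2) in \<open>auto simp: ts_prod_def\<close>)
    qed simp
    then have ev3: "\<forall>\<^sub>F y in nhds x. \<forall>j. y \<in> S \<longrightarrow> \<not> left_dense (T j) (x $ j) \<longrightarrow> x $ j \<le> y $ j"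
      by (rule eventually_all_finite)
    have "\<forall>\<^sub>F y in nhds x. y \<in> S \<longrightarrow> \<bar>f y\<bar> \<le> C"
      using ev1 ev2 ev3
    proof eventually_elim
      case (elim y)
      show ?case
      proof
        assume y: "y \<in> S"
        \<comment> \<open>A right-dense coordinate may move both ways and stays outside
          \<open>L\<close>; any other can only have moved to the left.\<close>
        define L where "L = {j. \<not> right_dense (T j) (x $ j) \<and> y $ j < x $ j}"
        have "left_dense (T j) (x $ j)" if "j \<in> L" for j
          using elim(3) y that unfolding L_def by (metis (mono_tags) mem_Collect_eq not_le)
        then have LD: "L \<in> Pow ?D" by (auto simp: L_def)
        have "if j \<in> L then y $ j < x $ j else right_dense (T j) (x $ j) \<or> y $ j = x $ j" for j
          using elim(2) y by (auto simp: L_def less_le)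
        then have "y \<in> ?A L" using y by blast
        then have "\<bar>f y\<bar> \<le> CL L" using elim(1) LD by blast
        also have "\<dots> \<le> C" unfolding C_def using LD by (intro Max_ge imageI) auto
        finally show "\<bar>f y\<bar> \<le> C" .
      qed
    qed
    then show ?thesis unfolding eventually_nhds_metric by blast
  qed
  then have "\<forall>x\<in>S. \<exists>p. fst p > 0 \<and> (\<forall>y\<in>S. dist y x < fst p \<longrightarrow> \<bar>f y\<bar> \<le> snd p)"
    by (metis fst_conv snd_conv)
  from bchoice[OF this] obtain p where
    p: "\<forall>x\<in>S. fst (p x) > 0 \<and> (\<forall>y\<in>S. dist y x < fst (p x) \<longrightarrow> \<bar>f y\<bar> \<le> snd (p x))" by blast
  define d C where "d x = fst (p x)" and "C x = snd (p x)" for x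
  have d: "\<And>x. x \<in> S \<Longrightarrow> d x > 0" "\<And>x y. x \<in> S \<Longrightarrow> y \<in> S \<Longrightarrow> dist y x < d x \<Longrightarrow> \<bar>f y\<bar> \<le> C x"
    using p by (auto simp: d_def C_def)
  have "S \<subseteq> (\<Union>x\<in>S. ball x (d x))" using d(1) by force
  then obtain F where F: "F \<subseteq> S" "finite F" "S \<subseteq> (\<Union>x\<in>F. ball x (d x))"
    using compactE_image[OF S(1), of S "\<lambda>x. ball x (d x)"] by (metis open_ball)
  have "\<bar>f y\<bar> \<le> (\<Sum>x\<in>F. \<bar>C x\<bar>)" if y: "y \<in> S" for y
  proof -
    obtain x where x: "x \<in> F" "dist x y < d x" using F(3) y by auto
    then have "\<bar>f y\<bar> \<le> C x" using d(2)[of x y] F y by (auto simp: dist_commute)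
    also have "\<dots> \<le> \<bar>C x\<bar>" by simp
    also have "\<dots> \<le> (\<Sum>x\<in>F. \<bar>C x\<bar>)" using F x by (intro member_le_sum) auto
    finally show ?thesis .
  qed
  then show ?thesis by blast
qed

section \<open>Recovering a function from its mixed derivative\<close>

lemma pdelta_tendsto:
  assumes "pdelta_differentiable S j f x"
  shows "(delta_quotient S j f x \<longlongrightarrow> pdelta S j f x) (delta_filter S (x $ j))"
  using assms tendsto_Lim unfolding pdelta_differentiable_def pdelta_def by fastforce

lemma pdeltaI:
  assumes "(delta_quotient S j f x \<longlongrightarrow> D) (delta_filter S (x $ j))" "delta_filter S (x $ j) \<noteq> bot"
  shows "pdelta S j f x = D"
  using assms tendsto_Lim[OF assms(2,1)] unfolding pdelta_differentiable_def pdelta_def by auto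

section \<open>The fundamental theorem along one coordinate\<close>

context ts_cuboid
begin

text \<open>At the points of \<open>Q k\<close> the derivatives of order \<open>k\<close> depend only on the values in the box. On the
  larger set \<open>kappa_box T a b k\<close> they may involve points beyond \<open>b\<close>, where the boundary conditions are not
  available.\<close>

definition Q :: "('n \<Rightarrow> nat) \<Rightarrow> (real, 'n) vec set" where
  "Q k = {x \<in> ts_box T a b. \<forall>i. 1 \<le> k i \<longrightarrow> x $ i < (bwd_jump (T i) ^^ (k i - 1)) (b $ i)}"

lemma a_in: "a $ j \<in> T j" and b_in: "b $ j \<in> T j"
  using aT bT by (auto simp: ts_prod_def)

lemma Q_subset: "Q k \<subseteq> kappa_box T a b k"
proof
  fix x assume x: "x \<in> Q k"
  then have "x $ j \<in> (ts_kappa ^^ k j) (T j)" for j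
    by (intro in_ts_kappa_iter[OF closed_scale b_in]) (auto simp: Q_def ts_box_def ts_prod_def)
  then show "x \<in> kappa_box T a b k" using x by (auto simp: Q_def kappa_box_def)
qed

text \<open>An integral over \<open>t < x $ j\<close> only visits points where one more derivative
  in \<open>j\<close> is determined by the box. Hence cutting the integrand to the smaller set does
  not change the integral.\<close>

lemma Q_Suc:
  assumes "x \<in> Q k" "t \<in> T j" "a $ j \<le> t" "t < x $ j"
  shows "vec_upd x j t \<in> Q (k(j := Suc (k j)))"
proof -
  have "t < (bwd_jump (T j) ^^ k j) (b $ j)"
  proof (cases "k j")
    case 0
    have "x $ j \<le> b $ j" using assms(1) by (simp add: Q_def ts_box_def)
    then show ?thesis using 0 assms(4) by simp
  next
    case (Suc l)
    let ?c = "(bwd_jump (T j) ^^ l) (b $ j)"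
    have "x $ i < (bwd_jump (T i) ^^ (k i - 1)) (b $ i)" if "1 \<le> k i" for i
      using assms(1) that by (simp add: Q_def)
    from this[of j] have "x $ j < ?c" using Suc by simp
    moreover have "x $ j \<in> T j" using assms(1) by (auto simp: Q_def ts_box_def ts_prod_def)
    ultimately have "x $ j \<in> T j" "x $ j < ?c" by auto
    from le_bwd_jump[OF this] show ?thesis using assms(4) Suc by simp
  qed
  moreover have "x $ j \<le> b $ j" using assms(1) by (simp add: Q_def ts_box_def)
  then have "t \<le> b $ j" using assms(4) by simp
  ultimately show ?thesis using assms by (auto simp: Q_def ts_box_def ts_prod_def)
qed

text \<open>The bound a < rho^(lambda-1)(b) for the highest order covers all lower ones, because
  iterated backward jumps decrease with the number of jumps.\<close>

lemma Q_base:
  assumes "x \<in> Q k" "k j \<le> lam j"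
  shows "vec_upd x j (a $ j) \<in> Q k"
proof -
  have "a $ j < (bwd_jump (T j) ^^ (k j - 1)) (b $ j)"
    using ab_rho[of j] bwd_iter_antimono[OF closed_scale b_in, of "k j - 1" "lam j - 1" j] assms(2)
    by (simp add: diff_le_mono)
  then show ?thesis using assms a_in ab[of j] by (auto simp: Q_def ts_box_def ts_prod_def)
qed

lemma meas_T [measurable]: "T j \<in> sets borel"
  by (rule I.meas_T)

lemma meas_box [measurable]: "ts_box T a b \<in> sets borel"
  unfolding ts_box_def ts_prod_def by measurable

lemma meas_Q [measurable]: "Q k \<in> sets borel"
  unfolding Q_def by measurable

lemma compact_kappa_box: "compact (kappa_box T a b k)"
proof -
  have eq: "kappa_box T a b k =
      (\<Inter>j. {x. x $ j \<in> (ts_kappa ^^ k j) (T j)}) \<inter> cbox a b"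
    using ts_kappa_iter_subset by (fastforce simp: kappa_box_def ts_box_def ts_prod_def mem_box_cart)
  have "closed {x :: (real, 'n) vec. x $ j \<in> (ts_kappa ^^ k j) (T j)}" for j
    using closed_vimage[OF closed_ts_kappa_iter[OF closed_scale], of "\<lambda>x. x $ j" "k j" j]
    by (simp add: vimage_def continuous_on_component continuous_intros)
  then show ?thesis unfolding eq by (intro closed_Int_compact closed_INT ballI compact_cbox)
qed

lemma rd_continuous_bounded_borel:
  assumes "rd_continuous_on T (kappa_box T a b k) g" "A \<in> sets borel" "A \<subseteq> kappa_box T a b k"
  shows "bounded_borel (\<lambda>x. indicator A x * g x)"
proof -
  let ?S = "kappa_box T a b k"
  have sub: "?S \<subseteq> ts_prod T" by (auto simp: kappa_box_def ts_box_def)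
  obtain C where C: "\<And>x. x \<in> ?S \<Longrightarrow> \<bar>g x\<bar> \<le> C"
    using rd_continuous_on_bounded[OF compact_kappa_box sub assms(1)] by blast
  have "bounded_borel (\<lambda>x. indicator ?S x * g x)"
  proof (rule bounded_borelI)
    show "(\<lambda>x. indicator ?S x * g x) \<in> borel_measurable borel"
      using rd_continuous_on_measurable[OF ts borel_compact[OF compact_kappa_box] sub assms(1)] .
    show "\<bar>indicator ?S x * g x\<bar> \<le> max C 0" for x
      using C[of x] by (auto simp: indicator_def)
  qed
  from bounded_borel_mult[OF bounded_borel_indicator[OF assms(2)] this]
  have "bounded_borel (\<lambda>x. indicator A x * (indicator ?S x * g x))" .
  moreover have "indicator A x * (indicator ?S x * g x) = indicator A x * g x" for x
    using assms(3) by (auto simp: indicator_def)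
  ultimately show ?thesis by simp
qed

text \<open>The fundamental theorem on the line through \<open>x\<close> in direction
  \<open>j\<close>. The difference quotients live on the truncated scale, whereas the integral runs
  over \<open>T j\<close>; \<open>Q_Suc\<close> allows the cut-off.\<close>

lemma increment_eq_J:
  assumes diff: "\<And>x. x \<in> kappa_box T a b (k(j := Suc (k j))) \<Longrightarrow>
      pdelta_differentiable ((ts_kappa ^^ k j) (T j)) j g x"
    and h: "h = pdelta ((ts_kappa ^^ k j) (T j)) j g"
    and rd: "rd_continuous_on T (kappa_box T a b (k(j := Suc (k j)))) h"
    and x: "x \<in> Q k"
  shows "g x - g (vec_upd x j (a $ j)) = J j (\<lambda>y. indicator (Q (k(j := Suc (k j)))) y * h y) x"
proof -
  let ?k = "k(j := Suc (k j))"
  let ?S = "(ts_kappa ^^ k j) (T j)"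
  let ?f = "\<lambda>y. indicator (Q ?k) y * h y"
  have xS: "x $ i \<in> (ts_kappa ^^ k i) (T i)" for i
    using Q_subset x by (auto simp: kappa_box_def)
  have xb: "a $ i \<le> x $ i" "x $ i \<le> b $ i" "x $ i \<in> T i" for i
    using x by (auto simp: Q_def ts_box_def ts_prod_def)
  have kb: "vec_upd x j t \<in> kappa_box T a b ?k"
    if "t \<in> ts_kappa ?S" "a $ j \<le> t" "t \<le> x $ j" for t
    using that xS xb ts_kappa_subset ts_kappa_iter_subset order_trans[OF _ xb(2)[of j]]
    by (fastforce simp: kappa_box_def ts_box_def ts_prod_def)
  have bb: "bounded_borel ?f" by (rule rd_continuous_bounded_borel[OF rd meas_Q Q_subset])
  have "g (vec_upd x j (x $ j)) - g (vec_upd x j (a $ j)) = I.prim j (\<lambda>t. ?f (vec_upd x j t)) (x $ j)"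
  proof (rule I.increment_eq_prim[where S="?S" and D="\<lambda>t. h (vec_upd x j t)"
        and g="\<lambda>t. g (vec_upd x j t)"])
    show "bounded_borel (\<lambda>t. ?f (vec_upd x j t))" by (rule bounded_borel_slice[OF bb])
    show "?S \<subseteq> T j" by (rule ts_kappa_iter_subset)
    show "s \<in> ?S" if "t \<in> ?S" "s \<in> T j" "s \<le> t" for s t
      using ts_kappa_iter_lower that .
    show "x $ j \<in> ?S" "a $ j \<le> x $ j" "x $ j \<le> b $ j" using xS xb by auto
    show "((\<lambda>s. (g (vec_upd x j (fwd_jump ?S t)) - g (vec_upd x j s)) / (fwd_jump ?S t - s))
        \<longlongrightarrow> h (vec_upd x j t)) (delta_filter ?S t)"
      if "t \<in> ts_kappa ?S" "a $ j \<le> t" "t \<le> x $ j" for t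
      using pdelta_tendsto[OF diff[OF kb[OF that]]] by (simp add: delta_quotient_def[abs_def] h)
    show "h (vec_upd x j t) = ?f (vec_upd x j t)" if "t \<in> ?S" "a $ j \<le> t" "t < x $ j" for t
      using Q_Suc[OF x, of t j] that ts_kappa_iter_subset by force
    show "((\<lambda>t. ?f (vec_upd x j t)) \<longlongrightarrow> ?f (vec_upd x j t)) (at t within {s\<in>T j. t < s \<and> s < x $ j})"
      if t: "t \<in> T j" "a $ j \<le> t" "t < x $ j" "right_dense (T j) t" for t
    proof -
      let ?y = "vec_upd x j t"
      have Qs: "vec_upd x j s \<in> Q ?k" if "s \<in> T j" "a $ j \<le> s" "s < x $ j" for s
        using Q_Suc[OF x that] .
      have yk: "?y \<in> kappa_box T a b ?k" using Qs[OF t(1-3)] Q_subset by auto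
      let ?A = "{y\<in>kappa_box T a b ?k. \<forall>i. if i \<in> {} then y $ i < ?y $ i
          else right_dense (T i) (?y $ i) \<or> y $ i = ?y $ i}"
      have "(h \<longlongrightarrow> h ?y) (at ?y within ?A)"
        by (rule rd_continuous_onD[OF rd yk])
      \<comment> \<open>Joint rd-continuity with \<open>L = {}\<close> is used along a single line:
        only coordinate \<open>j\<close> moves, and it is right-dense at \<open>t\<close>.\<close>
      moreover have "filterlim (vec_upd x j) (at ?y within ?A) (at t within {s\<in>T j. t < s \<and> s < x $ j})"
        unfolding filterlim_at
      proof
        show "\<forall>\<^sub>F s in at t within {s\<in>T j. t < s \<and> s < x $ j}. vec_upd x j s \<in> ?A \<and> vec_upd x j s \<noteq> ?y"
          unfolding eventually_at_filter
        proof (intro always_eventually allI impI)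
          fix s assume s: "s \<noteq> t" "s \<in> {s\<in>T j. t < s \<and> s < x $ j}"
          then have "vec_upd x j s \<in> kappa_box T a b ?k" using Qs[of s] Q_subset t by auto
          moreover have "vec_upd x j s \<noteq> ?y" using s(1) by (metis vec_upd_nth)
          ultimately show "vec_upd x j s \<in> ?A \<and> vec_upd x j s \<noteq> ?y" using t(4) by auto
        qed
        have "isCont (\<lambda>s. vec_upd x j s) t"
          using continuous_on_compose2[OF continuous_vec_upd[of j], of UNIV "\<lambda>s. (x, s)"]
          by (simp add: continuous_intros continuous_on_eq_continuous_at)
        then show "(vec_upd x j \<longlongrightarrow> ?y) (at t within {s\<in>T j. t < s \<and> s < x $ j})"
          unfolding isCont_def by (rule tendsto_within_subset) simp
      qed
      ultimately have "((\<lambda>s. h (vec_upd x j s)) \<longlongrightarrow> h ?y) (at t within {s\<in>T j. t < s \<and> s < x $ j})"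
        by (rule filterlim_compose)
      moreover have "\<forall>\<^sub>F s in at t within {s\<in>T j. t < s \<and> s < x $ j}. h (vec_upd x j s) = ?f (vec_upd x j s)"
        unfolding eventually_at_filter
        by (intro always_eventually allI impI) (use Qs t in \<open>auto simp: indicator_def\<close>)
      moreover have "h ?y = ?f ?y" using Qs t by (auto simp: indicator_def)
      ultimately show ?thesis using Lim_transform_eventually by force
    qed
  qed
  then show ?thesis by (simp add: J_prim)
qed

end

section \<open>Trivial filters and default values of derivatives\<close>

lemma delta_filter_trivial:
  assumes "closed S" "t \<notin> ts_kappa S"
  shows "delta_filter S t = bot"
proof (cases "t \<in> S")
  case False
  have "\<forall>\<^sub>F s in nhds t. s \<in> - S" using assms(1) False by (intro eventually_nhds_in_open) auto
  then show ?thesis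
    unfolding delta_filter_def trivial_limit_def eventually_inf_principal by eventually_elim auto
next
  case True
  then have t: "\<And>s. s \<in> S \<Longrightarrow> s \<le> t" "bwd_jump S t < t" using assms(2) by (auto simp: ts_kappa_def)
  then have "Sup S = t" using True by (intro cSup_eq_maximum) auto
  \<comment> \<open>At a maximum the convention for the forward jump excludes \<open>t\<close>
    itself; left-scatteredness leaves no other point nearby.\<close>
  then have \<sigma>: "fwd_jump S t = t" using t(1) by (force simp: fwd_jump_def)
  have "\<forall>\<^sub>F s in nhds t. s \<in> {bwd_jump S t<..}" using t(2) by (intro eventually_nhds_in_open) auto
  then show ?thesis
    unfolding delta_filter_def trivial_limit_def eventually_inf_principal
  proof eventually_elim
    case (elim s)
    then show ?case using le_bwd_jump[of s S t] t(1)[of s] \<sigma> by force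
  qed
qed

text \<open>Quotients in direction \<open>j\<close> stay in the slice on which coordinate
  \<open>i\<close> equals \<open>c\<close>, so the derivative vanishes there, whether as a limit or
  by default.\<close>

lemma pdelta_zero_slice:
  assumes "\<And>y. y $ i = c \<Longrightarrow> h y = 0" "i \<noteq> j" "x $ i = c"
  shows "pdelta S j h x = 0"
proof (cases "pdelta_differentiable S j h x")
  case True
  have "delta_quotient S j h x = (\<lambda>_. 0)"
    using assms by (auto simp: delta_quotient_def fun_eq_iff)
  then show ?thesis using True by (intro pdeltaI) (auto simp: pdelta_differentiable_def)
qed (simp add: pdelta_def)

lemma pdelta_iter_zero_slice:
  assumes "\<And>y. y $ i = c \<Longrightarrow> h y = 0" "i \<noteq> j" "x $ i = c"
  shows "pdelta_iter T j k h x = 0"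
  using assms(3) by (induction k arbitrary: x) (use assms(1,2) in \<open>auto intro: pdelta_zero_slice\<close>)

lemma fold_pdelta_zero_slice:
  assumes "\<And>y. y $ i = c \<Longrightarrow> h y = 0" "i \<notin> set js" "x $ i = c"
  shows "fold (\<lambda>j. pdelta_iter T j (k j)) js h x = 0"
  using assms
proof (induction js arbitrary: h)
  case (Cons j js)
  show ?case unfolding fold_Cons o_apply
  proof (rule Cons.IH)
    show "pdelta_iter T j (k j) h y = 0" if "y $ i = c" for y
      using that Cons.prems by (intro pdelta_iter_zero_slice[of i c]) auto
  qed (use Cons.prems in auto)
qed simp

context ts_cuboid
begin

text \<open>Off the truncated scale of variable \<open>i\<close> the filter is trivial, so the
  derivative of order \<open>lam i\<close> takes its default value 0 on a whole slice, and later
  derivatives in other variables preserve this.\<close>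

lemma mixed_delta_eq_0:
  assumes "x \<in> ts_box T a b" "x \<notin> kappa_box T a b lam"
  shows "mixed_delta T lam f x = 0"
proof -
  obtain i where i: "x $ i \<notin> (ts_kappa ^^ lam i) (T i)" using assms by (auto simp: kappa_box_def)
  obtain l where l: "lam i = Suc l" using lam[of i] by (cases "lam i") auto
  obtain js rest where s: "sorted_list_of_set (UNIV :: 'n set) = js @ i # rest"
    using split_list[of i "sorted_list_of_set UNIV"] by auto
  have "distinct (js @ i # rest)" by (metis s distinct_sorted_list_of_set)
  then have "i \<notin> set rest" by simp
  moreover have "pdelta_iter T i (lam i) g y = 0" if "y $ i = x $ i" for g and y :: "(real, 'n) vec"
    using delta_filter_trivial[OF closed_ts_kappa_iter[OF closed_scale], of "x $ i" l i] i that l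
    by (simp add: pdelta_def pdelta_differentiable_def)
  ultimately show ?thesis
    unfolding mixed_delta_def s fold_append fold_Cons o_apply
    by (intro fold_pdelta_zero_slice[of i "x $ i"]) auto
qed

definition ord1 :: "'n \<Rightarrow> nat \<Rightarrow> 'n \<Rightarrow> nat" where
  "ord1 j r = (\<lambda>i. if i = j then r else 0)"

lemma Q_ord1_iff:
  "x \<in> Q (ord1 j r) \<longleftrightarrow> x \<in> ts_box T a b \<and> (1 \<le> r \<longrightarrow> x $ j < (bwd_jump (T j) ^^ (r - 1)) (b $ j))"
  by (auto simp: Q_def ord1_def)

text \<open>If \<open>x $ j = a $ j\<close> is left-dense, the quotients also see points to the left of the box, hence the
  separate hypothesis of differentiability there.\<close>

lemma pdelta_eq_of_prim:
  assumes x: "x \<in> Q (ord1 j (Suc r))" and \<psi>: "bounded_borel \<psi>"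
    and u: "\<And>t. vec_upd x j t \<in> Q (ord1 j r) \<Longrightarrow> u (vec_upd x j t) = c + I.prim j \<psi> t"
    and cont: "(\<psi> \<longlongrightarrow> \<psi> (x $ j)) (at (x $ j) within T j \<inter> {a $ j..b $ j})"
    and diff: "x $ j = a $ j \<Longrightarrow> pdelta_differentiable ((ts_kappa ^^ r) (T j)) j u x"
  shows "pdelta ((ts_kappa ^^ r) (T j)) j u x = \<psi> (x $ j)"
proof -
  let ?S = "(ts_kappa ^^ r) (T j)" and ?t = "x $ j"
  let ?\<sigma> = "fwd_jump (T j) ?t"
  have xb: "x $ i \<in> T i" "a $ i \<le> x $ i" "x $ i \<le> b $ i" for i
    using x by (auto simp: Q_ord1_iff ts_box_def ts_prod_def)
  have t: "?t < (bwd_jump (T j) ^^ r) (b $ j)" using x by (simp add: Q_ord1_iff)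
  \<comment> \<open>Up to \<open>s0\<close> the formula for \<open>u\<close> is available, and sigma
    at \<open>x $ j\<close> does not exceed \<open>s0\<close>, so both ends of the quotient are
    covered.\<close>
  obtain s0 where s0: "s0 \<in> T j" "?t < s0" "s0 \<le> b $ j"
      "r \<ge> 1 \<longrightarrow> s0 < (bwd_jump (T j) ^^ (r - 1)) (b $ j)"
    using bwd_iter_above[OF closed_scale b_in xb(1) t] by blast
  have s0S: "s0 \<in> ?S" using s0 by (intro in_ts_kappa_iter[OF closed_scale b_in]) auto
  have \<sigma>: "fwd_jump ?S ?t = ?\<sigma>" using fwd_jump_kappa_iter[OF s0S s0(2)] .
  have tb: "?t < b $ j" using s0 by simp
  have \<sigma>b: "?t \<le> ?\<sigma>" "?\<sigma> \<le> s0" "?\<sigma> \<in> T j"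
    using fwd_jump_ge[OF xb(1)] fwd_jump_ge_le(2)[OF s0(1,2)] fwd_jump_in[OF closed_scale xb(1)] by auto
  have inQ: "vec_upd x j s \<in> Q (ord1 j r)" if "s \<in> T j" "a $ j \<le> s" "s \<le> s0" for s
    using that s0 xb by (auto simp: Q_ord1_iff ts_box_def ts_prod_def)
  \<comment> \<open>The part of the delta filter on which the formula for \<open>u\<close> is known.
    Being nontrivial, it identifies the limit even where the full filter is larger.\<close>
  let ?F = "inf (nhds ?t) (principal (?S \<inter> {a $ j..<s0} - {?\<sigma>}))"
  have S: "?S \<subseteq> T j" by (rule ts_kappa_iter_subset)
  have "?F \<le> inf (nhds ?t) (principal (T j \<inter> {a $ j..b $ j} - {?\<sigma>}))"
    using S s0 by (intro inf_mono order_refl) auto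
  then have "((\<lambda>s. (I.prim j \<psi> ?\<sigma> - I.prim j \<psi> s) / (?\<sigma> - s)) \<longlongrightarrow> \<psi> ?t) ?F"
    by (rule tendsto_mono[OF _ I.prim_quotient_tendsto[OF \<psi> xb(1,2) tb cont]])
  moreover have "\<forall>\<^sub>F s in ?F. (I.prim j \<psi> ?\<sigma> - I.prim j \<psi> s) / (?\<sigma> - s) = delta_quotient ?S j u x s"
    unfolding eventually_inf_principal delta_quotient_def \<sigma>
    using u[OF inQ] S \<sigma>b xb(2)[of j] by (intro always_eventually) auto
  ultimately have lim: "(delta_quotient ?S j u x \<longlongrightarrow> \<psi> ?t) ?F"
    by (rule Lim_transform_eventually)
  have le: "?F \<le> delta_filter ?S ?t"
    unfolding delta_filter_def \<sigma> by (intro inf_mono) auto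
  have nontriv: "?F \<noteq> bot"
  proof
    assume "?F = bot"
    then have ev: "\<forall>\<^sub>F s in nhds ?t. s \<notin> ?S \<inter> {a $ j..<s0} - {?\<sigma>}"
      unfolding trivial_limit_def eventually_inf_principal by simp
    have tS: "?t \<in> ?S" using ts_kappa_iter_lower[OF s0S xb(1)] s0 by simp
    show False
    proof (cases "?\<sigma> = ?t")
      case True
      from ev obtain d where d: "d > 0" "\<And>s. dist s ?t < d \<Longrightarrow> s \<notin> ?S \<inter> {a $ j..<s0} - {?\<sigma>}"
        unfolding eventually_nhds_metric by blast
      obtain s where s: "s \<in> T j" "?t < s" "s < min s0 (?t + d)"
        using fwd_jump_dense[OF s0(1,2) True, of "min s0 (?t + d)"] s0 d by auto
      moreover have "s \<in> ?S" using ts_kappa_iter_lower[OF s0S s(1)] s by simp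
      ultimately show False using d(2)[of s] xb(2)[of j] True by (auto simp: dist_real_def)
    next
      case False
      then show False using eventually_nhds_x_imp_x[OF ev] tS xb(2)[of j] s0 by auto
    qed
  qed
  show ?thesis
  proof (cases "?t = a $ j")
    case True
    from pdelta_tendsto[OF diff[OF True]]
    have "(delta_quotient ?S j u x \<longlongrightarrow> pdelta ?S j u x) ?F" by (rule tendsto_mono[OF le])
    from tendsto_unique[OF nontriv this lim] show ?thesis .
  next
    case False
    then have at: "a $ j < ?t" using xb(2)[of j] by simp
    \<comment> \<open>Away from the left end the two filters agree, so the limit along the full
      filter exists as well.\<close>
    have "delta_filter ?S ?t \<le> ?F"
    proof (rule filter_leI)
      fix P assume "eventually P ?F"
      then have "\<forall>\<^sub>F s in nhds ?t. s \<in> ?S \<inter> {a $ j..<s0} - {?\<sigma>} \<longrightarrow> P s"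
        by (simp add: eventually_inf_principal)
      moreover have "\<forall>\<^sub>F s in nhds ?t. s \<in> {a $ j<..<s0}"
        using at s0 by (intro eventually_nhds_in_open) auto
      ultimately show "eventually P (delta_filter ?S ?t)"
        unfolding delta_filter_def \<sigma> eventually_inf_principal by eventually_elim auto
    qed
    then have "(delta_quotient ?S j u x \<longlongrightarrow> \<psi> ?t) (delta_filter ?S ?t)"
      using lim by (rule tendsto_mono)
    moreover have "delta_filter ?S ?t \<noteq> bot" using le nontriv by (metis bot.extremum_unique)
    ultimately show ?thesis by (rule pdeltaI)
  qed
qed

lemma bounded_borel_subst:
  fixes \<phi> :: "(real, 'n) vec \<Rightarrow> real"
  assumes "bounded_borel \<phi>"
  shows "bounded_borel (\<lambda>y. \<phi> (vec_upd y j c))"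
proof -
  obtain C where [measurable]: "\<phi> \<in> borel_measurable borel" and "\<And>x. \<bar>\<phi> x\<bar> \<le> C"
    using assms by (metis bounded_borelE)
  then show ?thesis by (intro bounded_borelI[where C=C]) auto
qed

lemma JL_replicate_commute:
  assumes "bounded_borel \<phi>" "j \<notin> set js"
  shows "JL (replicate r j) (JL js \<phi>) = JL js (JL (replicate r j) \<phi>)"
  by (induction r) (auto simp: JL_J_commute JL_bounded_borel assms)

text \<open>By \<open>Q_Suc\<close> each of the \<open>r\<close> integrations raises the order by
  one, so only values on the set of order \<open>s + r\<close> are read.\<close>

lemma JL_replicate_cong:
  assumes "bounded_borel u" "bounded_borel v" "\<And>y. y \<in> Q (ord1 j (s + r)) \<Longrightarrow> u y = v y"
    and "x \<in> Q (ord1 j s)"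
  shows "JL (replicate r j) u x = JL (replicate r j) v x"
  using assms(3,4)
proof (induction r arbitrary: s x)
  case (Suc r)
  have "(ord1 j s)(j := Suc (ord1 j s j)) = ord1 j (Suc s)" by (auto simp: ord1_def)
  then show ?case
    using Suc.prems Q_Suc[of x "ord1 j s" _ j]
    by (auto intro!: J_cong JL_bounded_borel assms(1,2) Suc.IH[where s="Suc s"])
qed simp

definition blocks :: "'n list \<Rightarrow> 'n list" where
  "blocks js = concat (map (\<lambda>j. replicate (lam j) j) js)"

lemma set_blocks: "set (blocks js) \<subseteq> set js"
  by (auto simp: blocks_def)

definition ord_upto :: "'n list \<Rightarrow> 'n \<Rightarrow> nat \<Rightarrow> 'n \<Rightarrow> nat" where
  "ord_upto js j r = (\<lambda>i. if i = j then r else if i \<in> set js then lam i else 0)"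

definition stage :: "'n list \<Rightarrow> ((real, 'n) vec \<Rightarrow> real) \<Rightarrow> (real, 'n) vec \<Rightarrow> real" where
  "stage js f = fold (\<lambda>j. pdelta_iter T j (lam j)) js f"

text \<open>Beyond this set the derivative may depend on values outside the box. For functions of
  the class the cut gives a total bounded Borel function, and the integrals applied to it never look
  at the part cut away.\<close>

definition cut_stage :: "'n list \<Rightarrow> ((real, 'n) vec \<Rightarrow> real) \<Rightarrow> (real, 'n) vec \<Rightarrow> real" where
  "cut_stage js f x = indicator (Q (\<lambda>i. if i \<in> set js then lam i else 0)) x * stage js f x"

section \<open>Integrating back the derivatives in one variable\<close>

context
  fixes js j rest
  assumes split: "sorted_list_of_set (UNIV :: 'n set) = js @ j # rest"
begin

lemma j_notin: "j \<notin> set js" and set_js: "set js = {i. i < j}" and set_rest: "set rest = {i. j < i}"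
proof -
  have d: "distinct (js @ j # rest)" and s: "sorted (js @ j # rest)"
    and U: "set (js @ j # rest) = UNIV"
    by (metis split distinct_sorted_list_of_set, metis split sorted_sorted_list_of_set,
        metis split set_sorted_list_of_set finite)
  show "j \<notin> set js" using d by simp
  have 1: "\<And>i. i \<in> set js \<Longrightarrow> i < j" "\<And>i. i \<in> set rest \<Longrightarrow> j < i"
    using d s by (auto simp: sorted_append less_le)
  have U': "i \<in> set js \<or> i = j \<or> i \<in> set rest" for i using U by auto
  have "i \<in> set js" if "i < j" for i
    using U'[of i] 1(2)[of i] that order.asym[OF that] by blast
  then show "set js = {i. i < j}" using 1(1) by blast
  have "i \<in> set rest" if "j < i" for i
    using U'[of i] 1(1)[of i] that order.asym[OF that] by blast
  then show "set rest = {i. j < i}" using 1(2) by blast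
qed

lemma mixed_ord_upto:
  "mixed_delta T (ord_upto js j r) f = pdelta_iter T j r (stage js f)"
proof -
  have "fold (\<lambda>i. pdelta_iter T i (ord_upto js j r i)) js f = stage js f"
    unfolding stage_def using j_notin by (intro fold_cong) (auto simp: ord_upto_def)
  moreover have "fold (\<lambda>i. pdelta_iter T i (ord_upto js j r i)) rest = id"
    using set_rest set_js
    by (intro fold_id) (auto simp: ord_upto_def fun_eq_iff)
  ultimately show ?thesis
    unfolding mixed_delta_def split fold_append fold_Cons o_apply by (simp add: ord_upto_def)
qed

text \<open>The orders \<open>ord_upto js j (Suc r)\<close> are among those of \<open>C_rd\<close>
  because \<open>js\<close> lists exactly the variables before \<open>j\<close>.\<close>

lemma C_rd_stage:
  assumes "f \<in> C_rd T a b lam" "r < lam j"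
  shows "x \<in> kappa_box T a b (ord_upto js j (Suc r)) \<Longrightarrow>
      pdelta_differentiable ((ts_kappa ^^ r) (T j)) j (pdelta_iter T j r (stage js f)) x"
    and "rd_continuous_on T (kappa_box T a b (ord_upto js j (Suc r))) (pdelta_iter T j (Suc r) (stage js f))"
proof -
  let ?k = "ord_upto js j (Suc r)"
  have "\<forall>i\<le>j. 1 \<le> ?k i \<and> ?k i \<le> lam i" "\<forall>i>j. ?k i = 0"
    using assms(2) lam by (auto simp: ord_upto_def set_js)
  then have *: "(\<forall>x\<in>kappa_box T a b ?k.
         pdelta_differentiable ((ts_kappa ^^ (?k j - 1)) (T j)) j (mixed_delta T (?k(j := ?k j - 1)) f) x) \<and>
      rd_continuous_on T (kappa_box T a b ?k) (mixed_delta T ?k f)"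
    using assms(1) unfolding C_rd_def by blast
  have k: "?k j - 1 = r" "?k(j := r) = ord_upto js j r" by (auto simp: ord_upto_def)
  show "x \<in> kappa_box T a b ?k \<Longrightarrow>
      pdelta_differentiable ((ts_kappa ^^ r) (T j)) j (pdelta_iter T j r (stage js f)) x"
    using conjunct1[OF *] unfolding k mixed_ord_upto by blast
  show "rd_continuous_on T (kappa_box T a b ?k) (pdelta_iter T j (Suc r) (stage js f))"
    using conjunct2[OF *] unfolding mixed_ord_upto .
qed

text \<open>Leads from \<open>cut_stage js f\<close> at \<open>r = 0\<close> to
  \<open>cut_stage (js @ [j]) f\<close> at \<open>r = lam j\<close>, one derivative at a
  time.\<close>

definition cut :: "((real, 'n) vec \<Rightarrow> real) \<Rightarrow> nat \<Rightarrow> (real, 'n) vec \<Rightarrow> real" where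
  "cut f r x = indicator (Q (ord_upto js j r)) x * pdelta_iter T j r (stage js f) x"

lemma cut_bounded_borel:
  assumes "f \<in> C_rd T a b lam" "r < lam j"
  shows "bounded_borel (cut f (Suc r))"
  unfolding cut_def[abs_def]
  by (rule rd_continuous_bounded_borel[OF C_rd_stage(2)[OF assms] meas_Q Q_subset])

lemma cut_0: "cut f 0 = cut_stage js f"
proof -
  have "ord_upto js j 0 = (\<lambda>i. if i \<in> set js then lam i else 0)"
    using j_notin by (auto simp: ord_upto_def)
  then show ?thesis by (simp add: cut_def[abs_def] cut_stage_def[abs_def])
qed

lemma cut_lam: "cut f (lam j) = cut_stage (js @ [j]) f"
proof -
  have "ord_upto js j (lam j) = (\<lambda>i. if i \<in> set (js @ [j]) then lam i else 0)"
    by (auto simp: ord_upto_def)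
  then show ?thesis by (simp add: cut_def[abs_def] cut_stage_def[abs_def] stage_def)
qed

lemma ord_upto_Suc: "ord_upto js j r j = r" "(ord_upto js j r)(j := Suc r) = ord_upto js j (Suc r)"
  by (auto simp: ord_upto_def)

lemma stage_increment:
  assumes f: "f \<in> C_rd T a b lam" and r: "r < lam j" and y: "y \<in> Q (ord_upto js j r)"
  shows "pdelta_iter T j r (stage js f) y =
    pdelta_iter T j r (stage js f) (vec_upd y j (a $ j)) + J j (cut f (Suc r)) y"
proof -
  have "pdelta_iter T j r (stage js f) y - pdelta_iter T j r (stage js f) (vec_upd y j (a $ j)) =
      J j (cut f (Suc r)) y"
    unfolding cut_def[abs_def]
    by (rule increment_eq_J[where k="ord_upto js j r" and j=j, unfolded ord_upto_Suc,
          OF C_rd_stage(1)[OF f r] _ C_rd_stage(2)[OF f r] y]) auto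
  then show ?thesis by simp
qed

text \<open>\<open>JL_slice\<close> asks for this identity on the whole slice, also outside the cut
  set. There \<open>y\<close> violates a condition in a variable other than \<open>j\<close>, since
  \<open>y $ j = x $ j\<close> is admissible. The violation persists along the line in direction
  \<open>j\<close> and for every order in \<open>j\<close>, so all three terms vanish.\<close>

lemma cut_increment:
  assumes f: "f \<in> C_rd T a b lam" and r: "r < lam j"
    and x: "x \<in> Q (ord1 j r)" and y: "y $ j = x $ j"
  shows "cut f r y = cut f r (vec_upd y j (a $ j)) + J j (cut f (Suc r)) y"
proof (cases "y \<in> Q (ord_upto js j r)")
  case True
  have "vec_upd y j (a $ j) \<in> Q (ord_upto js j r)"
    using True r by (intro Q_base) (auto simp: ord_upto_def)
  then show ?thesis using stage_increment[OF f r True] True by (simp add: cut_def)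
next
  case False
  have *: "vec_upd y j t \<notin> Q (ord_upto js j q)" for t q
  proof
    assume v: "vec_upd y j t \<in> Q (ord_upto js j q)"
    have "y \<in> Q (ord_upto js j r)"
      unfolding Q_def ts_box_def ts_prod_def
    proof (intro CollectI conjI allI impI)
      fix i
      have *: "i \<noteq> j \<Longrightarrow> vec_upd y j t $ i = y $ i" "i = j \<Longrightarrow> y $ i = x $ i" using y by auto
      have "vec_upd y j t $ i \<in> T i \<and> a $ i \<le> vec_upd y j t $ i \<and> vec_upd y j t $ i \<le> b $ i"
        "x $ i \<in> T i \<and> a $ i \<le> x $ i \<and> x $ i \<le> b $ i"
        using v x unfolding Q_def ts_box_def ts_prod_def by blast+
      then show "y $ i \<in> T i" "a $ i \<le> y $ i" "y $ i \<le> b $ i"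
        using * by (cases "i = j"; simp)+
      assume "1 \<le> ord_upto js j r i"
      then show "y $ i < (bwd_jump (T i) ^^ (ord_upto js j r i - 1)) (b $ i)"
      proof (cases "i = j")
        case True
        then show ?thesis using x \<open>1 \<le> ord_upto js j r i\<close> * by (simp add: Q_ord1_iff ord_upto_def)
      next
        case False
        then have e: "ord_upto js j r i = ord_upto js j q i" by (simp add: ord_upto_def)
        have "1 \<le> ord_upto js j q i \<longrightarrow>
            vec_upd y j t $ i < (bwd_jump (T i) ^^ (ord_upto js j q i - 1)) (b $ i)"
          using v unfolding Q_def by blast
        then show ?thesis using e \<open>1 \<le> ord_upto js j r i\<close> *(1)[OF False] by simp
      qed
    qed
    then show False using False by simp
  qed
  have "J j (cut f (Suc r)) y = 0"
    unfolding J_prim I.prim_def cut_def using * by simp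
  then show ?thesis using False * by (simp add: cut_def)
qed

text \<open>Differentiating the primitive of \<open>G (Suc r)\<close> requires continuity of
  \<open>G (Suc r)\<close> in variable \<open>j\<close>. Below order \<open>lam j\<close> this holds
  because \<open>G (Suc r)\<close> is itself a constant plus a primitive; the function of order
  \<open>lam j\<close> is only integrated.\<close>

lemma representation_step:
  assumes f: "f \<in> L1_class T a b lam" and bb: "bounded_borel (cut_stage js f)"
    and rep: "\<And>x. x \<in> ts_box T a b \<Longrightarrow> f x = JL (blocks js) (cut_stage js f) x"
  shows "bounded_borel (cut_stage (js @ [j]) f)"
    and "x \<in> ts_box T a b \<Longrightarrow> f x = JL (blocks (js @ [j])) (cut_stage (js @ [j]) f) x"
proof -
  have C: "f \<in> C_rd T a b lam" using f by (simp add: L1_class_def)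
  have L1: "(r > 0 \<longrightarrow> pdelta_differentiable ((ts_kappa ^^ (r - 1)) (T j)) j (pdelta_iter T j (r - 1) f) x) \<and>
      pdelta_iter T j r f x = 0" if "r < lam j" "x \<in> ts_box T a b" "x $ j = a $ j" for r x
    using f that unfolding L1_class_def by blast
  have cbb: "bounded_borel (cut f r)" if "r \<le> lam j" for r
  proof (cases r)
    case 0
    then show ?thesis using bb cut_0[of f] by simp
  next
    case (Suc q)
    then show ?thesis using cut_bounded_borel[OF C, of q] that by simp
  qed
  show "bounded_borel (cut_stage (js @ [j]) f)" using cbb[of "lam j"] cut_lam[of f] by simp
  define G where "G r = JL (blocks js) (cut f r)" for r
  have jb: "j \<notin> set (blocks js)" using j_notin set_blocks by auto
  have Gbb: "bounded_borel (G r)" if "r \<le> lam j" for r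
    unfolding G_def using that by (intro JL_bounded_borel cbb)
  have G_inc: "G r x = G r (vec_upd x j (a $ j)) + J j (G (Suc r)) x"
    if r: "r < lam j" and x: "x \<in> Q (ord1 j r)" for r x
  proof -
    have "G r x = JL (blocks js) (\<lambda>y. cut f r (vec_upd y j (a $ j)) + J j (cut f (Suc r)) y) x"
      unfolding G_def by (rule JL_slice[OF jb]) (rule cut_increment[OF C r x])
    also have "\<dots> = JL (blocks js) (\<lambda>y. cut f r (vec_upd y j (a $ j))) x + JL (blocks js) (J j (cut f (Suc r))) x"
      using r by (subst JL_add[OF bounded_borel_subst[OF cbb] J_bounded_borel[OF cbb]]) auto
    also have "\<dots> = G r (vec_upd x j (a $ j)) + J j (G (Suc r)) x"
      using r by (simp add: JL_subst[OF jb] JL_J_commute[OF cbb jb] G_def)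
    finally show ?thesis .
  qed
  have box: "x \<in> ts_box T a b" if "x \<in> Q k" for x k
    using that by (simp add: Q_def)
  have G_prim: "G r (vec_upd x j t) = G r (vec_upd x j (a $ j)) + I.prim j (\<lambda>s. G (Suc r) (vec_upd x j s)) t"
    if "r < lam j" "vec_upd x j t \<in> Q (ord1 j r)" for r x t
    using G_inc[OF that] by (simp add: J_prim)
  have eq: "pdelta_iter T j r f x = G r x" if "r < lam j" "x \<in> Q (ord1 j r)" for r x
    using that
  proof (induction r arbitrary: x)
    case 0
    then show ?case using rep[OF box[OF 0(2)]] cut_0[of f] by (simp add: G_def)
  next
    case (Suc r)
    have xb: "x $ j \<in> T j" "a $ j \<le> x $ j" "x $ j \<le> b $ j"
      using box[OF Suc.prems(2)] by (auto simp: ts_box_def ts_prod_def)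
    let ?\<psi> = "\<lambda>t. G (Suc r) (vec_upd x j t)"
    have "pdelta ((ts_kappa ^^ r) (T j)) j (pdelta_iter T j r f) x = ?\<psi> (x $ j)"
    proof (rule pdelta_eq_of_prim[OF Suc.prems(2), where c="G r (vec_upd x j (a $ j))"])
      show "bounded_borel ?\<psi>" using Suc.prems by (intro bounded_borel_slice Gbb) simp
      show "pdelta_iter T j r f (vec_upd x j t) = G r (vec_upd x j (a $ j)) + I.prim j ?\<psi> t"
        if "vec_upd x j t \<in> Q (ord1 j r)" for t
        using Suc.IH[OF _ that] G_prim[OF _ that] Suc.prems(1) by simp
      show "pdelta_differentiable ((ts_kappa ^^ r) (T j)) j (pdelta_iter T j r f) x" if "x $ j = a $ j"
        using L1[OF Suc.prems(1) box[OF Suc.prems(2)] that] by simp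
      let ?F = "at (x $ j) within T j \<inter> {a $ j..b $ j}"
      \<comment> \<open>A continuous version of \<open>?\<psi>\<close>: the two agree on the scale
        below rho^r(b), hence near \<open>x $ j\<close>.\<close>
      let ?\<chi> = "\<lambda>t. G (Suc r) (vec_upd x j (a $ j)) + I.prim j (\<lambda>s. G (Suc (Suc r)) (vec_upd x j s)) t"
      have "(?\<chi> \<longlongrightarrow> ?\<chi> (x $ j)) ?F"
        using Suc.prems(1) xb
        by (intro tendsto_add tendsto_const I.prim_continuous bounded_borel_slice Gbb) auto
      moreover have *: "?\<chi> t = ?\<psi> t"
        if "t \<in> T j" "a $ j \<le> t" "t \<le> b $ j" "t < (bwd_jump (T j) ^^ r) (b $ j)" for t
        using G_prim[OF Suc.prems(1), of x t] that box[OF Suc.prems(2)]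
        by (auto simp: Q_ord1_iff ts_box_def ts_prod_def)
      moreover have lt: "x $ j < (bwd_jump (T j) ^^ r) (b $ j)"
        using Suc.prems(2) by (simp add: Q_ord1_iff)
      moreover have "\<forall>\<^sub>F t in ?F. ?\<chi> t = ?\<psi> t"
      proof -
        have "\<forall>\<^sub>F t in nhds (x $ j). t \<in> {..<(bwd_jump (T j) ^^ r) (b $ j)}"
          using lt by (intro eventually_nhds_in_open) auto
        then show ?thesis unfolding eventually_at_filter by eventually_elim (use * in auto)
      qed
      ultimately show "(?\<psi> \<longlongrightarrow> ?\<psi> (x $ j)) ?F"
        using Lim_transform_eventually[of ?\<chi> "?\<chi> (x $ j)" ?F ?\<psi>] xb by simp
    qed
    then show ?case by simp
  qed
  \<comment> \<open>By \<open>eq\<close> the boundary term is a derivative of \<open>f\<close>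
    itself at a point with \<open>x $ j = a $ j\<close>, where the class makes it zero.\<close>
  have G_J: "G r x = J j (G (Suc r)) x" if "r < lam j" "x \<in> Q (ord1 j r)" for r x
  proof -
    have "vec_upd x j (a $ j) \<in> Q (ord1 j r)" using that by (intro Q_base) (auto simp: ord1_def)
    then have "G r (vec_upd x j (a $ j)) = 0" 
      using eq[OF that(1), of "vec_upd x j (a $ j)"]
        L1[OF that(1) box, of "vec_upd x j (a $ j)" "ord1 j r"] by simp
    then show ?thesis using G_inc[OF that] by simp
  qed
  have main: "f x = JL (replicate r j) (G r) x" if "r \<le> lam j" "x \<in> ts_box T a b" for r x
    using that
  proof (induction r)
    case 0
    then show ?case using rep cut_0[of f] by (simp add: G_def)
  next
    case (Suc r)
    then have "f x = JL (replicate r j) (G r) x" by simp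
    also have "\<dots> = JL (replicate r j) (J j (G (Suc r))) x"
      using Suc.prems by (intro JL_replicate_cong[where s=0] Gbb J_bounded_borel G_J) (auto simp: Q_ord1_iff)
    also have "\<dots> = JL (replicate r j @ [j]) (G (Suc r)) x" by simp
    also have "replicate r j @ [j] = replicate (Suc r) j" by (simp add: replicate_append_same)
    finally show ?case .
  qed
  show "f x = JL (blocks (js @ [j])) (cut_stage (js @ [j]) f) x" if "x \<in> ts_box T a b"
  proof -
    have "JL (replicate (lam j) j) (G (lam j)) = JL (blocks js) (JL (replicate (lam j) j) (cut f (lam j)))"
      unfolding G_def by (rule JL_replicate_commute[OF cbb jb]) simp
    then show ?thesis using main[OF order_refl that] cut_lam[of f] by (simp add: blocks_def)
  qed
qed

end

lemma ord_lam: "(\<lambda>i. if i \<in> set (sorted_list_of_set UNIV) then lam i else 0) = lam"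
  by auto

text \<open>\<open>C_rd\<close> says nothing about \<open>f\<close> itself, so its measurability comes from integrating its derivative in
  the first variable.\<close>

lemma stage_0_bounded_borel:
  assumes "f \<in> L1_class T a b lam"
  shows "bounded_borel (cut_stage [] f)"
proof -
  have "sorted_list_of_set (UNIV :: 'n set) \<noteq> []" by simp
  then obtain j rest where s: "sorted_list_of_set (UNIV :: 'n set) = [] @ j # rest"
    by (metis append_Nil list.exhaust)
  have C: "f \<in> C_rd T a b lam" using assms by (simp add: L1_class_def)
  have l: "0 < lam j" using lam[of j] by simp
  have Q0: "Q (\<lambda>_. 0) = ts_box T a b" by (auto simp: Q_def)
  have o0: "ord_upto [] j 0 = (\<lambda>_. 0)" by (auto simp: ord_upto_def)
  have "f x = J j (cut [] j f (Suc 0)) x" if "x \<in> ts_box T a b" for x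
  proof -
    have "vec_upd x j (a $ j) \<in> ts_box T a b" using Q_base[of x "\<lambda>_. 0" j] that Q0 by simp
    then have "f (vec_upd x j (a $ j)) = 0"
      using assms l unfolding L1_class_def by force
    then show ?thesis using stage_increment[OF s C l, of x] that by (simp add: o0 Q0 stage_def)
  qed
  then have "cut_stage [] f = (\<lambda>x. indicator (ts_box T a b) x * J j (cut [] j f (Suc 0)) x)"
    by (auto simp: cut_stage_def[abs_def] stage_def Q0 indicator_def)
  moreover have "bounded_borel \<dots>"
    by (intro bounded_borel_mult bounded_borel_indicator J_bounded_borel cut_bounded_borel[OF s C l] meas_box)
  ultimately show ?thesis by simp
qed

lemma representation_prefix:
  assumes f: "f \<in> L1_class T a b lam" and "sorted_list_of_set (UNIV :: 'n set) = js @ rest"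
  shows "bounded_borel (cut_stage js f) \<and> (\<forall>x\<in>ts_box T a b. f x = JL (blocks js) (cut_stage js f) x)"
  using assms(2)
\<comment> \<open>Induction from the right end, since each step appends the next variable to those
  already treated.\<close>
proof (induction js arbitrary: rest rule: rev_induct)
  case Nil
  have "Q (\<lambda>_. 0) = ts_box T a b" by (auto simp: Q_def)
  then have "f x = JL (blocks []) (cut_stage [] f) x" if "x \<in> ts_box T a b" for x
    using that by (simp add: blocks_def cut_stage_def stage_def)
  then show ?case using stage_0_bounded_borel[OF f] by blast
next
  case (snoc j js)
  then have s: "sorted_list_of_set (UNIV :: 'n set) = js @ j # rest" by simp
  from snoc.IH[OF s] representation_step[OF s f] show ?case by blast
qed

lemma representation:
  assumes f: "f \<in> L1_class T a b lam"
  shows "x \<in> ts_box T a b \<Longrightarrow> f x = JL (blocks (sorted_list_of_set UNIV))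
      (\<lambda>y. indicator (Q lam) y * mixed_delta T lam f y) x"
    and "bounded_borel (\<lambda>y. indicator (Q lam) y * mixed_delta T lam f y)"
  using representation_prefix[OF f, of "sorted_list_of_set UNIV" "[]"]
  unfolding cut_stage_def[abs_def] ord_lam by (auto simp: stage_def mixed_delta_def)

text \<open>The theorem integrates the full derivative over the whole box, including points outside
  \<open>Q lam\<close> that the representation never reads. It is rd-continuous on
  \<open>kappa_box\<close> and 0 by default on the rest of the box.\<close>

lemma mixed_delta_bounded_borel:
  assumes f: "f \<in> C_rd T a b lam"
  shows "bounded_borel (\<lambda>x. indicator (ts_box T a b) x * mixed_delta T lam f x)"
proof -
  have "sorted_list_of_set (UNIV :: 'n set) \<noteq> []" by simp
  then obtain j js where s: "sorted_list_of_set (UNIV :: 'n set) = js @ j # []"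
    by (metis rev_exhaust)
  have l: "lam j - 1 < lam j" "Suc (lam j - 1) = lam j" using lam[of j] by auto
  have "set (js @ [j]) = UNIV" by (metis s set_sorted_list_of_set finite)
  then have "i = j \<or> i \<in> set js" for i by auto
  then have "ord_upto js j (lam j) = lam" by (auto simp: ord_upto_def fun_eq_iff)
  then have "rd_continuous_on T (kappa_box T a b lam) (mixed_delta T lam f)"
    using C_rd_stage(2)[OF s f l(1)] mixed_ord_upto[OF s, of "lam j" f] unfolding l(2) by simp
  from rd_continuous_bounded_borel[OF this borel_compact[OF compact_kappa_box] order_refl]
  have "bounded_borel (\<lambda>x. indicator (kappa_box T a b lam) x * mixed_delta T lam f x)" .
  moreover have "indicator (kappa_box T a b lam) x * mixed_delta T lam f x =
      indicator (ts_box T a b) x * mixed_delta T lam f x" for x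
    using mixed_delta_eq_0[of x f] by (auto simp: indicator_def kappa_box_def)
  ultimately show ?thesis by simp
qed

end

section \<open>The one-dimensional inequality\<close>

text \<open>The sign and monotonicity conditions on \<open>F\<close> concern the open cube, but the
  functions \<open>f i\<close> and the path \<open>V\<close> may vanish in some coordinates. The
  faces at 0 are reached by continuity along the diagonal.\<close>

definition nonneg_cube :: "ereal \<Rightarrow> (real ^ 'm) set" where
  "nonneg_cube R = {x. \<forall>i. 0 \<le> x $ i \<and> ereal (x $ i) < R}"

lemma nonneg_cube_subset: "nonneg_cube R \<subseteq> sym_cube R"
  by (auto simp: nonneg_cube_def sym_cube_def)

lemma pos_cube_subset: "pos_cube R \<subseteq> sym_cube R"
proof
  fix x :: "real ^ 'm" assume x: "x \<in> pos_cube R"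
  then have "\<bar>x $ i\<bar> = x $ i" for i by (simp add: pos_cube_def abs_of_pos)
  then show "x \<in> sym_cube R" using x by (simp add: pos_cube_def sym_cube_def)
qed

lemma pos_cube_shift:
  fixes x :: "real ^ 'm::finite"
  assumes "x \<in> nonneg_cube R"
  shows "\<forall>\<^sub>F e in at_right 0. x + (\<chi> i. e) \<in> pos_cube R"
proof -
  have "\<forall>\<^sub>F e in at_right 0. 0 < x $ i + e \<and> ereal (x $ i + e) < R" for i
  proof -
    have x: "0 \<le> x $ i" "ereal (x $ i) < R" using assms by (auto simp: nonneg_cube_def)
    have pos: "\<forall>\<^sub>F e in at_right (0::real). 0 < e" by (simp add: eventually_at_right_less)
    obtain z where z: "x $ i < z" "ereal z < R" using ereal_dense2[OF x(2)] by auto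
    have "\<forall>\<^sub>F e in at_right (0::real). e < z - x $ i"
      using z(1) by (intro order_tendstoD(2)[OF tendsto_ident_at]) simp
    with pos show ?thesis
    proof eventually_elim
      case (elim e)
      have "ereal (x $ i + e) < ereal z" using elim by simp
      from less_trans[OF this z(2)] show ?case using x elim by simp
    qed
  qed
  then have "\<forall>\<^sub>F e in at_right 0. \<forall>i. 0 < x $ i + e \<and> ereal (x $ i + e) < R"
    by (rule eventually_all_finite)
  then show ?thesis by eventually_elim (simp add: pos_cube_def)
qed

context
  fixes F :: "real ^ 'm::finite \<Rightarrow> real" and R :: ereal
  assumes F: "F \<in> H_class R"
begin

lemma partial_deriv_cont: "continuous_on (sym_cube R) (partial_deriv i F)"
  using F by (auto simp: H_class_def C1_on_def)

lemma partial_deriv_shift: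
  assumes "x \<in> nonneg_cube R"
  shows "((\<lambda>e. partial_deriv i F (x + (\<chi> i. e))) \<longlongrightarrow> partial_deriv i F x) (at_right 0)"
proof (rule continuous_on_tendsto_compose[OF partial_deriv_cont])
  have "((\<lambda>e. x + (\<chi> i. e)) \<longlongrightarrow> x + (\<chi> i. 0)) (at_right 0)"
    by (intro tendsto_add tendsto_const tendsto_vec_lambda tendsto_ident_at)
  moreover have "(\<chi> i. 0) = (0 :: real ^ 'm)" by (simp add: vec_eq_iff)
  ultimately show "((\<lambda>e. x + (\<chi> i. e)) \<longlongrightarrow> x) (at_right 0)" by simp
  show "x \<in> sym_cube R" using assms nonneg_cube_subset by auto
  show "\<forall>\<^sub>F e in at_right 0. x + (\<chi> i. e) \<in> sym_cube R"
    using pos_cube_shift[OF assms] by eventually_elim (use pos_cube_subset in auto)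
qed

lemma partial_deriv_nonneg:
  assumes "x \<in> nonneg_cube R"
  shows "0 \<le> partial_deriv i F x"
proof (rule tendsto_lowerbound[OF partial_deriv_shift[OF assms]])
  show "\<forall>\<^sub>F e in at_right 0. 0 \<le> partial_deriv i F (x + (\<chi> i. e))"
    using pos_cube_shift[OF assms] by eventually_elim (use F in \<open>auto simp: H_class_def\<close>)
qed simp

lemma partial_deriv_mono_pos:
  assumes x: "x \<in> pos_cube R" and y: "y \<in> pos_cube R" and le: "\<And>j. x $ j \<le> y $ j"
  shows "partial_deriv i F x \<le> partial_deriv i F y"
proof -
  \<comment> \<open>Coordinates are raised one at a time; \<open>A\<close> collects those already
    raised.\<close>
  have "partial_deriv i F x \<le> partial_deriv i F (\<chi> j. if j \<in> A then y $ j else x $ j)"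
    if "finite A" for A
    using that
  proof (induction A rule: finite_induct)
    case empty
    then show ?case by simp
  next
    case (insert k A)
    let ?z = "\<chi> j. if j \<in> A then y $ j else x $ j"
    have z: "?z \<in> pos_cube R" using x y by (auto simp: pos_cube_def)
    have "?z $ k \<le> y $ k \<and> ereal (y $ k) < R" using insert le y by (auto simp: pos_cube_def)
    then have "partial_deriv i F ?z \<le> partial_deriv i F (vec_upd ?z k (y $ k))"
      using F z unfolding H_class_def by blast
    also have "vec_upd ?z k (y $ k) = (\<chi> j. if j \<in> insert k A then y $ j else x $ j)"
      by (auto simp: vec_eq_iff)
    finally show ?case using insert.IH by simp
  qed
  from this[of UNIV] show ?thesis by simp
qed

lemma partial_deriv_mono:
  assumes x: "x \<in> nonneg_cube R" and y: "y \<in> nonneg_cube R" and le: "\<And>j. x $ j \<le> y $ j"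
  shows "partial_deriv i F x \<le> partial_deriv i F y"
proof (rule tendsto_le[OF _ partial_deriv_shift[OF y] partial_deriv_shift[OF x]])
  show "\<forall>\<^sub>F e in at_right 0. partial_deriv i F (x + (\<chi> i. e)) \<le> partial_deriv i F (y + (\<chi> i. e))"
    using pos_cube_shift[OF x] pos_cube_shift[OF y]
    by eventually_elim (rule partial_deriv_mono_pos, auto simp: le)
qed simp

text \<open>Walk from \<open>x\<close> to \<open>y\<close> one coordinate at a time. On each edge
  the mean value theorem yields a partial derivative at a point above \<open>x\<close>, which
  monotonicity compares with the one at \<open>x\<close>. This replaces the chain rule across a
  jump.\<close>

lemma gradient_le_increment:
  assumes x: "x \<in> nonneg_cube R" and y: "y \<in> nonneg_cube R" and le: "\<And>j. x $ j \<le> y $ j"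
  shows "(\<Sum>i\<in>UNIV. partial_deriv i F x * (y $ i - x $ i)) \<le> F y - F x"
proof -
  have "(\<Sum>i\<in>A. partial_deriv i F x * (y $ i - x $ i)) \<le> F (\<chi> j. if j \<in> A then y $ j else x $ j) - F x"
    if "finite A" for A
    using that
  proof (induction A rule: finite_induct)
    case empty
    then show ?case by simp
  next
    case (insert k A)
    let ?z = "\<chi> j. if j \<in> A then y $ j else x $ j"
    have zk: "?z $ k = x $ k" using insert by simp
    have up: "vec_upd ?z k (y $ k) = (\<chi> j. if j \<in> insert k A then y $ j else x $ j)"
      by (auto simp: vec_eq_iff)
    have in_cube: "vec_upd ?z k t \<in> nonneg_cube R" if "x $ k \<le> t" "t \<le> y $ k" for t
    proof -
      have "ereal t \<le> ereal (y $ k)" "ereal (y $ k) < R" "0 \<le> x $ k"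
        using that x y by (auto simp: nonneg_cube_def)
      then have "ereal t < R" "0 \<le> t" using that le_less_trans[of "ereal t" "ereal (y $ k)" R] by auto
      then show ?thesis using x y by (auto simp: nonneg_cube_def)
    qed
    have "partial_deriv k F x * (y $ k - x $ k) \<le> F (vec_upd ?z k (y $ k)) - F ?z"
    proof (cases "x $ k = y $ k")
      case True
      then have "vec_upd ?z k (y $ k) = ?z" using zk vec_upd_id[of ?z k] by simp
      then show ?thesis using True by simp
    next
      case False
      then have lt: "x $ k < y $ k" using le[of k] by simp
      have "((\<lambda>s. F (vec_upd ?z k s)) has_real_derivative partial_deriv k F (vec_upd ?z k t)) (at t)"
        if "x $ k \<le> t" "t \<le> y $ k" for t
      proof -
        have "vec_upd ?z k t \<in> sym_cube R" using in_cube[OF that] nonneg_cube_subset by auto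
        moreover have "\<forall>w\<in>sym_cube R. (\<lambda>s. F (vec_upd w k s)) field_differentiable at (w $ k)"
          using F unfolding H_class_def C1_on_def by blast
        ultimately have "(\<lambda>s. F (vec_upd (vec_upd ?z k t) k s)) field_differentiable at (vec_upd ?z k t $ k)"
          by blast
        then show ?thesis unfolding partial_deriv_def
          by (simp add: field_differentiable_derivI)
      qed
      from MVT2[OF lt this] obtain \<xi> where \<xi>: "x $ k < \<xi>" "\<xi> < y $ k"
        "F (vec_upd ?z k (y $ k)) - F (vec_upd ?z k (x $ k)) = (y $ k - x $ k) * partial_deriv k F (vec_upd ?z k \<xi>)"
        by blast
      have "partial_deriv k F x \<le> partial_deriv k F (vec_upd ?z k \<xi>)"
        using \<xi> le by (intro partial_deriv_mono x in_cube) auto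
      then have "partial_deriv k F x * (y $ k - x $ k) \<le> partial_deriv k F (vec_upd ?z k \<xi>) * (y $ k - x $ k)"
        using lt by (intro mult_right_mono) auto
      then show ?thesis using \<xi>(3) vec_upd_id[of ?z k] unfolding zk by (simp add: mult.commute)
    qed
    then show ?case using insert unfolding up by simp
  qed
  from this[of UNIV] show ?thesis by simp
qed

end

section \<open>Primitives as increasing paths and the limit of sums along them\<close>

context ts_interval
begin

lemma prim_diff_eq:
  assumes "bounded_borel f" "bounded_borel g" "x \<le> y" "\<And>t. x \<le> t \<Longrightarrow> t < y \<Longrightarrow> f t = g t"
  shows "prim f y - prim f x = prim g y - prim g x"
proof -
  have *: "prim f y - prim f x = (\<integral>t. indicator {x..<y} t * f t \<partial>\<mu>)" if "bounded_borel f" for f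
  proof -
    have "prim f y - prim f x = (\<integral>t. (if t < y then 1 else 0) * f t - (if t < x then 1 else 0) * f t \<partial>\<mu>)"
      unfolding prim_def using that
      by (intro Bochner_Integration.integral_diff[symmetric] integrable_cell bounded_borel_less)
    also have "\<dots> = (\<integral>t. indicator {x..<y} t * f t \<partial>\<mu>)"
      using assms(3) by (intro Bochner_Integration.integral_cong) (auto simp: indicator_def)
    finally show ?thesis .
  qed
  show ?thesis unfolding *[OF assms(1)] *[OF assms(2)]
    using assms(4) by (intro Bochner_Integration.integral_cong) (auto simp: indicator_def)
qed

lemma prim_top:
  assumes "bounded_borel f" "b \<le> x"
  shows "prim f x = (\<integral>t. f t \<partial>\<mu>)"
  unfolding prim_def
proof (rule integral_cong_AE)
  show "(\<lambda>t. (if t < x then 1 else 0) * f t) \<in> borel_measurable \<mu>" "f \<in> borel_measurable \<mu>"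
    using bounded_borel_measurable[OF bounded_borel_less[OF assms(1)]] bounded_borel_measurable[OF assms(1)]
    by simp_all
  show "AE t in \<mu>. (if t < x then 1 else 0) * f t = f t"
    using AE_cell by eventually_elim (use assms(2) in auto)
qed

lemma prim_le_top:
  assumes "bounded_borel f" "\<And>t. 0 \<le> f t"
  shows "prim f x \<le> (\<integral>t. f t \<partial>\<mu>)"
  using prim_incr[OF assms, of x "max x b"] prim_top[OF assms(1), of "max x b"] by simp

lemma prim_sum:
  assumes "\<And>i. i \<in> I \<Longrightarrow> bounded_borel (f i)"
  shows "prim (\<lambda>t. \<Sum>i\<in>I. c i * f i t) x = (\<Sum>i\<in>I. c i * prim (f i) x)"
proof -
  have "prim (\<lambda>t. \<Sum>i\<in>I. c i * f i t) x = (\<integral>t. (\<Sum>i\<in>I. c i * ((if t < x then 1 else 0) * f i t)) \<partial>\<mu>)"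
    unfolding prim_def by (intro Bochner_Integration.integral_cong) (auto simp: sum_distrib_left)
  also have "\<dots> = (\<Sum>i\<in>I. \<integral>t. c i * ((if t < x then 1 else 0) * f i t) \<partial>\<mu>)"
    using assms by (intro Bochner_Integration.integral_sum integrable_mult_right integrable_cell bounded_borel_less)
  finally show ?thesis by (simp add: prim_def)
qed

text \<open>For \<open>s n\<close> tending to \<open>t\<close> from the left the cut-off
  \<open>r < s n\<close> converges pointwise to \<open>r < t\<close>, also at an atom
  \<open>r = t\<close>, where both are false.\<close>

lemma prim_left_continuous:
  assumes f: "bounded_borel f" and s: "s \<longlonglongrightarrow> t" "\<And>n. s n \<le> t"
  shows "(\<lambda>n. prim f (s n)) \<longlonglongrightarrow> prim f t"
  unfolding prim_def
proof (rule integral_dominated_convergence[where w="\<lambda>r. \<bar>f r\<bar>"])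
  have *: "(\<lambda>r. (if r < x then 1 else 0) * f r) \<in> borel_measurable \<mu>" for x
    using bounded_borel_measurable[OF bounded_borel_less[OF f]] by simp
  show "(\<lambda>r. (if r < t then 1 else 0) * f r) \<in> borel_measurable \<mu>"
    "(\<lambda>r. (if r < s n then 1 else 0) * f r) \<in> borel_measurable \<mu>" for n
    by (rule *)+
  show "integrable \<mu> (\<lambda>r. \<bar>f r\<bar>)" by (intro integrable_cell bounded_borel_abs f)
  show "AE r in \<mu>. norm ((if r < s n then 1 else 0) * f r) \<le> \<bar>f r\<bar>" for n by simp
  show "AE r in \<mu>. (\<lambda>n. (if r < s n then 1 else 0) * f r) \<longlonglongrightarrow> (if r < t then 1 else 0) * f r"
  proof (rule AE_I2)
    fix r
    have "\<forall>\<^sub>F n in sequentially. (if r < t then 1 else 0) * f r = (if r < s n then 1 else 0) * f r"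
    proof (cases "r < t")
      case True
      from order_tendstoD(1)[OF s(1) this] show ?thesis by eventually_elim (use True in simp)
    next
      case False
      then have "\<not> r < s n" for n using s(2)[of n] by simp
      then show ?thesis using False by simp
    qed
    then show "(\<lambda>n. (if r < s n then 1 else 0) * f r) \<longlonglongrightarrow> (if r < t then 1 else 0) * f r"
      by (rule Lim_transform_eventually[OF tendsto_const])
  qed
qed

text \<open>The derivatives along \<open>V\<close> are left-continuous, so replacing \<open>t\<close> by the grid point \<open>step n t\<close> below it
  and letting \<open>n\<close> tend to infinity does not change the integral.\<close>

lemma chain_inequality:
  fixes F :: "real ^ 'm::finite \<Rightarrow> real" and v :: "'m \<Rightarrow> real \<Rightarrow> real"
  assumes F: "F \<in> H_class R"
    and v: "\<And>i. bounded_borel (v i)" "\<And>i t. 0 \<le> v i t" and c: "0 \<le> c"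
    and top: "\<And>i. ereal (c * (\<integral>t. v i t \<partial>\<mu>)) < R"
  defines "V \<equiv> \<lambda>t. \<chi> i. c * prim (v i) t"
  shows "bounded_borel (\<lambda>t. partial_deriv i F (V t))"
    and "(\<integral>t. (\<Sum>i\<in>UNIV. partial_deriv i F (V t) * (c * v i t)) \<partial>\<mu>) \<le> F (\<chi> i. c * (\<integral>t. v i t \<partial>\<mu>))"
proof -
  let ?W = "\<chi> i. c * (\<integral>t. v i t \<partial>\<mu>)"
  define \<Theta> where "\<Theta> i t = partial_deriv i F (V t)" for i t
  have V0: "0 \<le> V t $ i" for t i using c v by (simp add: V_def prim_nonneg)
  have VW: "V t $ i \<le> ?W $ i" for t i using c v by (simp add: V_def prim_le_top mult_left_mono)
  have Vcube: "V t \<in> nonneg_cube R" for t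
  proof -
    have "ereal (V t $ i) < R" for i
      using le_less_trans[of "ereal (V t $ i)" "ereal (?W $ i)" R] VW[of t i] top[of i] by simp
    then show ?thesis using V0 by (simp add: nonneg_cube_def)
  qed
  have Wcube: "?W \<in> nonneg_cube R"
    using c v top by (auto simp: nonneg_cube_def intro!: mult_nonneg_nonneg integral_nonneg_AE)
  have V_mono: "V s $ i \<le> V t $ i" if "s \<le> t" for s t i
    using that c v by (auto simp: V_def intro!: mult_left_mono prim_incr)
  have \<Theta>0: "0 \<le> \<Theta> i t" for i t unfolding \<Theta>_def by (rule partial_deriv_nonneg[OF F Vcube])
  have \<Theta>W: "\<Theta> i t \<le> partial_deriv i F ?W" for i t
    unfolding \<Theta>_def by (rule partial_deriv_mono[OF F Vcube Wcube VW])
  have \<Theta>_mono: "\<Theta> i s \<le> \<Theta> i t" if "s \<le> t" for i s t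
    unfolding \<Theta>_def by (rule partial_deriv_mono[OF F Vcube Vcube V_mono[OF that]])
  have \<Theta>_meas: "\<Theta> i \<in> borel_measurable borel" for i
    by (rule borel_measurable_mono) (auto intro: monoI \<Theta>_mono)
  have \<Theta>bb: "bounded_borel (\<Theta> i)" for i
    by (rule bounded_borelI[OF \<Theta>_meas, of _ "partial_deriv i F ?W"]) (use \<Theta>0 \<Theta>W in auto)
  then show "bounded_borel (\<lambda>t. partial_deriv i F (V t))" by (simp add: \<Theta>_def[abs_def])
  \<comment> \<open>The grid of mesh 1/(n+1) starts at \<open>a\<close> and ignores
    \<open>T\<close>, which is possible because \<open>prim\<close> is defined on the whole
    line.\<close>
  define step where "step n t = a + of_int \<lfloor>(t - a) * real (Suc n)\<rfloor> / real (Suc n)" for n t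
  define h where "h n t = (\<Sum>i\<in>UNIV. \<Theta> i (step n t) * (c * v i t))" for n t
  have [measurable]: "step n \<in> borel_measurable borel" for n
    unfolding step_def[abs_def] by measurable
  have step_le: "step n t \<le> t" for n t
  proof -
    have "of_int \<lfloor>(t - a) * real (Suc n)\<rfloor> / real (Suc n) \<le> (t - a) * real (Suc n) / real (Suc n)"
      by (intro divide_right_mono of_int_floor_le) simp
    then show ?thesis by (simp add: step_def)
  qed
  have step_ge: "t - inverse (real (Suc n)) \<le> step n t" for n t
  proof -
    have "((t - a) * real (Suc n) - 1) / real (Suc n) \<le> of_int \<lfloor>(t - a) * real (Suc n)\<rfloor> / real (Suc n)"
      by (intro divide_right_mono) linarith+
    then show ?thesis by (simp add: step_def diff_divide_distrib inverse_eq_divide)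
  qed
  have step_tendsto: "(\<lambda>n. step n t) \<longlonglongrightarrow> t" for t
  proof (rule tendsto_sandwich)
    show "(\<lambda>n. t - inverse (real (Suc n))) \<longlonglongrightarrow> t"
      using tendsto_diff[OF tendsto_const LIMSEQ_inverse_real_of_nat, of t] by simp
  qed (use step_le step_ge in auto)
  have \<Theta>_step: "bounded_borel (\<lambda>t. \<Theta> i (step n t))" for i n
    using \<Theta>_meas[of i] by (intro bounded_borelI[of _ "partial_deriv i F ?W"]) (use \<Theta>0 \<Theta>W in auto)
  have hbb: "bounded_borel (h n)" for n
    unfolding h_def[abs_def]
    by (intro bounded_borel_sum bounded_borel_mult \<Theta>_step v(1) bounded_borel_const)
  \<comment> \<open>Telescoping over the grid: on one mesh the coefficients are frozen, so the
    integral is a gradient term and at most the increment of \<open>F\<close> along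
    \<open>V\<close>. The sum starts from V(a) = 0 and F(0) = 0.\<close>
  have "prim (h n) (a + real k / real (Suc n)) \<le> F (V (a + real k / real (Suc n)))" for n k
  proof (induction k)
    case 0
    have "V a = 0" by (simp add: V_def vec_eq_iff prim_base[OF v(1)])
    moreover have "F 0 = 0" using F by (simp add: H_class_def)
    ultimately show ?case by (simp add: prim_base[OF hbb])
  next
    case (Suc k)
    let ?x = "a + real k / real (Suc n)" and ?y = "a + real (Suc k) / real (Suc n)"
    have xy: "?x \<le> ?y" by (intro add_left_mono divide_right_mono) auto
    have step_eq: "step n t = ?x" if "?x \<le> t" "t < ?y" for t
    proof -
      have "real k \<le> (t - a) * real (Suc n)" using that(1) by (simp add: field_simps)
      moreover have "(t - a) * real (Suc n) < real k + 1" using that(2) by (simp add: field_simps)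
      ultimately have "\<lfloor>(t - a) * real (Suc n)\<rfloor> = int k" by (intro floor_unique) auto
      then show ?thesis by (simp add: step_def)
    qed
    have "prim (h n) ?y - prim (h n) ?x =
        prim (\<lambda>t. \<Sum>i\<in>UNIV. (\<Theta> i ?x * c) * v i t) ?y - prim (\<lambda>t. \<Sum>i\<in>UNIV. (\<Theta> i ?x * c) * v i t) ?x"
      by (intro prim_diff_eq hbb xy bounded_borel_sum bounded_borel_mult[OF bounded_borel_const] v(1))
        (simp add: h_def step_eq mult.assoc)
    also have "\<dots> = (\<Sum>i\<in>UNIV. \<Theta> i ?x * (V ?y $ i - V ?x $ i))"
      by (subst (1 2) prim_sum) (auto simp: v(1) V_def sum_subtractf[symmetric] algebra_simps)
    also have "\<dots> \<le> F (V ?y) - F (V ?x)"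
      unfolding \<Theta>_def by (intro gradient_le_increment[OF F] Vcube V_mono xy)
    finally show ?case using Suc by simp
  qed
  then have bound: "(\<integral>t. h n t \<partial>\<mu>) \<le> F ?W" for n
  proof -
    \<comment> \<open>Once the grid has passed \<open>b\<close>, the primitives are full
      integrals.\<close>
    obtain k :: nat where "(b - a) * real (Suc n) \<le> real k" using real_arch_simple by blast
    then have k: "b \<le> a + real k / real (Suc n)" by (simp add: field_simps)
    have "V (a + real k / real (Suc n)) = ?W" using prim_top[OF v(1) k] by (simp add: V_def)
    then show ?thesis
      using \<open>prim (h n) (a + real k / real (Suc n)) \<le> F (V (a + real k / real (Suc n)))\<close>
        prim_top[OF hbb k] by simp
  qed
  have "(\<lambda>n. \<integral>t. h n t \<partial>\<mu>) \<longlonglongrightarrow> (\<integral>t. (\<Sum>i\<in>UNIV. \<Theta> i t * (c * v i t)) \<partial>\<mu>)"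
  \<comment> \<open>Monotonicity bounds all coefficients by their values at the endpoint
    \<open>?W\<close>.\<close>
  proof (rule integral_dominated_convergence[where w="\<lambda>t. \<Sum>i\<in>UNIV. partial_deriv i F ?W * (c * v i t)"])
    show "(\<lambda>t. \<Sum>i\<in>UNIV. \<Theta> i t * (c * v i t)) \<in> borel_measurable \<mu>"
      using bounded_borel_measurable[OF v(1)] \<Theta>_meas by simp
    show "h n \<in> borel_measurable \<mu>" for n using bounded_borel_measurable[OF hbb] by simp
    show "integrable \<mu> (\<lambda>t. \<Sum>i\<in>UNIV. partial_deriv i F ?W * (c * v i t))"
      by (intro integrable_cell bounded_borel_sum bounded_borel_mult bounded_borel_const v(1))
    show "AE t in \<mu>. norm (h n t) \<le> (\<Sum>i\<in>UNIV. partial_deriv i F ?W * (c * v i t))" for n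
    proof (rule AE_I2)
      fix t
      have "0 \<le> h n t" unfolding h_def using \<Theta>0 c v(2) by (intro sum_nonneg mult_nonneg_nonneg)
      moreover have "h n t \<le> (\<Sum>i\<in>UNIV. partial_deriv i F ?W * (c * v i t))"
        unfolding h_def using \<Theta>W c v(2) by (intro sum_mono mult_right_mono mult_nonneg_nonneg)
      ultimately show "norm (h n t) \<le> (\<Sum>i\<in>UNIV. partial_deriv i F ?W * (c * v i t))" by simp
    qed
    show "AE t in \<mu>. (\<lambda>n. h n t) \<longlonglongrightarrow> (\<Sum>i\<in>UNIV. \<Theta> i t * (c * v i t))"
    proof (rule AE_I2)
      fix t
      have "(\<lambda>n. V (step n t)) \<longlonglongrightarrow> V t"
        unfolding V_def using step_tendsto step_le
        by (intro tendsto_vec_lambda tendsto_mult tendsto_const prim_left_continuous v(1)) auto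
      then have "(\<lambda>n. \<Theta> i (step n t)) \<longlonglongrightarrow> \<Theta> i t" for i
        unfolding \<Theta>_def using Vcube nonneg_cube_subset
        by (intro continuous_on_tendsto_compose[OF partial_deriv_cont[OF F]]) (auto intro!: always_eventually)
      then show "(\<lambda>n. h n t) \<longlonglongrightarrow> (\<Sum>i\<in>UNIV. \<Theta> i t * (c * v i t))"
        unfolding h_def by (intro tendsto_sum tendsto_mult tendsto_const)
    qed
  qed
  then have "(\<integral>t. (\<Sum>i\<in>UNIV. \<Theta> i t * (c * v i t)) \<partial>\<mu>) \<le> F ?W"
    by (rule LIMSEQ_le_const2) (use bound in auto)
  then show "(\<integral>t. (\<Sum>i\<in>UNIV. partial_deriv i F (V t) * (c * v i t)) \<partial>\<mu>) \<le> F ?W"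
    by (simp add: \<Theta>_def)
qed

end

section \<open>The inequality on the box\<close>

lemma measurable_vec_lambda:
  assumes "\<And>i. (\<lambda>x. f x i) \<in> borel_measurable M"
  shows "(\<lambda>x. (\<chi> i. f x i) :: real ^ 'm::finite) \<in> borel_measurable M"
  by (rule borel_measurable_euclidean_space[THEN iffD2])
    (use assms in \<open>auto simp: Basis_vec_def inner_axis\<close>)

lemma sym_cube_borel: "(sym_cube R :: (real ^ 'm::finite) set) \<in> sets borel"
proof -
  have m: "(\<lambda>x :: real ^ 'm. ereal \<bar>x $ i\<bar>) \<in> borel_measurable borel" for i
    by (intro borel_measurable_ereal borel_measurable_abs measurable_vec_nth)
  have "{x :: real ^ 'm. ereal \<bar>x $ i\<bar> < R} \<in> sets borel" for i
    using measurable_sets[OF m[of i], of "{..<R}"] by (simp add: vimage_def)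
  then have "(\<Inter>i. {x :: real ^ 'm. ereal \<bar>x $ i\<bar> < R}) \<in> sets borel"
    by (intro sets.finite_INT) auto
  moreover have "sym_cube R = (\<Inter>i. {x :: real ^ 'm. ereal \<bar>x $ i\<bar> < R})" by (auto simp: sym_cube_def)
  ultimately show ?thesis by simp
qed

section \<open>Iterated integrals over the whole box and the bound for iterated primitives\<close>

context ts_cuboid
begin

lemma E_integral: "E j \<phi> x = (\<integral>t. \<phi> (vec_upd x j t) \<partial>cell j)"
  by (simp add: E_def kernel_op_def)

definition EL :: "'n list \<Rightarrow> ((real, 'n) vec \<Rightarrow> real) \<Rightarrow> (real, 'n) vec \<Rightarrow> real" where
  "EL js \<phi> = foldr E js \<phi>"

lemma EL_simps [simp]: "EL [] \<phi> = \<phi>" "EL (j # js) \<phi> = E j (EL js \<phi>)"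
  by (simp_all add: EL_def)

lemma EL_bounded_borel: "bounded_borel \<phi> \<Longrightarrow> bounded_borel (EL js \<phi>)"
  by (induction js) (auto intro: E_bounded_borel)

lemma E_integrable: "bounded_borel \<phi> \<Longrightarrow> integrable (cell j) (\<lambda>t. \<phi> (vec_upd x j t))"
  by (intro I.integrable_cell bounded_borel_slice)

lemma EL_indep:
  assumes "\<And>i. i \<notin> set js \<Longrightarrow> x $ i = y $ i"
  shows "EL js \<phi> x = EL js \<phi> y"
  using assms
proof (induction js arbitrary: x y)
  case Nil
  then have "x = y" by (simp add: vec_eq_iff)
  then show ?case by simp
next
  case (Cons j js)
  have "EL js \<phi> (vec_upd x j t) = EL js \<phi> (vec_upd y j t)" for t
    using Cons.prems by (intro Cons.IH) auto
  then show ?case by (simp add: E_integral)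
qed

text \<open>Coordinates outside \<open>js\<close> keep their values from \<open>x\<close>, so a
  bound depending on them acts as a constant. In the theorem this is the bound by V at the first
  coordinate.\<close>

lemma EL_mono_slice:
  assumes "bounded_borel \<phi>" "bounded_borel \<psi>" "\<And>y. (\<And>i. i \<notin> set js \<Longrightarrow> y $ i = x $ i) \<Longrightarrow> \<phi> y \<le> \<psi> y"
  shows "EL js \<phi> x \<le> EL js \<psi> x"
  using assms(3)
proof (induction js arbitrary: x)
  case (Cons j js)
  have "EL js \<phi> (vec_upd x j t) \<le> EL js \<psi> (vec_upd x j t)" for t
    by (rule Cons.IH, rule Cons.prems) auto
  then show ?case using assms(1,2)
    by (simp add: E_integral) (intro integral_mono E_integrable EL_bounded_borel)
qed simp

lemma EL_nonneg:
  assumes "\<And>y. 0 \<le> \<phi> y"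
  shows "0 \<le> EL js \<phi> x"
  by (induction js arbitrary: x) (auto simp: assms E_integral intro: integral_nonneg_AE)

lemma EL_sum:
  assumes "\<And>i. i \<in> I \<Longrightarrow> bounded_borel (\<phi> i)"
  shows "EL js (\<lambda>y. \<Sum>i\<in>I. c i * \<phi> i y) x = (\<Sum>i\<in>I. c i * EL js (\<phi> i) x)"
proof (induction js arbitrary: x)
  case (Cons j js)
  have "EL (j # js) (\<lambda>y. \<Sum>i\<in>I. c i * \<phi> i y) x = (\<integral>t. (\<Sum>i\<in>I. c i * EL js (\<phi> i) (vec_upd x j t)) \<partial>cell j)"
    by (simp add: E_integral Cons.IH)
  also have "\<dots> = (\<Sum>i\<in>I. \<integral>t. c i * EL js (\<phi> i) (vec_upd x j t) \<partial>cell j)"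
    using assms by (intro Bochner_Integration.integral_sum integrable_mult_right E_integrable EL_bounded_borel)
  finally show ?case by (simp add: E_integral)
qed simp

text \<open>Agreement of \<open>g\<close> and \<open>\<phi>\<close> on the box is enough, because
  integration over \<open>T j\<close> in \<open>{a $ j..<b $ j}\<close> keeps each new coordinate
  inside it. With \<open>js\<close> listing all variables the condition on the base point is
  void.\<close>

lemma iter_delta_integral_EL:
  assumes \<phi>: "bounded_borel \<phi>" and eq: "\<And>y. y \<in> ts_box T a b \<Longrightarrow> g y = \<phi> y"
    and x: "\<And>i. i \<notin> set js \<Longrightarrow> x $ i \<in> T i \<and> a $ i \<le> x $ i \<and> x $ i < b $ i"
  shows "iter_delta_integral T a b js g x = EL js \<phi> x"
  using x
proof (induction js arbitrary: x)
  case Nil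
  then have "x \<in> ts_box T a b" by (auto simp: ts_box_def ts_prod_def less_imp_le)
  then show ?case using eq by simp
next
  case (Cons j js)
  have "delta_integral (T j) (a $ j) (b $ j) (\<lambda>t. iter_delta_integral T a b js g (vec_upd x j t))
      = (\<integral>t. indicator {a $ j..<b $ j} t * EL js \<phi> (vec_upd x j t) \<partial>cell j)"
  proof (rule I.delta_integral_cell)
    show "bounded_borel (\<lambda>t. EL js \<phi> (vec_upd x j t))"
      by (intro bounded_borel_slice EL_bounded_borel \<phi>)
    show "iter_delta_integral T a b js g (vec_upd x j t) = EL js \<phi> (vec_upd x j t)"
      if "t \<in> T j" "a $ j \<le> t" "t < b $ j" for t
      using that Cons.prems by (intro Cons.IH) auto
  qed (use ab[of j] in auto)
  also have "\<dots> = (\<integral>t. EL js \<phi> (vec_upd x j t) \<partial>cell j)"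
  proof (rule integral_cong_AE)
    have [measurable]: "(\<lambda>t. EL js \<phi> (vec_upd x j t)) \<in> borel_measurable borel"
      by (intro bounded_borel_measurable bounded_borel_slice EL_bounded_borel \<phi>)
    show "(\<lambda>t. indicator {a $ j..<b $ j} t * EL js \<phi> (vec_upd x j t)) \<in> borel_measurable (cell j)"
      "(\<lambda>t. EL js \<phi> (vec_upd x j t)) \<in> borel_measurable (cell j)" by measurable
    show "AE t in cell j. indicator {a $ j..<b $ j} t * EL js \<phi> (vec_upd x j t) = EL js \<phi> (vec_upd x j t)"
      using I.AE_cell[of j] by eventually_elim (simp add: indicator_def)
  qed
  finally show ?case by (simp add: E_integral)
qed

lemma box_delta_integral_EL:
  assumes "bounded_borel \<phi>" "\<And>y. y \<in> ts_box T a b \<Longrightarrow> g y = \<phi> y"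
  shows "box_delta_integral T a b g = EL (sorted_list_of_set UNIV) \<phi> 0"
  unfolding box_delta_integral_def using assms by (intro iter_delta_integral_EL) auto

lemma JL_abs_le:
  assumes "bounded_borel \<phi>" "bounded_borel \<psi>" "\<And>y. \<bar>\<phi> y\<bar> \<le> \<psi> y"
  shows "\<bar>JL js \<phi> x\<bar> \<le> JL js \<psi> x"
proof (induction js arbitrary: x)
  case (Cons j js)
  have bb: "bounded_borel (\<lambda>t. JL js \<phi> (vec_upd x j t))" "bounded_borel (\<lambda>t. JL js \<psi> (vec_upd x j t))"
    by (intro bounded_borel_slice JL_bounded_borel assms)+
  have "\<bar>J j (JL js \<phi>) x\<bar> \<le> (\<integral>t. \<bar>(if t < x $ j then 1 else 0) * JL js \<phi> (vec_upd x j t)\<bar> \<partial>cell j)"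
    unfolding J_prim I.prim_def by (rule integral_abs_bound)
  also have "\<dots> \<le> (\<integral>t. (if t < x $ j then 1 else 0) * JL js \<psi> (vec_upd x j t) \<partial>cell j)"
    using Cons.IH
    by (intro integral_mono I.integrable_cell bounded_borel_abs I.bounded_borel_less bb) (auto simp: abs_mult)
  finally show ?case by (simp add: J_prim I.prim_def)
qed (use assms in auto)

definition hmax :: "'n \<Rightarrow> real" where
  "hmax j = ts_monomial (T j) (lam j - 1) (b $ j) (fwd_jump (T j) (a $ j))"

lemma hmax_eq: "hmax j = I.mono_ext j (fwd_jump (T j) (a $ j)) (lam j - 1) (b $ j)"
  unfolding hmax_def using fwd_jump_ge[OF a_in] fwd_jump_ge_le(2)[OF b_in ab]
  by (intro I.ts_monomial_eq) auto

lemma hmax_pos: "0 < hmax j"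
  unfolding hmax_eq by (intro I.mono_ext_pos b_in ab_rho) simp

lemma JL_block_le:
  assumes "bounded_borel \<phi>" "\<And>y. 0 \<le> \<phi> y" "x $ j \<le> b $ j"
  shows "JL (replicate (lam j) j) \<phi> x \<le> hmax j * J j \<phi> x"
proof -
  let ?f = "\<lambda>t. \<phi> (vec_upd x j t)"
  obtain l where l: "lam j = Suc l" using lam[of j] by (cases "lam j") auto
  have f: "bounded_borel ?f" "\<And>t. 0 \<le> ?f t" using assms by (auto intro: bounded_borel_slice)
  have "JL (replicate (lam j) j) \<phi> x = (I.prim j ^^ Suc l) ?f (x $ j)" by (simp only: JL_replicate l)
  also have "\<dots> \<le> I.mono_ext j (fwd_jump (T j) (a $ j)) l (x $ j) * I.prim j ?f (x $ j)"
    by (rule I.prim_iter_le[OF f])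
  also have "\<dots> \<le> hmax j * I.prim j ?f (x $ j)"
    unfolding hmax_eq l using assms(3) I.prim_nonneg[OF f]
    by (intro mult_right_mono) (auto intro: I.mono_ext_incr)
  finally show ?thesis by (simp add: J_prim)
qed

lemma JL_nonneg:
  assumes "bounded_borel \<phi>" "\<And>y. 0 \<le> \<phi> y"
  shows "0 \<le> JL js \<phi> x"
  using JL_abs_le[OF assms(1,1), of js x] assms(2) by simp

lemma J_le_E:
  assumes "bounded_borel \<phi>" "\<And>y. 0 \<le> \<phi> y"
  shows "J j \<phi> x \<le> E j \<phi> x"
  unfolding J_prim E_integral using assms by (intro I.prim_le_top bounded_borel_slice) auto

lemma J_scale: "J j (\<lambda>y. c * \<phi> y) x = c * J j \<phi> x"
  by (simp add: J_prim I.prim_def mult.left_commute)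

lemma blocks_Cons: "blocks (j # js) = replicate (lam j) j @ blocks js"
  by (simp add: blocks_def)

text \<open>Only the first variable keeps its own upper limit, while every later primitive is
  enlarged to the integral over the whole cell. When \<open>js\<close> lists all other variables,
  the bound thus depends on \<open>x $ j\<close> alone.\<close>

lemma JL_blocks_Cons_le:
  assumes "bounded_borel \<phi>" "\<And>y. 0 \<le> \<phi> y" "x \<in> ts_box T a b"
  shows "JL (blocks (j # js)) \<phi> x \<le> (\<Prod>i\<leftarrow>j # js. hmax i) * J j (EL js \<phi>) x"
  using assms(3)
proof (induction js arbitrary: j x)
  case Nil
  then show ?case using JL_block_le[OF assms(1,2), of x j]
    by (simp add: blocks_def ts_box_def)
next
  case (Cons k js)
  let ?p = "\<Prod>i\<leftarrow>k # js. hmax i" and ?u = "JL (blocks (k # js)) \<phi>"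
  have p: "0 \<le> ?p" by (intro prod_list_nonneg) (auto simp: hmax_pos less_imp_le)
  have u: "bounded_borel ?u" "\<And>y. 0 \<le> ?u y"
    by (auto intro: JL_bounded_borel JL_nonneg assms(1,2))
  have e: "bounded_borel (EL js \<phi>)" "\<And>y. 0 \<le> EL js \<phi> y"
    by (auto intro: EL_bounded_borel EL_nonneg assms(1,2))
  have "JL (blocks (j # k # js)) \<phi> x = JL (replicate (lam j) j) ?u x"
    by (simp only: blocks_Cons[of j] JL_simps)
  also have "\<dots> \<le> hmax j * J j ?u x"
    using Cons.prems by (intro JL_block_le u) (simp add: ts_box_def)
  also have "J j ?u x \<le> J j (\<lambda>y. ?p * EL (k # js) \<phi> y) x"
  proof (rule J_mono[OF _ u(1)])
    show "bounded_borel (\<lambda>y. ?p * EL (k # js) \<phi> y)"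
      by (intro bounded_borel_mult[OF bounded_borel_const] EL_bounded_borel assms)
    fix t assume "t \<in> T j" "a $ j \<le> t" "t < b $ j"
    then have "vec_upd x j t \<in> ts_box T a b" using Cons.prems by (auto simp: ts_box_def ts_prod_def)
    from Cons.IH[OF this, of k]
    have "?u (vec_upd x j t) \<le> ?p * J k (EL js \<phi>) (vec_upd x j t)" .
    also have "\<dots> \<le> ?p * E k (EL js \<phi>) (vec_upd x j t)"
      using p by (intro mult_left_mono J_le_E e)
    finally show "?u (vec_upd x j t) \<le> ?p * EL (k # js) \<phi> (vec_upd x j t)" by simp
  qed
  finally show ?case using hmax_pos[of j] by (simp add: J_scale mult.assoc)
qed

end

theorem theorem3p2:
  fixes T :: "'n::{finite,linorder} \<Rightarrow> real set"
    and a b :: "(real, 'n) vec"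
    and lam :: "'n \<Rightarrow> nat"
    and R :: ereal
    and F :: "real ^ 'm::finite \<Rightarrow> real"
    and f :: "'m \<Rightarrow> (real, 'n) vec \<Rightarrow> real"
  assumes "\<And>j. time_scale (T j)"
    and "\<And>j. 1 \<le> lam j"
    and "a \<in> ts_prod T" and "b \<in> ts_prod T"
    and "\<And>j. a $ j < (bwd_jump (T j) ^^ (lam j - 1)) (b $ j)"
    and "0 < R"
    and "F \<in> H_class R"
    and "\<And>i x. x \<in> ts_box T a b \<Longrightarrow> ereal \<bar>f i x\<bar> < R"
    and "\<And>i. ereal (H_kernel T lam b a *
                box_delta_integral T a b (\<lambda>x. \<bar>mixed_delta T lam (f i) x\<bar>)) < R"
    and "\<And>i. f i \<in> L1_class T a b lam"
  shows "box_delta_integral T a b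
           (\<lambda>x. \<Sum>i\<in>UNIV. partial_deriv i F (\<chi> l. \<bar>f l x\<bar>) * \<bar>mixed_delta T lam (f i) x\<bar>)
         \<le> 1 / H_kernel T lam b a *
            F (\<chi> i. H_kernel T lam b a *
                 box_delta_integral T a b (\<lambda>x. \<bar>mixed_delta T lam (f i) x\<bar>))"
proof -
  interpret ts_cuboid T a b lam by unfold_locales (use assms in auto)
  let ?sl = "sorted_list_of_set (UNIV :: 'n set)"
  let ?B = "indicator (ts_box T a b) :: (real, 'n) vec \<Rightarrow> real"
  define H where "H = H_kernel T lam b a"
  define w where "w i x = ?B x * \<bar>mixed_delta T lam (f i) x\<bar>" for i x
  define W where "W i = box_delta_integral T a b (\<lambda>x. \<bar>mixed_delta T lam (f i) x\<bar>)" for i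
  have HW: "ereal (H * W i) < R" for i using assms(9) by (simp add: H_def W_def)
  have Hprod: "H = (\<Prod>i\<leftarrow>?sl. hmax i)"
  proof -
    have "H = (\<Prod>i\<in>UNIV. hmax i)" by (simp add: H_def H_kernel_def hmax_def)
    then show ?thesis using prod.distinct_set_conv_list[of ?sl hmax] by simp
  qed
  have H: "0 < H" unfolding H_def H_kernel_def using hmax_pos by (intro prod_pos) (auto simp: hmax_def)
  have C: "f i \<in> C_rd T a b lam" for i using assms(10)[of i] by (simp add: L1_class_def)
  have wbb: "bounded_borel (w i)" for i
    using bounded_borel_abs[OF mixed_delta_bounded_borel[OF C[of i]]]
    by (simp add: w_def[abs_def] abs_mult)
  have w0: "0 \<le> w i x" for i x by (simp add: w_def)
  have W: "W i = EL ?sl (w i) 0" for i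
    unfolding W_def by (rule box_delta_integral_EL[OF wbb]) (simp add: w_def)
  obtain j js where sl: "?sl = j # js" by (cases ?sl) auto
  \<comment> \<open>Up to the factor H, the density of V in the first variable: the absolute
    derivative integrated over all the others.\<close>
  define v where "v i t = EL js (w i) (vec_upd 0 j t)" for i t
  have vbb: "bounded_borel (v i)" for i
    unfolding v_def[abs_def] by (intro bounded_borel_slice EL_bounded_borel wbb)
  have v0: "0 \<le> v i t" for i t unfolding v_def by (intro EL_nonneg w0)
  have Wv: "W i = (\<integral>t. v i t \<partial>cell j)" for i by (simp add: W sl E_integral v_def)
  have j_js: "set js = - {j}"
  proof -
    have "insert j (set js) = UNIV" "j \<notin> set js"
      using set_sorted_list_of_set[of "UNIV :: 'n set"] distinct_sorted_list_of_set[of "UNIV :: 'n set"]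
      unfolding sl by simp_all
    then show ?thesis by blast
  qed
  have J_v: "J j (EL js (w i)) x = I.prim j (v i) (x $ j)" for i x
  proof -
    have "EL js (w i) (vec_upd x j t) = v i t" for t
      unfolding v_def using j_js by (intro EL_indep) auto
    then show ?thesis by (simp add: J_prim)
  qed
  have f_le: "\<bar>f i x\<bar> \<le> H * I.prim j (v i) (x $ j)" if x: "x \<in> ts_box T a b" for i x
  proof -
    \<comment> \<open>The representation involves the derivative on \<open>Q lam\<close> only, a
      subset of the box, so \<open>w\<close> dominates it.\<close>
    have "\<bar>indicator (Q lam) y * mixed_delta T lam (f i) y\<bar> \<le> w i y" for y
      by (auto simp: w_def indicator_def Q_def)
    then have "\<bar>f i x\<bar> \<le> JL (blocks ?sl) (w i) x"
      unfolding representation(1)[OF assms(10) x] by (intro JL_abs_le representation(2) assms(10) wbb)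
    also have "\<dots> \<le> H * J j (EL js (w i)) x"
      unfolding Hprod sl by (rule JL_blocks_Cons_le[OF wbb w0 x])
    finally show ?thesis by (simp add: J_v)
  qed
  define V where "V t = (\<chi> i. H * I.prim j (v i) t)" for t
  have Vcube: "V t \<in> nonneg_cube R" for t
  proof -
    have "H * I.prim j (v i) t \<le> H * W i" for i
      unfolding Wv using H by (intro mult_left_mono I.prim_le_top vbb v0) simp
    then have "ereal (H * I.prim j (v i) t) < R" for i
      using le_less_trans[OF _ HW, of "ereal (H * I.prim j (v i) t)" i] by simp
    then show ?thesis using H by (simp add: V_def nonneg_cube_def I.prim_nonneg vbb v0)
  qed
  have top: "ereal (H * (\<integral>t. v i t \<partial>cell j)) < R" for i using HW[of i] by (simp add: Wv)
  have \<Theta>bb: "bounded_borel (\<lambda>t. partial_deriv i F (V t))" for i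
    unfolding V_def by (rule I.chain_inequality(1)[OF assms(7) vbb v0 less_imp_le[OF H] top])
  have chain: "(\<integral>t. (\<Sum>i\<in>UNIV. partial_deriv i F (V t) * (H * v i t)) \<partial>cell j) \<le> F (\<chi> i. H * W i)"
    unfolding V_def Wv by (rule I.chain_inequality(2)[OF assms(7) vbb v0 less_imp_le[OF H] top])
  \<comment> \<open>Measurability of \<open>f l\<close> is known on the box only, hence the inner
    cut-off. The outer one makes \<open>D i\<close> vanish elsewhere, so that \<open>D_le\<close>
    holds at every point.\<close>
  define D where "D i x = ?B x * partial_deriv i F (\<chi> l. \<bar>?B x * f l x\<bar>)" for i x
  have fcube: "(\<chi> l. \<bar>f l x\<bar>) \<in> nonneg_cube R" if "x \<in> ts_box T a b" for x
    using assms(8)[OF that] by (simp add: nonneg_cube_def)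
  have D_le: "0 \<le> D i x" "D i x \<le> partial_deriv i F (V (x $ j))" for i x
  proof -
    have "0 \<le> D i x \<and> D i x \<le> partial_deriv i F (V (x $ j))"
    proof (cases "x \<in> ts_box T a b")
      case True
      have "partial_deriv i F (\<chi> l. \<bar>f l x\<bar>) \<le> partial_deriv i F (V (x $ j))"
        using f_le[OF True] by (intro partial_deriv_mono[OF assms(7) fcube[OF True] Vcube]) (simp add: V_def)
      then show ?thesis using True partial_deriv_nonneg[OF assms(7) fcube[OF True]] by (simp add: D_def)
    next
      case False
      then show ?thesis using partial_deriv_nonneg[OF assms(7) Vcube] by (simp add: D_def)
    qed
    then show "0 \<le> D i x" "D i x \<le> partial_deriv i F (V (x $ j))" by auto
  qed
  have Dbb: "bounded_borel (D i)" for i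
  proof -
    from \<Theta>bb[of i] obtain K where K: "\<And>t. \<bar>partial_deriv i F (V t)\<bar> \<le> K"
      unfolding bounded_borel_def by blast
    have fm: "(\<lambda>x. ?B x * f l x) \<in> borel_measurable borel" for l
    proof -
      \<comment> \<open>Measurability of \<open>f l\<close> on the box is read off from its
        representation as an iterated integral.\<close>
      have eq: "(\<lambda>x. ?B x * f l x) =
          (\<lambda>x. ?B x * JL (blocks ?sl) (\<lambda>y. indicator (Q lam) y * mixed_delta T lam (f l) y) x)"
        using representation(1)[OF assms(10), of _ l] by (auto simp: indicator_def fun_eq_iff)
      show ?thesis unfolding eq
        by (intro bounded_borel_measurable bounded_borel_mult bounded_borel_indicator meas_box
            JL_bounded_borel representation(2) assms(10))
    qed
    \<comment> \<open>The partial derivative is continuous on the cube only; extended by 0 it is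
      Borel, and on the box its argument stays in the cube.\<close>
    let ?P = "\<lambda>y. indicator (sym_cube R) y *\<^sub>R partial_deriv i F y"
    have "?P \<in> borel_measurable borel"
      by (rule borel_measurable_continuous_on_indicator[OF sym_cube_borel partial_deriv_cont[OF assms(7)]])
    moreover have "(\<lambda>x. \<chi> l. \<bar>?B x * f l x\<bar>) \<in> borel_measurable borel"
      by (intro measurable_vec_lambda borel_measurable_abs fm)
    ultimately have "(\<lambda>x. ?P (\<chi> l. \<bar>?B x * f l x\<bar>)) \<in> borel_measurable borel"
      by (rule measurable_compose[rotated])
    then have "(\<lambda>x. ?B x * ?P (\<chi> l. \<bar>?B x * f l x\<bar>)) \<in> borel_measurable borel"
      by (intro borel_measurable_times borel_measurable_indicator meas_box)
    moreover have "?B x * ?P (\<chi> l. \<bar>?B x * f l x\<bar>) = D i x" for x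
    proof (cases "x \<in> ts_box T a b")
      case True
      then have "(\<chi> l. \<bar>f l x\<bar>) \<in> sym_cube R" using fcube[OF True] nonneg_cube_subset by blast
      then show ?thesis using True by (simp add: D_def)
    qed (simp add: D_def)
    ultimately have "D i \<in> borel_measurable borel" by simp
    then show ?thesis
    proof (rule bounded_borelI)
      show "\<bar>D i x\<bar> \<le> K" for x
        using D_le[of i x] abs_le_D1[OF K[of "x $ j"]] by simp
    qed
  qed
  define g where "g x = (\<Sum>i\<in>UNIV. D i x * w i x)" for x
  have gbb: "bounded_borel g"
    unfolding g_def[abs_def] by (intro bounded_borel_sum bounded_borel_mult Dbb wbb)
  have "box_delta_integral T a b
      (\<lambda>x. \<Sum>i\<in>UNIV. partial_deriv i F (\<chi> l. \<bar>f l x\<bar>) * \<bar>mixed_delta T lam (f i) x\<bar>) = EL ?sl g 0"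
    by (rule box_delta_integral_EL[OF gbb]) (simp add: g_def D_def w_def)
  also have "\<dots> = (\<integral>t. EL js g (vec_upd 0 j t) \<partial>cell j)" by (simp add: sl E_integral)
  \<comment> \<open>With the first coordinate fixed at \<open>t\<close> the coefficients are bounded
    by constants, so the remaining integrals of \<open>w i\<close> give exactly
    \<open>v i t\<close>.\<close>
  also have "\<dots> \<le> (\<integral>t. (\<Sum>i\<in>UNIV. partial_deriv i F (V t) * v i t) \<partial>cell j)"
  proof (rule integral_mono)
    show "integrable (cell j) (\<lambda>t. EL js g (vec_upd 0 j t))"
      by (intro E_integrable EL_bounded_borel gbb)
    show "integrable (cell j) (\<lambda>t. \<Sum>i\<in>UNIV. partial_deriv i F (V t) * v i t)"
      by (intro I.integrable_cell bounded_borel_sum bounded_borel_mult \<Theta>bb vbb)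
    fix t
    have "EL js g (vec_upd 0 j t) \<le> EL js (\<lambda>y. \<Sum>i\<in>UNIV. partial_deriv i F (V t) * w i y) (vec_upd 0 j t)"
    proof (rule EL_mono_slice[OF gbb])
      show "bounded_borel (\<lambda>y. \<Sum>i\<in>UNIV. partial_deriv i F (V t) * w i y)"
        by (intro bounded_borel_sum bounded_borel_mult[OF bounded_borel_const] wbb)
      fix y :: "(real, 'n) vec" assume "\<And>i. i \<notin> set js \<Longrightarrow> y $ i = vec_upd 0 j t $ i"
      then have "y $ j = t" using j_js by simp
      then show "g y \<le> (\<Sum>i\<in>UNIV. partial_deriv i F (V t) * w i y)"
        unfolding g_def using D_le(2)[of _ y] w0 by (intro sum_mono mult_right_mono) auto
    qed
    also have "\<dots> = (\<Sum>i\<in>UNIV. partial_deriv i F (V t) * v i t)"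
      unfolding v_def by (rule EL_sum) (rule wbb)
    finally show "EL js g (vec_upd 0 j t) \<le> (\<Sum>i\<in>UNIV. partial_deriv i F (V t) * v i t)" .
  qed
  \<comment> \<open>The path V has density \<open>H * v i\<close>, so H is inserted here and divided
    out again.\<close>
  also have "\<dots> = 1 / H * (\<integral>t. (\<Sum>i\<in>UNIV. partial_deriv i F (V t) * (H * v i t)) \<partial>cell j)"
  proof -
    have "(\<Sum>i\<in>UNIV. partial_deriv i F (V t) * (H * v i t)) = H * (\<Sum>i\<in>UNIV. partial_deriv i F (V t) * v i t)" for t
      by (simp add: sum_distrib_left mult.left_commute)
    then show ?thesis using H by simp
  qed
  also have "\<dots> \<le> 1 / H * F (\<chi> i. H * W i)"
    using chain H by (intro mult_left_mono) auto
  finally show ?thesis unfolding H_def W_def .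
qed

end
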